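(* Let $(X,\mathcal{B}_X,\mu,T)$ be a $\mathbb{Z}^2$-measure preserving dynamical system and let $\vec{v}=(1,\beta)$ with $\beta\in\mathbb{R}$ irrational. For any $b\in(0,\infty)$, the following conditions are equivalent. (a) $(X,\mathcal{B}_X,\mu,T)$ is $\vec{v}$-weakly mixing. (b) For any infinite subset $Q=\{(m_i,n_i)\}_{i=1}^\infty$ of $\Lambda_+^{\vec{v}}(b)$ with $\underline{D}_b(Q)>0$, one has $$\lim_{N\to\infty}\left\|\frac{1}{N}\sum_{i=1}^{N}U_T^{(m_i,n_i)}f-\int_X f\,d\mu\right\|_2=0$$ for all $f\in L^2(X,\mathcal{B}_X,\mu)$.
   Context: A $\mathbb{Z}^2$-measure preserving dynamical system $(X,\mathcal{B}_X,\mu,T)$ consists of a compact metric space $X$, its Borel $\sigma$-algebra $\mathcal{B}_X$, a group homomorphism $(m,n)\mapsto T^{(m,n)}$ from the additive group $\mathbb{Z}^2$ to the group of homeomorphisms of $X$, and a Borel probability measure $\mu$ invariant under every $T^{(m,n)}$. For $f\in L^2(X,\mathcal{B}_X,\mu)$, $U_T^{(m,n)}f=f\circ T^{(m,n)}$; $1_B$ is the indicator function of $B$; $\|\cdot\|_2$ is the $L^2(\mu)$-norm. For $\vec{v}=(1,\beta)$ and $b\in(0,\infty)$, $\Lambda^{\vec{v}}(b)=\{(m,n)\in\mathbb{Z}^2:\beta m-b\le n\le\beta m+b\}$, $\Lambda_+^{\vec{v}}(b)=\Lambda^{\vec{v}}(b)\cap(\mathbb{Z}_+\times\mathbb{Z})$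 with $\mathbb{Z}_+$ the non-negative integers, and for $k\in\mathbb{N}$, $\Lambda_k^{\vec{v}}(b)=\Lambda^{\vec{v}}(b)\cap([0,k-1]\times\mathbb{Z})$. For an infinite $Q\subset\Lambda_+^{\vec{v}}(b)$, the lower density of $Q$ in $\Lambda_+^{\vec{v}}(b)$ is $$\underline{D}_b(Q)=\liminf_{k\to\infty}\frac{\#(Q\cap([0,k-1]\times\mathbb{Z}))}{\#(\Lambda_k^{\vec{v}}(b))}.$$ The directional Kronecker algebra $\mathcal{K}_\mu^{\vec{v}}$ is the $\sigma$-algebra of all $B\in\mathcal{B}_X$ such that the closure of $\{U_T^{(m,n)}1_B:(m,n)\in\Lambda^{\vec{v}}(b)\}$ is compact in $L^2(X,\mathcal{B}_X,\mu)$; it does not depend on the choice of $b\in(0,\infty)$. The system is called $\vec{v}$-weakly mixing if $\mathcal{K}_\mu^{\vec{v}}=\{X,\emptyset\}$, understood modulo $\mu$-null sets (every $B\in\mathcal{K}_\mu^{\vec{v}}$ has $\mu(B)\in\{0,1\}$).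
   Formalization: In (b) the points (m_i,n_i) of Q are listed without repetition with nondecreasing first coordinate m_i (ties in any order); for arbitrary enumerations (a) does not imply (b), e.g. for T^{(m,n)}=S^m with S weakly mixing and rigid. *)

theory Defs
  imports "HOL-Probability.Probability"
begin

section \<open>The space of square-integrable functions\<close>

definition L2_fun :: "'a measure \<Rightarrow> ('a \<Rightarrow> complex) set" where
  "L2_fun M = {f \<in> borel_measurable M. integrable M (\<lambda>x. (cmod (f x))\<^sup>2)}"

definition L2_norm :: "'a measure \<Rightarrow> ('a \<Rightarrow> complex) \<Rightarrow> real" where
  "L2_norm M f = sqrt (\<integral>x. (cmod (f x))\<^sup>2 \<partial>M)"

definition L2_rel :: "'a measure \<Rightarrow> (('a \<Rightarrow> complex) \<times> ('a \<Rightarrow> complex)) set" where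
  "L2_rel M = {(f, g). f \<in> L2_fun M \<and> g \<in> L2_fun M \<and> (AE x in M. f x = g x)}"

definition L2_class :: "'a measure \<Rightarrow> ('a \<Rightarrow> complex) \<Rightarrow> ('a \<Rightarrow> complex) set" where
  "L2_class M f = L2_rel M `` {f}"

definition L2_space :: "'a measure \<Rightarrow> ('a \<Rightarrow> complex) set set" where
  "L2_space M = L2_fun M // L2_rel M"

text \<open>The distance does not depend on the chosen representatives, see \<open>L2_dist_class\<close> below.\<close>

definition L2_dist :: "'a measure \<Rightarrow> ('a \<Rightarrow> complex) set \<Rightarrow> ('a \<Rightarrow> complex) set \<Rightarrow> real" where
  "L2_dist M F G = L2_norm M (\<lambda>x. (SOME f. f \<in> F) x - (SOME g. g \<in> G) x)"

definition L2_topology :: "'a measure \<Rightarrow> ('a \<Rightarrow> complex) set topology" where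
  "L2_topology M = Metric_space.mtopology (L2_space M) (L2_dist M)"

lemma L2_fun_diff:
  assumes "f \<in> L2_fun M" "g \<in> L2_fun M"
  shows "(\<lambda>x. f x - g x) \<in> L2_fun M"
proof -
  have meas [measurable]: "f \<in> borel_measurable M" "g \<in> borel_measurable M"
    using assms by (auto simp: L2_fun_def)
  have "integrable M (\<lambda>x. 2 * (cmod (f x))\<^sup>2 + 2 * (cmod (g x))\<^sup>2)"
    using assms by (auto simp: L2_fun_def)
  then have "integrable M (\<lambda>x. (cmod (f x - g x))\<^sup>2)"
  proof (rule Bochner_Integration.integrable_bound)
    have "(cmod (f x - g x))\<^sup>2 \<le> 2 * (cmod (f x))\<^sup>2 + 2 * (cmod (g x))\<^sup>2" for x
    proof -
      have "(cmod (f x - g x))\<^sup>2 \<le> (cmod (f x) + cmod (g x))\<^sup>2"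
        by (simp add: norm_triangle_ineq4 power_mono)
      also have "\<dots> \<le> 2 * (cmod (f x))\<^sup>2 + 2 * (cmod (g x))\<^sup>2"
        using sum_squares_bound[of "cmod (f x)" "cmod (g x)"] by (simp add: power2_sum)
      finally show ?thesis .
    qed
    then show "AE x in M. norm ((cmod (f x - g x))\<^sup>2)
        \<le> norm (2 * (cmod (f x))\<^sup>2 + 2 * (cmod (g x))\<^sup>2)"
      by auto
  qed measurable
  then show ?thesis by (auto simp: L2_fun_def)
qed

lemma L2_norm_minkowski:
  assumes f: "f \<in> L2_fun M" and g: "g \<in> L2_fun M"
  shows "L2_norm M (\<lambda>x. f x - g x) \<le> L2_norm M f + L2_norm M g"
proof -
  have meas [measurable]: "f \<in> borel_measurable M" "g \<in> borel_measurable M"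
    and int [simp]: "integrable M (\<lambda>x. (cmod (f x))\<^sup>2)" "integrable M (\<lambda>x. (cmod (g x))\<^sup>2)"
    using assms by (auto simp: L2_fun_def)
  have int_diff: "integrable M (\<lambda>x. (cmod (f x - g x))\<^sup>2)"
    using L2_fun_diff[OF assms] by (auto simp: L2_fun_def)
  have int_prod [simp]: "integrable M (\<lambda>x. cmod (f x) * cmod (g x))"
  proof (rule Bochner_Integration.integrable_bound)
    show "integrable M (\<lambda>x. (cmod (f x))\<^sup>2 + (cmod (g x))\<^sup>2)" by simp
    have "cmod (f x) * cmod (g x) \<le> (cmod (f x))\<^sup>2 + (cmod (g x))\<^sup>2" for x
    proof -
      have "0 \<le> cmod (f x) * cmod (g x)" by simp
      then show ?thesis using sum_squares_bound[of "cmod (f x)" "cmod (g x)"] by linarith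
    qed
    then show "AE x in M. norm (cmod (f x) * cmod (g x)) \<le> norm ((cmod (f x))\<^sup>2 + (cmod (g x))\<^sup>2)"
      by auto
  qed measurable
  define A B C where "A = (\<integral>x. (cmod (f x))\<^sup>2 \<partial>M)" and "B = (\<integral>x. (cmod (g x))\<^sup>2 \<partial>M)"
    and "C = (\<integral>x. cmod (f x) * cmod (g x) \<partial>M)"
  have nonneg: "0 \<le> A" "0 \<le> B" "0 \<le> C" by (auto simp: A_def B_def C_def)
  have "(\<integral>\<^sup>+x. ennreal (cmod (f x)) * ennreal (cmod (g x)) \<partial>M)\<^sup>2
      \<le> (\<integral>\<^sup>+x. (ennreal (cmod (f x)))\<^sup>2 \<partial>M) * (\<integral>\<^sup>+x. (ennreal (cmod (g x)))\<^sup>2 \<partial>M)"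
    by (rule Cauchy_Schwarz_nn_integral) auto
  then have "(ennreal C)\<^sup>2 \<le> ennreal A * ennreal B"
    by (simp add: A_def B_def C_def ennreal_mult[symmetric] ennreal_power nn_integral_eq_integral)
  then have "C\<^sup>2 \<le> A * B"
    using nonneg by (simp add: ennreal_mult[symmetric] ennreal_power)
  then have C: "C \<le> sqrt A * sqrt B"
    using real_le_rsqrt by (simp add: real_sqrt_mult[symmetric])
  have "(\<integral>x. (cmod (f x - g x))\<^sup>2 \<partial>M)
      \<le> (\<integral>x. (cmod (f x))\<^sup>2 + (cmod (g x))\<^sup>2 + 2 * (cmod (f x) * cmod (g x)) \<partial>M)"
  proof (rule integral_mono[OF int_diff])
    fix x
    have "(cmod (f x - g x))\<^sup>2 \<le> (cmod (f x) + cmod (g x))\<^sup>2"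
      by (simp add: norm_triangle_ineq4 power_mono)
    then show "(cmod (f x - g x))\<^sup>2 \<le> (cmod (f x))\<^sup>2 + (cmod (g x))\<^sup>2 + 2 * (cmod (f x) * cmod (g x))"
      by (simp add: power2_sum)
  qed simp
  also have "\<dots> = A + B + 2 * C" by (simp add: A_def B_def C_def)
  also have "\<dots> \<le> (sqrt A + sqrt B)\<^sup>2" using C nonneg by (simp add: power2_sum)
  finally have "sqrt (\<integral>x. (cmod (f x - g x))\<^sup>2 \<partial>M) \<le> sqrt A + sqrt B"
    using nonneg by (simp add: real_le_lsqrt)
  then show ?thesis by (simp add: L2_norm_def A_def B_def)
qed

lemma L2_norm_diff_eq_0_iff:
  assumes "f \<in> L2_fun M" "g \<in> L2_fun M"
  shows "L2_norm M (\<lambda>x. f x - g x) = 0 \<longleftrightarrow> (AE x in M. f x = g x)"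
proof -
  have "integrable M (\<lambda>x. (cmod (f x - g x))\<^sup>2)"
    using L2_fun_diff[OF assms] by (auto simp: L2_fun_def)
  then show ?thesis
    unfolding L2_norm_def by (subst real_sqrt_eq_0_iff, subst integral_nonneg_eq_0_iff_AE) auto
qed

lemma equiv_L2_rel: "equiv (L2_fun M) (L2_rel M)"
proof (rule equivI)
  show "L2_rel M \<subseteq> L2_fun M \<times> L2_fun M" by (auto simp: L2_rel_def)
  show "refl_on (L2_fun M) (L2_rel M)" by (auto simp: refl_on_def L2_rel_def)
  show "sym (L2_rel M)" by (auto simp: sym_def L2_rel_def eq_commute)
  show "trans (L2_rel M)"
  proof (rule transI)
    fix f g h assume "(f, g) \<in> L2_rel M" "(g, h) \<in> L2_rel M"
    then show "(f, h) \<in> L2_rel M" by (auto simp: L2_rel_def elim: AE_mp)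
  qed
qed

lemma L2_class_in_space [simp]: "f \<in> L2_fun M \<Longrightarrow> L2_class M f \<in> L2_space M"
  by (simp add: L2_class_def L2_space_def quotientI)

lemma L2_space_cases:
  assumes "F \<in> L2_space M"
  obtains f where "f \<in> L2_fun M" "F = L2_class M f"
  using assms by (auto simp: L2_space_def L2_class_def quotient_def)

lemma L2_class_eq_iff:
  assumes "f \<in> L2_fun M" "g \<in> L2_fun M"
  shows "L2_class M f = L2_class M g \<longleftrightarrow> (AE x in M. f x = g x)"
  using eq_equiv_class_iff[OF equiv_L2_rel assms] assms by (auto simp: L2_class_def L2_rel_def)

lemma L2_dist_class:
  assumes "f \<in> L2_fun M" "g \<in> L2_fun M"
  shows "L2_dist M (L2_class M f) (L2_class M g) = L2_norm M (\<lambda>x. f x - g x)"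
proof -
  have some: "(SOME u. u \<in> L2_class M h) \<in> L2_fun M \<and> (AE x in M. (SOME u. u \<in> L2_class M h) x = h x)"
    if "h \<in> L2_fun M" for h
  proof -
    have "h \<in> L2_class M h" using that by (auto simp: L2_class_def L2_rel_def)
    then have "(SOME u. u \<in> L2_class M h) \<in> L2_class M h" by (rule someI[where P = "\<lambda>u. u \<in> L2_class M h"])
    then show ?thesis by (auto simp: L2_class_def L2_rel_def eq_commute)
  qed
  define f' g' where "f' = (SOME u. u \<in> L2_class M f)" and "g' = (SOME u. u \<in> L2_class M g)"
  have fg: "f' \<in> L2_fun M" "g' \<in> L2_fun M" "AE x in M. f' x = f x" "AE x in M. g' x = g x"
    using some assms by (auto simp: f'_def g'_def)
  have "(\<integral>x. (cmod (f' x - g' x))\<^sup>2 \<partial>M) = (\<integral>x. (cmod (f x - g x))\<^sup>2 \<partial>M)"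
  proof (rule integral_cong_AE)
    show "AE x in M. (cmod (f' x - g' x))\<^sup>2 = (cmod (f x - g x))\<^sup>2"
      using fg(3,4) by eventually_elim simp
  qed (use fg assms in \<open>auto simp: L2_fun_def\<close>)
  then show ?thesis by (simp add: L2_dist_def L2_norm_def f'_def g'_def)
qed

lemma Metric_space_L2: "Metric_space (L2_space M) (L2_dist M)"
proof
  show "0 \<le> L2_dist M F G" for F G by (simp add: L2_dist_def L2_norm_def)
  show "L2_dist M F G = L2_dist M G F" for F G
    by (simp add: L2_dist_def L2_norm_def norm_minus_commute)
  show "L2_dist M F G = 0 \<longleftrightarrow> F = G" if "F \<in> L2_space M" "G \<in> L2_space M" for F G
    using that by (metis L2_space_cases L2_dist_class L2_norm_diff_eq_0_iff L2_class_eq_iff)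
  show "L2_dist M F H \<le> L2_dist M F G + L2_dist M G H"
    if FGH: "F \<in> L2_space M" "G \<in> L2_space M" "H \<in> L2_space M" for F G H
  proof -
    obtain f g h where fgh: "f \<in> L2_fun M" "g \<in> L2_fun M" "h \<in> L2_fun M"
      and eq: "F = L2_class M f" "G = L2_class M g" "H = L2_class M h"
      using FGH by (meson L2_space_cases)
    have "L2_norm M (\<lambda>x. (f x - g x) - (h x - g x))
        \<le> L2_norm M (\<lambda>x. f x - g x) + L2_norm M (\<lambda>x. h x - g x)"
      using fgh by (intro L2_norm_minkowski L2_fun_diff)
    moreover have "L2_norm M (\<lambda>x. h x - g x) = L2_norm M (\<lambda>x. g x - h x)"
      by (simp add: L2_norm_def norm_minus_commute)
    ultimately show ?thesis using fgh by (simp add: eq L2_dist_class)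
  qed
qed

section \<open>Directional notions for actions of the integer plane\<close>

text \<open>The compact metric space is the whole carrier type. The group structure on
  \<open>int \<times> int\<close> is the componentwise one.\<close>

locale Z2_system = prob_space M
  for M :: "'a :: metric_space measure" +
  fixes T :: "int \<times> int \<Rightarrow> 'a \<Rightarrow> 'a"
  assumes compact_space: "compact (UNIV :: 'a set)"
    and sets_M: "sets M = sets borel"
    and T_zero: "T 0 = id"
    and T_add: "T (p + q) = T p \<circ> T q"
    and T_homeo: "\<exists>S. homeomorphism UNIV UNIV (T p) S"
    and T_invariant: "B \<in> sets M \<Longrightarrow> emeasure M (T p -` B) = emeasure M B"

definition koopman :: "(int \<times> int \<Rightarrow> 'a \<Rightarrow> 'a) \<Rightarrow> int \<times> int \<Rightarrow> ('a \<Rightarrow> complex) \<Rightarrow> 'a \<Rightarrow> complex" where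
  "koopman T p f = f \<circ> T p"

text \<open>The direction is \<open>(1, \<beta>)\<close> throughout.\<close>

definition strip :: "real \<Rightarrow> real \<Rightarrow> (int \<times> int) set" where
  "strip \<beta> b = {(m, n). \<beta> * of_int m - b \<le> of_int n \<and> of_int n \<le> \<beta> * of_int m + b}"

definition strip_pos :: "real \<Rightarrow> real \<Rightarrow> (int \<times> int) set" where
  "strip_pos \<beta> b = strip \<beta> b \<inter> ({0..} \<times> UNIV)"

definition strip_upto :: "real \<Rightarrow> real \<Rightarrow> nat \<Rightarrow> (int \<times> int) set" where
  "strip_upto \<beta> b k = strip \<beta> b \<inter> ({0..int k - 1} \<times> UNIV)"

definition lower_density :: "real \<Rightarrow> real \<Rightarrow> (int \<times> int) set \<Rightarrow> ereal" where
  "lower_density \<beta> b Q =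
     liminf (\<lambda>k. ereal (real (card (Q \<inter> ({0..int k - 1} \<times> UNIV))) / real (card (strip_upto \<beta> b k))))"

definition orbit_compact ::
  "'a measure \<Rightarrow> (int \<times> int \<Rightarrow> 'a \<Rightarrow> 'a) \<Rightarrow> (int \<times> int) set \<Rightarrow> ('a \<Rightarrow> complex) \<Rightarrow> bool" where
  "orbit_compact M T P f \<longleftrightarrow>
     compactin (L2_topology M) (L2_topology M closure_of ((\<lambda>p. L2_class M (koopman T p f)) ` P))"

text \<open>The condition does not depend on the width \<open>b\<close> of the strip, so quantifying over all widths
  gives the same family of sets as any single width; see \<open>directional_kronecker_iff\<close> below.\<close>

definition directional_kronecker ::
  "'a measure \<Rightarrow> (int \<times> int \<Rightarrow> 'a \<Rightarrow> 'a) \<Rightarrow> real \<Rightarrow> 'a set set" where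
  "directional_kronecker M T \<beta> =
     {B \<in> sets M. \<forall>b>0. orbit_compact M T (strip \<beta> b) (indicator B)}"

definition directionally_weakly_mixing ::
  "'a measure \<Rightarrow> (int \<times> int \<Rightarrow> 'a \<Rightarrow> 'a) \<Rightarrow> real \<Rightarrow> bool" where
  "directionally_weakly_mixing M T \<beta> \<longleftrightarrow>
     (\<forall>B \<in> directional_kronecker M T \<beta>. measure M B = 0 \<or> measure M B = 1)"

text \<open>Averages along a set depend on the order of summation. The points are listed without
  repetition by increasing first coordinate; points with equal first coordinate (there are at most
  \<open>2 * b + 1\<close> of them in a strip) may come in any order.\<close>

definition enumerates :: "(nat \<Rightarrow> int \<times> int) \<Rightarrow> (int \<times> int) set \<Rightarrow> bool" where
  "enumerates q Q \<longleftrightarrow> bij_betw q UNIV Q \<and> mono (\<lambda>i. fst (q i))"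

section \<open>Independence of the width\<close>

lemma strip_finite_cover:
  assumes "b > 0"
  obtains F where "finite F" "\<And>p. p \<in> strip \<beta> c \<Longrightarrow> \<exists>r\<in>F. p - r \<in> strip \<beta> b"
proof -
  define h where "h p = (of_int (snd p) - \<beta> * of_int (fst p)) / b" for p :: "int \<times> int"
  define cell where "cell p = \<lfloor>h p\<rfloor>" for p
  have "cell ` strip \<beta> c \<subseteq> {\<lfloor>- c / b\<rfloor>..\<lfloor>c / b\<rfloor>}"
  proof
    fix j assume "j \<in> cell ` strip \<beta> c"
    then obtain m n where mn: "(m, n) \<in> strip \<beta> c" "j = cell (m, n)" by auto
    then have "- c / b \<le> h (m, n)" "h (m, n) \<le> c / b"
      using assms divide_right_mono[of "- c" "of_int n - \<beta> * of_int m" b]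
      by (auto simp: h_def strip_def intro!: divide_right_mono)
    then show "j \<in> {\<lfloor>- c / b\<rfloor>..\<lfloor>c / b\<rfloor>}"
      unfolding mn cell_def by (meson atLeastAtMost_iff floor_mono)
  qed
  then have "finite (cell ` strip \<beta> c)" by (rule finite_subset) simp
  then obtain F where F: "F \<subseteq> strip \<beta> c" "finite F" "cell ` strip \<beta> c = cell ` F"
    by (meson finite_subset_image subset_refl)
  show thesis
  proof
    fix p assume "p \<in> strip \<beta> c"
    then obtain r where r: "r \<in> F" "cell p = cell r" using F(3) by blast
    then have "\<bar>h p - h r\<bar> \<le> 1" unfolding cell_def by linarith
    moreover have "h p - h r = (of_int (snd (p - r)) - \<beta> * of_int (fst (p - r))) / b"
      by (simp add: h_def diff_divide_distrib[symmetric] algebra_simps)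
    ultimately have "\<bar>of_int (snd (p - r)) - \<beta> * of_int (fst (p - r))\<bar> \<le> b"
      using assms by (simp add: abs_divide)
    then have "p - r \<in> strip \<beta> b" by (cases p; cases r) (auto simp: strip_def abs_le_iff)
    with r show "\<exists>r\<in>F. p - r \<in> strip \<beta> b" by blast
  qed (fact F(2))
qed

context Z2_system
begin

lemma space_M [simp]: "space M = UNIV"
  using sets_eq_imp_space_eq[OF sets_M] by simp

lemma T_measurable [measurable]: "T p \<in> measurable M M"
proof -
  have "continuous_on UNIV (T p)" using T_homeo[of p] by (auto simp: homeomorphism_def)
  then have "T p \<in> borel_measurable borel" by (rule borel_measurable_continuous_onI)
  then show ?thesis using sets_M measurable_cong_sets by blast
qed

lemma distr_T: "distr M M (T p) = M"
  by (rule measure_eqI) (auto simp: emeasure_distr T_invariant)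

lemma AE_T: "AE x in M. P x \<Longrightarrow> AE x in M. P (T p x)"
  using AE_distrD[OF T_measurable[of p], of P] unfolding distr_T .

lemma koopman_L2_fun:
  assumes "f \<in> L2_fun M"
  shows "koopman T p f \<in> L2_fun M"
proof -
  have f [measurable]: "f \<in> borel_measurable M" and "integrable M (\<lambda>x. (cmod (f x))\<^sup>2)"
    using assms by (auto simp: L2_fun_def)
  then have "integrable (distr M M (T p)) (\<lambda>x. (cmod (f x))\<^sup>2)" by (simp add: distr_T)
  then have "integrable M (\<lambda>x. (cmod (f (T p x)))\<^sup>2)" by (rule integrable_distr[OF T_measurable])
  moreover have "koopman T p f \<in> borel_measurable M" unfolding koopman_def by measurable
  ultimately show ?thesis by (simp add: L2_fun_def koopman_def)
qed

lemma koopman_norm: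
  assumes "f \<in> L2_fun M"
  shows "L2_norm M (koopman T p f) = L2_norm M f"
proof -
  have f [measurable]: "f \<in> borel_measurable M" using assms by (auto simp: L2_fun_def)
  have "(\<integral>x. (cmod (f x))\<^sup>2 \<partial>distr M M (T p)) = (\<integral>x. (cmod (f (T p x)))\<^sup>2 \<partial>M)"
    by (rule integral_distr) measurable
  then show ?thesis by (simp add: distr_T L2_norm_def koopman_def)
qed

lemma koopman_add: "koopman T (p + q) f = koopman T q (koopman T p f)"
  by (simp add: koopman_def T_add comp_assoc)

lemma indicator_L2_fun: "B \<in> sets M \<Longrightarrow> indicator B \<in> L2_fun M"
proof -
  assume B: "B \<in> sets M"
  have "(\<lambda>x. (cmod (indicator B x))\<^sup>2) = (indicator B :: _ \<Rightarrow> real)"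
    by (auto simp: indicator_def)
  moreover have "integrable M (indicator B :: _ \<Rightarrow> real)"
    using B by (simp add: less_top[symmetric])
  ultimately show ?thesis using B by (auto simp: L2_fun_def)
qed

definition koopman_class :: "int \<times> int \<Rightarrow> ('a \<Rightarrow> complex) set \<Rightarrow> ('a \<Rightarrow> complex) set" where
  "koopman_class p F = L2_class M (koopman T p (SOME f. f \<in> F))"

lemma koopman_class_eq:
  assumes "f \<in> L2_fun M"
  shows "koopman_class p (L2_class M f) = L2_class M (koopman T p f)"
proof -
  have "f \<in> L2_class M f" using assms by (auto simp: L2_class_def L2_rel_def)
  then have "(SOME u. u \<in> L2_class M f) \<in> L2_class M f" by (rule someI[where P = "\<lambda>u. u \<in> L2_class M f"])
  then have u: "(SOME u. u \<in> L2_class M f) \<in> L2_fun M"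
    "AE x in M. (SOME u. u \<in> L2_class M f) x = f x"
    by (auto simp: L2_class_def L2_rel_def eq_commute)
  from AE_T[OF u(2), of p] show ?thesis
    unfolding koopman_class_def using u(1) assms
    by (subst L2_class_eq_iff) (auto simp: koopman_L2_fun, simp add: koopman_def)
qed

lemma continuous_koopman_class:
  "continuous_map (L2_topology M) (L2_topology M) (koopman_class p)"
proof -
  interpret L2: Metric_space "L2_space M" "L2_dist M" by (rule Metric_space_L2)
  have in_space: "koopman_class p F \<in> L2_space M" if "F \<in> L2_space M" for F
    using that by (auto elim!: L2_space_cases simp: koopman_class_eq koopman_L2_fun)
  have isom: "L2_dist M (koopman_class p F) (koopman_class p G) = L2_dist M F G"
    if FG: "F \<in> L2_space M" "G \<in> L2_space M" for F G
  proof -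
    obtain f g where fg: "f \<in> L2_fun M" "g \<in> L2_fun M"
      and eq: "F = L2_class M f" "G = L2_class M g"
      using FG by (meson L2_space_cases)
    have "L2_norm M (\<lambda>x. koopman T p f x - koopman T p g x) = L2_norm M (\<lambda>x. f x - g x)"
      using koopman_norm[OF L2_fun_diff[OF fg], of p] by (simp add: koopman_def comp_def)
    then show ?thesis using fg by (simp add: eq koopman_class_eq L2_dist_class koopman_L2_fun)
  qed
  show ?thesis
    unfolding L2_topology_def L2.continuous_map_to_metric L2.topspace_mtopology
  proof (intro ballI allI impI)
    fix F and e :: real assume F: "F \<in> L2_space M" and e: "e > 0"
    show "\<exists>U. openin L2.mtopology U \<and> F \<in> U \<and> (\<forall>G\<in>U. koopman_class p G \<in> L2.mball (koopman_class p F) e)"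
      using F e by (intro exI[of _ "L2.mball F e"]) (auto simp: in_space isom)
  qed
qed

lemma orbit_compact_strip:
  assumes f: "f \<in> L2_fun M" and b: "b > 0" and comp: "orbit_compact M T (strip \<beta> b) f"
  shows "orbit_compact M T (strip \<beta> c) f"
proof -
  interpret L2: Metric_space "L2_space M" "L2_dist M" by (rule Metric_space_L2)
  let ?X = "L2_topology M"
  let ?o = "\<lambda>p. L2_class M (koopman T p f)"
  have haus: "Hausdorff_space ?X" by (simp add: L2_topology_def L2.Hausdorff_space_mtopology)
  obtain F where F: "finite F" "\<And>p. p \<in> strip \<beta> c \<Longrightarrow> \<exists>r\<in>F. p - r \<in> strip \<beta> b"
    using strip_finite_cover[OF b] by metis
  define C where "C = ?X closure_of (?o ` strip \<beta> b)"
  have "?o ` strip \<beta> b \<subseteq> topspace ?X"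
    using f by (auto simp: L2_topology_def koopman_L2_fun)
  then have sub: "?o ` strip \<beta> b \<subseteq> C" unfolding C_def by (rule closure_of_subset)
  define K where "K = (\<Union>r\<in>F. koopman_class r ` C)"
  have "compactin ?X (koopman_class r ` C)" for r
    using comp unfolding orbit_compact_def C_def
    by (rule image_compactin[OF _ continuous_koopman_class])
  then have K: "compactin ?X K" unfolding K_def using F(1) by (intro compactin_Union) auto
  have "?o ` strip \<beta> c \<subseteq> K"
  proof
    fix G assume "G \<in> ?o ` strip \<beta> c"
    then obtain p where p: "p \<in> strip \<beta> c" "G = ?o p" by auto
    then obtain r where r: "r \<in> F" "p - r \<in> strip \<beta> b" using F(2) by blast
    have "?o p = koopman_class r (?o (p - r))"
      using koopman_add[of "p - r" r f] f by (simp add: koopman_class_eq koopman_L2_fun)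
    then show "G \<in> K" using p r sub unfolding K_def by blast
  qed
  then have "?X closure_of (?o ` strip \<beta> c) \<subseteq> K"
    using compactin_imp_closedin[OF haus K] by (rule closure_of_minimal)
  then show ?thesis unfolding orbit_compact_def using closed_compactin[OF K] by simp
qed

lemma directional_kronecker_iff:
  assumes "b > 0"
  shows "B \<in> directional_kronecker M T \<beta> \<longleftrightarrow>
    B \<in> sets M \<and> orbit_compact M T (strip \<beta> b) (indicator B)"
  using assms orbit_compact_strip[OF indicator_L2_fun]
  unfolding directional_kronecker_def by blast

end

end

theory Submission
  imports Defs "HOL-Library.Ramsey"
begin

text \<open>
  The averages satisfy
  \<open>\<parallel>(1/N) \<Sum>\<^sub>i U\<^sup>q\<^sup>i f\<parallel>\<^sup>2 \<le> (1/N) \<Sum>\<^sub>p \<bar>\<langle>f, U\<^sup>p f\<rangle>\<bar>\<close> with \<open>p\<close> ranging over a strip of twice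
  the width, so for (a) \<open>\<Longrightarrow>\<close> (b) it suffices that the correlations of a function \<open>f\<close> of mean zero
  vanish on average along the strip. If they do not, consider the operators
  \<open>A h = \<Sum>\<^sub>p a\<^sub>p \<langle>h, U\<^sup>p f\<rangle> U\<^sup>p f\<close> with averaging weights \<open>a\<close> that depend on the distance of \<open>p\<close> to the
  line in a Lipschitz way. They almost commute with \<open>U\<^sup>q\<close> when \<open>q\<close> is close to the line. The admissible
  weights form decreasing convex sets, so the vectors \<open>A f\<close> of nearly minimal norm converge to some
  \<open>g \<noteq> 0\<close> of mean zero. The orbit of \<open>g\<close> along the strip is totally bounded: among infinitely many
  vectors \<open>U\<^sup>q f\<close>, Ramsey's theorem finds differences that are almost orthogonal to each other, and by
  an approximate Bessel inequality \<open>A\<close> makes one of them small, uniformly in \<open>A\<close>. A suitable level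
  set of \<open>g\<close> is then a nontrivial member of the directional Kronecker algebra.

  For the converse, if \<open>B\<close> is such a member, the \<open>p\<close> with \<open>U\<^sup>p 1\<^sub>B\<close> close to \<open>1\<^sub>B\<close> are syndetic in the
  strip, and averages along them stay close to \<open>1\<^sub>B\<close>, hence away from the constant \<open>\<mu>(B)\<close>.
\<close>

section \<open>Real square-integrable functions\<close>

text \<open>The obstacle is that a strip is not a group. Translating weights by \<open>q\<close>
  shifts them across the line by \<open>offset \<beta> q\<close>, and the resulting error does not
  fade as the averages get longer. It is small only for \<open>q\<close> near the line; total
  boundedness is therefore proved on a thin strip, where the error is a fraction of the required
  precision, and carried to the given width by finitely many translates of the thin strip. The
  operator \<open>A\<close> has the kernel \<open>\<Sum> a p * f (T p x) * f (T p y)\<close>. On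
  almost orthogonal vectors its squared norms sum to at most a constant that depends only on
  \<open>f\<close> and the mass of the weights, as for Hilbert-Schmidt operators; this uniform bound
  replaces compactness of a limit operator. Only the vectors \<open>A f\<close> converge, and the
  orbit of \<open>g\<close> is compared with one sufficiently late \<open>A\<close>. Real functions
  are used because \<open>g\<close> is finally cut at a level; complex functions are split into real
  and imaginary parts.\<close>

definition L2_real :: "'a measure \<Rightarrow> ('a \<Rightarrow> real) set" where
  "L2_real M = {f \<in> borel_measurable M. integrable M (\<lambda>x. (f x)\<^sup>2)}"

definition ip :: "'a measure \<Rightarrow> ('a \<Rightarrow> real) \<Rightarrow> ('a \<Rightarrow> real) \<Rightarrow> real" where
  "ip M f g = (\<integral>x. f x * g x \<partial>M)"

definition nrm :: "'a measure \<Rightarrow> ('a \<Rightarrow> real) \<Rightarrow> real" where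
  "nrm M f = sqrt (ip M f f)"

lemma L2_real_measurable: "f \<in> L2_real M \<Longrightarrow> f \<in> borel_measurable M"
  by (simp add: L2_real_def)

lemma integrable_mult_L2:
  assumes "f \<in> L2_real M" "g \<in> L2_real M"
  shows "integrable M (\<lambda>x. f x * g x)"
proof (rule Bochner_Integration.integrable_bound)
  show "integrable M (\<lambda>x. (f x)\<^sup>2 + (g x)\<^sup>2)" using assms by (simp add: L2_real_def)
  have "\<bar>f x * g x\<bar> \<le> (f x)\<^sup>2 + (g x)\<^sup>2" for x
  proof -
    have "2 * (\<bar>f x\<bar> * \<bar>g x\<bar>) \<le> (f x)\<^sup>2 + (g x)\<^sup>2"
      using sum_squares_bound[of "\<bar>f x\<bar>" "\<bar>g x\<bar>"] by simp
    moreover have "0 \<le> \<bar>f x\<bar> * \<bar>g x\<bar>" by simp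
    ultimately show ?thesis unfolding abs_mult by linarith
  qed
  then show "AE x in M. norm (f x * g x) \<le> norm ((f x)\<^sup>2 + (g x)\<^sup>2)" by simp
qed (use assms in \<open>auto simp: L2_real_def\<close>)

lemma L2_real_add:
  assumes "f \<in> L2_real M" "g \<in> L2_real M"
  shows "(\<lambda>x. f x + g x) \<in> L2_real M"
proof -
  have "integrable M (\<lambda>x. (f x)\<^sup>2 + (g x)\<^sup>2 + 2 * (f x * g x))"
    using assms integrable_mult_L2[OF assms] by (simp add: L2_real_def)
  then show ?thesis using assms by (simp add: L2_real_def power2_sum mult.assoc borel_measurable_add)
qed

lemma L2_real_scale: "f \<in> L2_real M \<Longrightarrow> (\<lambda>x. c * f x) \<in> L2_real M"
  by (auto simp: L2_real_def power_mult_distrib)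

lemma L2_real_diff:
  assumes "f \<in> L2_real M" "g \<in> L2_real M"
  shows "(\<lambda>x. f x - g x) \<in> L2_real M"
  using L2_real_add[OF assms(1) L2_real_scale[OF assms(2), of "-1"]] by simp

lemma L2_real_sum:
  assumes "\<And>i. i \<in> I \<Longrightarrow> f i \<in> L2_real M"
  shows "(\<lambda>x. \<Sum>i\<in>I. c i * f i x) \<in> L2_real M"
  using assms
proof (induction I rule: infinite_finite_induct)
  case (insert i I)
  then have "(\<lambda>x. c i * f i x + (\<Sum>i\<in>I. c i * f i x)) \<in> L2_real M"
    by (intro L2_real_add L2_real_scale) auto
  with insert show ?case by simp
qed (simp_all add: L2_real_def)

lemma (in finite_measure) L2_real_const: "(\<lambda>x. c) \<in> L2_real M"
  by (simp add: L2_real_def)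

lemma ip_commute: "ip M f g = ip M g f"
  by (simp add: ip_def mult.commute)

lemma ip_add:
  assumes "f \<in> L2_real M" "g \<in> L2_real M" "h \<in> L2_real M"
  shows "ip M (\<lambda>x. f x + g x) h = ip M f h + ip M g h"
  using assms by (simp add: ip_def ring_distribs integrable_mult_L2)

lemma ip_diff:
  assumes "f \<in> L2_real M" "g \<in> L2_real M" "h \<in> L2_real M"
  shows "ip M (\<lambda>x. f x - g x) h = ip M f h - ip M g h"
  using assms by (simp add: ip_def ring_distribs integrable_mult_L2)

lemma ip_scale: "ip M (\<lambda>x. c * f x) h = c * ip M f h"
  by (simp add: ip_def mult.assoc)

lemma ip_add_right:
  assumes "f \<in> L2_real M" "g \<in> L2_real M" "h \<in> L2_real M"
  shows "ip M h (\<lambda>x. f x + g x) = ip M h f + ip M h g"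
  using ip_add[OF assms] by (simp add: ip_commute)

lemma ip_diff_right:
  assumes "f \<in> L2_real M" "g \<in> L2_real M" "h \<in> L2_real M"
  shows "ip M h (\<lambda>x. f x - g x) = ip M h f - ip M h g"
  using ip_diff[OF assms] by (simp add: ip_commute)

lemma ip_scale_right: "ip M h (\<lambda>x. c * f x) = c * ip M h f"
  by (simp add: ip_def mult.left_commute)

lemma ip_sum:
  assumes "\<And>i. i \<in> I \<Longrightarrow> f i \<in> L2_real M" "h \<in> L2_real M"
  shows "ip M (\<lambda>x. \<Sum>i\<in>I. c i * f i x) h = (\<Sum>i\<in>I. c i * ip M (f i) h)"
  using assms by (simp add: ip_def sum_distrib_right mult.assoc integrable_mult_L2)

lemma ip_self_nonneg: "0 \<le> ip M f f"
  by (simp add: ip_def)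

lemma nrm_nonneg [simp]: "0 \<le> nrm M f"
  by (simp add: nrm_def ip_self_nonneg)

lemma nrm_power2: "(nrm M f)\<^sup>2 = ip M f f"
  by (simp add: nrm_def ip_self_nonneg)

lemma ip_self_add:
  assumes "f \<in> L2_real M" "g \<in> L2_real M"
  shows "ip M (\<lambda>x. f x + g x) (\<lambda>x. f x + g x) = ip M f f + 2 * ip M f g + ip M g g"
  using assms ip_commute[of M g f]
  by (simp add: ip_add ip_add_right L2_real_add)

lemma ip_self_diff:
  assumes "f \<in> L2_real M" "g \<in> L2_real M"
  shows "ip M (\<lambda>x. f x - g x) (\<lambda>x. f x - g x) = ip M f f - 2 * ip M f g + ip M g g"
  using assms ip_commute[of M g f]
  by (simp add: ip_diff ip_diff_right L2_real_diff)

lemma ip_Cauchy_Schwarz: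
  assumes f: "f \<in> L2_real M" and g: "g \<in> L2_real M"
  shows "\<bar>ip M f g\<bar> \<le> nrm M f * nrm M g"
proof -
  define a b c where "a = ip M f f" and "b = ip M f g" and "c = ip M g g"
  have q: "0 \<le> a - 2 * t * b + t\<^sup>2 * c" for t
    using ip_self_nonneg[of M "\<lambda>x. f x - t * g x"] ip_self_diff[OF f L2_real_scale[OF g, of t]]
    by (simp add: a_def b_def c_def power2_eq_square mult.assoc ip_scale ip_scale_right)
  have "b\<^sup>2 \<le> a * c"
  proof (cases "c = 0")
    case True
    \<comment> \<open>With \<open>c = 0\<close> the quadratic is affine in \<open>t\<close>; a
      nonzero \<open>b\<close> would make it equal to -1 at
      \<open>t = (a + 1) / (2 * b)\<close>.\<close>
    have "b = 0"
      using q[of "(a + 1) / (2 * b)"] True by (cases "b = 0") auto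
    then show ?thesis using True by simp
  next
    case False
    then have "c > 0" using ip_self_nonneg[of M g] by (simp add: c_def)
    then show ?thesis using q[of "b / c"] by (simp add: field_simps power2_eq_square)
  qed
  then have "sqrt (b\<^sup>2) \<le> sqrt (a * c)" by (rule real_sqrt_le_mono)
  then show ?thesis by (simp add: a_def b_def c_def nrm_def real_sqrt_mult)
qed

lemma nrm_scale: "nrm M (\<lambda>x. c * f x) = \<bar>c\<bar> * nrm M f"
  by (simp add: nrm_def ip_scale ip_scale_right real_sqrt_mult flip: mult.assoc)

lemma nrm_diff_commute: "nrm M (\<lambda>x. f x - g x) = nrm M (\<lambda>x. g x - f x)"
  using nrm_scale[of M "-1" "\<lambda>x. f x - g x"] by simp

lemma nrm_add:
  assumes f: "f \<in> L2_real M" and g: "g \<in> L2_real M"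
  shows "nrm M (\<lambda>x. f x + g x) \<le> nrm M f + nrm M g"
proof (rule power2_le_imp_le)
  show "(nrm M (\<lambda>x. f x + g x))\<^sup>2 \<le> (nrm M f + nrm M g)\<^sup>2"
    using ip_Cauchy_Schwarz[OF f g] by (simp add: power2_sum nrm_power2 ip_self_add f g)
qed simp

lemma nrm_diff_triangle:
  assumes "f \<in> L2_real M" "g \<in> L2_real M" "h \<in> L2_real M"
  shows "nrm M (\<lambda>x. f x - h x) \<le> nrm M (\<lambda>x. f x - g x) + nrm M (\<lambda>x. g x - h x)"
  using nrm_add[OF L2_real_diff[OF assms(1,2)] L2_real_diff[OF assms(2,3)]] by simp

lemma nrm_sum:
  assumes "\<And>i. i \<in> I \<Longrightarrow> f i \<in> L2_real M"
  shows "nrm M (\<lambda>x. \<Sum>i\<in>I. c i * f i x) \<le> (\<Sum>i\<in>I. \<bar>c i\<bar> * nrm M (f i))"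
  using assms
proof (induction I rule: infinite_finite_induct)
  case (insert i I)
  have "nrm M (\<lambda>x. c i * f i x + (\<Sum>i\<in>I. c i * f i x))
      \<le> nrm M (\<lambda>x. c i * f i x) + nrm M (\<lambda>x. \<Sum>i\<in>I. c i * f i x)"
    using insert by (intro nrm_add L2_real_scale L2_real_sum) auto
  with insert show ?case by (simp add: nrm_scale)
qed (simp_all add: nrm_def ip_def)

section \<open>Passage to complex functions and completeness\<close>

lemma of_real_L2_fun: "f \<in> L2_real M \<Longrightarrow> (\<lambda>x. complex_of_real (f x)) \<in> L2_fun M"
  by (auto simp: L2_real_def L2_fun_def)

lemma L2_norm_of_real: "L2_norm M (\<lambda>x. complex_of_real (f x)) = nrm M f"
  by (simp add: L2_norm_def nrm_def ip_def power2_eq_square)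

lemma L2_fun_Re_Im:
  assumes "f \<in> L2_fun M"
  shows "(\<lambda>x. Re (f x)) \<in> L2_real M" "(\<lambda>x. Im (f x)) \<in> L2_real M"
proof -
  have f [measurable]: "f \<in> borel_measurable M" and i: "integrable M (\<lambda>x. (cmod (f x))\<^sup>2)"
    using assms by (auto simp: L2_fun_def)
  have "integrable M (\<lambda>x. (Re (f x))\<^sup>2)" "integrable M (\<lambda>x. (Im (f x))\<^sup>2)"
    by (rule Bochner_Integration.integrable_bound[OF i], measurable, simp add: cmod_power2)+
  then show "(\<lambda>x. Re (f x)) \<in> L2_real M" "(\<lambda>x. Im (f x)) \<in> L2_real M"
    by (auto simp: L2_real_def)
qed

lemma nrm_Re_le:
  assumes "f \<in> L2_fun M"
  shows "nrm M (\<lambda>x. Re (f x)) \<le> L2_norm M f"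
proof -
  have "(\<integral>x. (Re (f x))\<^sup>2 \<partial>M) \<le> (\<integral>x. (cmod (f x))\<^sup>2 \<partial>M)"
    using assms L2_fun_Re_Im(1)[OF assms]
    by (intro integral_mono) (auto simp: L2_fun_def L2_real_def cmod_power2)
  then show ?thesis by (simp add: nrm_def ip_def L2_norm_def power2_eq_square)
qed

lemma L2_norm_le_Re_Im:
  assumes "f \<in> L2_fun M"
  shows "L2_norm M f \<le> nrm M (\<lambda>x. Re (f x)) + nrm M (\<lambda>x. Im (f x))"
proof -
  have "(\<integral>x. (cmod (f x))\<^sup>2 \<partial>M) = ip M (\<lambda>x. Re (f x)) (\<lambda>x. Re (f x)) + ip M (\<lambda>x. Im (f x)) (\<lambda>x. Im (f x))"
    using L2_fun_Re_Im[OF assms] by (simp add: ip_def cmod_power2 L2_real_def flip: power2_eq_square)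
  then show ?thesis
    using ip_self_nonneg sqrt_add_le_add_sqrt unfolding L2_norm_def nrm_def by metis
qed

lemma (in prob_space) integral_norm_le_L2_norm:
  assumes "f \<in> L2_fun M"
  shows "integrable M (\<lambda>x. cmod (f x))" "(\<integral>x. cmod (f x) \<partial>M) \<le> L2_norm M f"
proof -
  have f [measurable]: "f \<in> borel_measurable M" and i: "integrable M (\<lambda>x. (cmod (f x))\<^sup>2)"
    using assms by (auto simp: L2_fun_def)
  have r: "(\<lambda>x. cmod (f x)) \<in> L2_real M" "(\<lambda>x. 1) \<in> L2_real M"
    using i by (simp_all add: L2_real_def)
  show "integrable M (\<lambda>x. cmod (f x))"
    using integrable_mult_L2[OF r] by simp
  show "(\<integral>x. cmod (f x) \<partial>M) \<le> L2_norm M f"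
    using ip_Cauchy_Schwarz[OF r] by (simp add: ip_def nrm_def L2_norm_def power2_eq_square prob_space)
qed

text \<open>Riesz--Fischer: a rapidly converging subsequence converges almost everywhere, because its
  increments are summable in \<open>L\<^sup>1\<close>; Fatou's lemma upgrades this to convergence in norm.\<close>

lemma (in prob_space) L2_Cauchy_limit:
  assumes f: "\<And>n. f n \<in> L2_fun M"
    and Cauchy: "\<And>e. e > 0 \<Longrightarrow> \<exists>N. \<forall>m\<ge>N. \<forall>n\<ge>N. L2_norm M (\<lambda>x. f m x - f n x) < e"
  obtains g where "g \<in> L2_fun M" "(\<lambda>n. L2_norm M (\<lambda>x. f n x - g x)) \<longlonglongrightarrow> 0"
proof -
  have [measurable]: "f n \<in> borel_measurable M" for n using f by (auto simp: L2_fun_def)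
  have "\<exists>N. \<forall>m\<ge>N. \<forall>n\<ge>N. L2_norm M (\<lambda>x. f m x - f n x) < (1/2)^k" for k
    using Cauchy[of "(1/2)^k"] by simp
  then obtain N where N: "\<And>k m n. m \<ge> N k \<Longrightarrow> n \<ge> N k \<Longrightarrow> L2_norm M (\<lambda>x. f m x - f n x) < (1/2)^k"
    by metis
  \<comment> \<open>The partial sums of \<open>N\<close> dominate \<open>N k\<close> at index
    \<open>k\<close> and later; the summand \<open>k\<close> makes \<open>r\<close> tend to
    infinity, as the Fatou step requires.\<close>
  define r where "r k = (\<Sum>j\<le>k. N j) + k" for k
  have r: "r k \<ge> N k" "r (Suc k) \<ge> N k" "r k \<ge> k" for k
  proof -
    have "N k \<le> (\<Sum>j\<le>k. N j)" by (rule member_le_sum) auto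
    then show "r k \<ge> N k" "r (Suc k) \<ge> N k" "r k \<ge> k" by (simp_all add: r_def)
  qed
  define D where "D k x = f (r (Suc k)) x - f (r k) x" for k x
  have D: "D k \<in> L2_fun M" for k unfolding D_def by (rule L2_fun_diff[OF f f])
  have D_meas [measurable]: "D k \<in> borel_measurable M" for k using D by (auto simp: L2_fun_def)
  have Dint: "(\<integral>x. cmod (D k x) \<partial>M) \<le> (1/2)^k" for k
    using integral_norm_le_L2_norm(2)[OF D, of k] N[OF r(2,1), of k] by (simp add: D_def[abs_def])
  have "(\<integral>\<^sup>+x. (\<Sum>k. ennreal (cmod (D k x))) \<partial>M) = (\<Sum>k. \<integral>\<^sup>+x. ennreal (cmod (D k x)) \<partial>M)"
    by (rule nn_integral_suminf) measurable
  also have "\<dots> \<le> (\<Sum>k. ennreal ((1/2)^k))"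
    using integral_norm_le_L2_norm(1)[OF D] Dint
    by (intro suminf_le) (auto simp: nn_integral_eq_integral)
  also have "\<dots> = ennreal (\<Sum>k. (1/2)^k)"
    by (rule suminf_ennreal2) (auto intro!: summable_geometric)
  finally have "(\<integral>\<^sup>+x. (\<Sum>k. ennreal (cmod (D k x))) \<partial>M) \<noteq> \<infinity>"
    by (auto simp: top_unique)
  then have "AE x in M. (\<Sum>k. ennreal (cmod (D k x))) \<noteq> \<infinity>"
    by (intro nn_integral_PInf_AE) measurable
  then have conv: "AE x in M. convergent (\<lambda>k. f (r k) x)"
  proof eventually_elim
    case (elim x)
    then have "summable (\<lambda>k. cmod (D k x))"
      by (intro summable_suminf_not_top) auto
    then have "summable (\<lambda>k. D k x)" by (rule summable_norm_cancel)
    then have "convergent (\<lambda>n. \<Sum>k<n. D k x)" by (simp add: summable_iff_convergent)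
    then have "convergent (\<lambda>n. f (r n) x - f (r 0) x)"
      using sum_lessThan_telescope[of "\<lambda>k. f (r k) x"] by (simp add: D_def)
    then have "convergent (\<lambda>n. (f (r n) x - f (r 0) x) + f (r 0) x)"
      by (intro convergent_add convergent_const)
    then show ?case by simp
  qed
  \<comment> \<open>\<open>lim\<close> has a value also where the sequence diverges, and it is
    measurable in \<open>x\<close>, so no exceptional null set has to be cut out.\<close>
  define g where "g x = lim (\<lambda>k. f (r k) x)" for x
  have g_lim: "AE x in M. (\<lambda>k. f (r k) x) \<longlonglongrightarrow> g x"
    using conv by eventually_elim (simp add: g_def convergent_LIMSEQ_iff)
  have [measurable]: "g \<in> borel_measurable M" unfolding g_def by measurable
  have key: "(\<integral>\<^sup>+x. ennreal ((cmod (f m x - g x))\<^sup>2) \<partial>M) \<le> ennreal (((1/2)^k)\<^sup>2)" if m: "m \<ge> N k" for m k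
  proof -
    have "(\<integral>\<^sup>+x. ennreal ((cmod (f m x - g x))\<^sup>2) \<partial>M)
        = (\<integral>\<^sup>+x. liminf (\<lambda>j. ennreal ((cmod (f m x - f (r j) x))\<^sup>2)) \<partial>M)"
    proof (rule nn_integral_cong_AE)
      show "AE x in M. ennreal ((cmod (f m x - g x))\<^sup>2) = liminf (\<lambda>j. ennreal ((cmod (f m x - f (r j) x))\<^sup>2))"
        using g_lim
      proof eventually_elim
        case (elim x)
        then have "(\<lambda>j. ennreal ((cmod (f m x - f (r j) x))\<^sup>2)) \<longlonglongrightarrow> ennreal ((cmod (f m x - g x))\<^sup>2)"
          by (intro tendsto_intros)
        then show ?case by (rule lim_imp_Liminf[OF trivial_limit_sequentially, symmetric])
      qed
    qed
    also have "\<dots> \<le> liminf (\<lambda>j. \<integral>\<^sup>+x. ennreal ((cmod (f m x - f (r j) x))\<^sup>2) \<partial>M)"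
      by (rule nn_integral_liminf) measurable
    also have "\<dots> \<le> ennreal (((1/2)^k)\<^sup>2)"
    proof (rule Liminf_le)
      have "(\<integral>\<^sup>+x. ennreal ((cmod (f m x - f (r j) x))\<^sup>2) \<partial>M) \<le> ennreal (((1/2)^k)\<^sup>2)" if "j \<ge> N k" for j
      proof -
        have d: "(\<lambda>x. f m x - f (r j) x) \<in> L2_fun M" by (rule L2_fun_diff[OF f f])
        have "L2_norm M (\<lambda>x. f m x - f (r j) x) < (1/2)^k"
          using N[of k m "r j"] m that r(3)[of j] by simp
        then have "(L2_norm M (\<lambda>x. f m x - f (r j) x))\<^sup>2 \<le> ((1/2)^k)\<^sup>2"
          by (intro power_mono) (auto simp: L2_norm_def)
        then have "(\<integral>x. (cmod (f m x - f (r j) x))\<^sup>2 \<partial>M) \<le> ((1/2)^k)\<^sup>2"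
          by (simp add: L2_norm_def)
        then show ?thesis using d
          by (subst nn_integral_eq_integral) (auto simp: L2_fun_def)
      qed
      then show "\<forall>\<^sub>F j in sequentially. (\<integral>\<^sup>+x. ennreal ((cmod (f m x - f (r j) x))\<^sup>2) \<partial>M) \<le> ennreal (((1/2)^k)\<^sup>2)"
        unfolding eventually_sequentially by blast
    qed simp
    finally show ?thesis .
  qed
  have fg: "(\<lambda>x. f m x - g x) \<in> L2_fun M" if "m \<ge> N 0" for m
  proof -
    have "integrable M (\<lambda>x. (cmod (f m x - g x))\<^sup>2)"
      using key[OF that] by (intro integrableI_nonneg) (auto simp: less_top[symmetric] top_unique)
    then show ?thesis by (auto simp: L2_fun_def)
  qed
  have g: "g \<in> L2_fun M"
    using L2_fun_diff[OF f fg[of "N 0"], of "N 0"] by simp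
  have fin: "L2_norm M (\<lambda>x. f m x - g x) \<le> (1/2)^k" if "m \<ge> N k" for m k
  proof -
    have "ennreal (\<integral>x. (cmod (f m x - g x))\<^sup>2 \<partial>M) \<le> ennreal (((1/2)^k)\<^sup>2)"
      using key[OF that] L2_fun_diff[OF f g, of m]
      by (subst (asm) nn_integral_eq_integral) (auto simp: L2_fun_def)
    then show ?thesis
      unfolding L2_norm_def by (intro real_le_lsqrt) (auto simp: ennreal_le_iff)
  qed
  have "(\<lambda>n. L2_norm M (\<lambda>x. f n x - g x)) \<longlonglongrightarrow> 0"
  proof (rule LIMSEQ_I)
    fix e :: real assume "e > 0"
    then obtain k where k: "(1/2)^k < e" using real_arch_pow_inv[of e "1/2"] by auto
    show "\<exists>no. \<forall>n\<ge>no. norm (L2_norm M (\<lambda>x. f n x - g x) - 0) < e"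
    proof (intro exI allI impI)
      fix n assume "n \<ge> N k"
      from fin[OF this] k show "norm (L2_norm M (\<lambda>x. f n x - g x) - 0) < e"
        by (simp add: L2_norm_def)
    qed
  qed
  with g show thesis by (rule that)
qed

text \<open>Completeness gives totally bounded orbits compact closure, so that the Kronecker algebra
  can be described by finite nets.\<close>

lemma (in prob_space) mcomplete_L2: "Metric_space.mcomplete (L2_space M) (L2_dist M)"
proof -
  interpret L2: Metric_space "L2_space M" "L2_dist M" by (rule Metric_space_L2)
  show ?thesis
    unfolding L2.mcomplete_def
  proof (intro allI impI)
    fix F assume C: "L2.MCauchy F"
    have "\<exists>f. f \<in> L2_fun M \<and> F n = L2_class M f" for n
    proof -
      have "F n \<in> L2_space M" using C by (auto simp: L2.MCauchy_def)
      then show ?thesis by (rule L2_space_cases) auto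
    qed
    then obtain f where f: "\<And>n. f n \<in> L2_fun M" "\<And>n. F n = L2_class M (f n)" by metis
    have "\<exists>N. \<forall>m\<ge>N. \<forall>n\<ge>N. L2_norm M (\<lambda>x. f m x - f n x) < e" if "e > 0" for e
      using C that f by (auto simp: L2.MCauchy_def L2_dist_class)
    from L2_Cauchy_limit[OF f(1) this] obtain g
      where g: "g \<in> L2_fun M" "(\<lambda>n. L2_norm M (\<lambda>x. f n x - g x)) \<longlonglongrightarrow> 0" by blast
    have "limitin L2.mtopology F (L2_class M g) sequentially"
      unfolding L2.limitin_metric_dist_null using g f by (simp add: L2_dist_class)
    then show "\<exists>x. limitin L2.mtopology F x sequentially" ..
  qed
qed

text \<open>The real part of a complex limit serves, since taking real parts fixes the sequence and
  does not increase the norm.\<close>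

lemma (in prob_space) L2_real_Cauchy_limit:
  assumes f: "\<And>n. f n \<in> L2_real M"
    and Cauchy: "\<And>e. e > 0 \<Longrightarrow> \<exists>N. \<forall>m\<ge>N. \<forall>n\<ge>N. nrm M (\<lambda>x. f m x - f n x) < e"
  obtains g where "g \<in> L2_real M" "(\<lambda>n. nrm M (\<lambda>x. f n x - g x)) \<longlonglongrightarrow> 0"
proof -
  have "L2_norm M (\<lambda>x. complex_of_real (f m x) - complex_of_real (f n x)) = nrm M (\<lambda>x. f m x - f n x)" for m n
    using L2_norm_of_real[of M "\<lambda>x. f m x - f n x"] by simp
  then obtain g where g: "g \<in> L2_fun M" "(\<lambda>n. L2_norm M (\<lambda>x. complex_of_real (f n x) - g x)) \<longlonglongrightarrow> 0"
    using L2_Cauchy_limit[of "\<lambda>n x. complex_of_real (f n x)"] f Cauchy by (auto simp: of_real_L2_fun)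
  have "nrm M (\<lambda>x. f n x - Re (g x)) \<le> L2_norm M (\<lambda>x. complex_of_real (f n x) - g x)" for n
    using nrm_Re_le[OF L2_fun_diff[OF of_real_L2_fun[OF f] g(1)], of n] by simp
  then have "(\<lambda>n. nrm M (\<lambda>x. f n x - Re (g x))) \<longlonglongrightarrow> 0"
    by (intro tendsto_sandwich[OF _ _ tendsto_const g(2)]) auto
  with L2_fun_Re_Im(1)[OF g(1)] show thesis by (rule that)
qed

section \<open>Almost orthogonality and nearly minimal norms\<close>

text \<open>For \<open>s = \<Sum> c i * d i\<close> with \<open>c i = ip M (d i) f\<close>, the
  left-hand side \<open>S\<close> equals \<open>ip M s f\<close>, and the Gram form gives
  \<open>ip M s s \<le> S * (D + \<eta> * card I)\<close>. Cauchy-Schwarz for \<open>s\<close> and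
  \<open>f\<close> then leaves one factor \<open>S\<close> to cancel. With \<open>\<eta>\<close> of
  order \<open>1 / card I\<close> the bound does not grow with the number of vectors.\<close>

lemma almost_orthogonal_Bessel:
  assumes I: "finite I" and d: "\<And>i. i \<in> I \<Longrightarrow> d i \<in> L2_real M" and f: "f \<in> L2_real M"
    and D: "\<And>i. i \<in> I \<Longrightarrow> ip M (d i) (d i) \<le> D"
    and \<eta>: "\<And>i j. i \<in> I \<Longrightarrow> j \<in> I \<Longrightarrow> i \<noteq> j \<Longrightarrow> \<bar>ip M (d i) (d j)\<bar> \<le> \<eta>" and "0 \<le> \<eta>" "0 \<le> D"
  shows "(\<Sum>i\<in>I. (ip M (d i) f)\<^sup>2) \<le> (D + \<eta> * card I) * (nrm M f)\<^sup>2"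
proof -
  define c where "c i = ip M (d i) f" for i
  define S where "S = (\<Sum>i\<in>I. (c i)\<^sup>2)"
  define s where "s = (\<lambda>x. \<Sum>i\<in>I. c i * d i x)"
  have s: "s \<in> L2_real M" unfolding s_def using d by (rule L2_real_sum)
  have Ss: "S = ip M s f"
    unfolding s_def S_def using d f by (simp add: ip_sum c_def power2_eq_square)
  have "ip M s s = (\<Sum>i\<in>I. c i * ip M (d i) s)"
    using d s unfolding s_def by (subst ip_sum) auto
  also have "\<dots> = (\<Sum>i\<in>I. c i * (\<Sum>j\<in>I. c j * ip M (d j) (d i)))"
  proof (rule sum.cong[OF refl])
    fix i assume "i \<in> I"
    then have "ip M (d i) s = (\<Sum>j\<in>I. c j * ip M (d j) (d i))"
      using d unfolding s_def by (subst ip_commute, subst ip_sum) auto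
    then show "c i * ip M (d i) s = c i * (\<Sum>j\<in>I. c j * ip M (d j) (d i))" by simp
  qed
  \<comment> \<open>The diagonal also receives the nonnegative \<open>\<eta>\<close> term, so that
    this term is summed over all pairs and evaluates in closed form.\<close>
  also have "\<dots> \<le> (\<Sum>i\<in>I. \<Sum>j\<in>I. (if i = j then (c i)\<^sup>2 * D else 0) + \<eta> * ((c i)\<^sup>2 + (c j)\<^sup>2) / 2)"
    unfolding sum_distrib_left
  proof (intro sum_mono)
    fix i j assume ij: "i \<in> I" "j \<in> I"
    show "c i * (c j * ip M (d j) (d i)) \<le> (if i = j then (c i)\<^sup>2 * D else 0) + \<eta> * ((c i)\<^sup>2 + (c j)\<^sup>2) / 2"
    proof (cases "i = j")
      case True
      have "(c i)\<^sup>2 * ip M (d i) (d i) \<le> (c i)\<^sup>2 * D"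
        using D ij by (intro mult_left_mono) auto
      moreover have "0 \<le> \<eta> * ((c i)\<^sup>2 + (c j)\<^sup>2) / 2" using \<open>0 \<le> \<eta>\<close> by simp
      ultimately show ?thesis using True by (simp add: power2_eq_square mult.assoc)
    next
      case False
      have "c i * (c j * ip M (d j) (d i)) \<le> (\<bar>c i\<bar> * \<bar>c j\<bar>) * \<bar>ip M (d j) (d i)\<bar>"
        by (metis abs_ge_self abs_mult mult.assoc)
      also have "\<dots> \<le> (\<bar>c i\<bar> * \<bar>c j\<bar>) * \<eta>"
        using \<eta>[of j i] ij False by (intro mult_left_mono) auto
      also have "\<dots> \<le> ((c i)\<^sup>2 + (c j)\<^sup>2) / 2 * \<eta>"
        using sum_squares_bound[of "\<bar>c i\<bar>" "\<bar>c j\<bar>"] \<open>0 \<le> \<eta>\<close> by (intro mult_right_mono) auto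
      finally show ?thesis using False by (simp add: mult.commute)
    qed
  qed
  also have "\<dots> = (\<Sum>i\<in>I. (c i)\<^sup>2 * D) + (\<Sum>i\<in>I. \<Sum>j\<in>I. \<eta> / 2 * (c i)\<^sup>2 + \<eta> / 2 * (c j)\<^sup>2)"
    using I by (simp add: sum.distrib sum.delta' algebra_simps add_divide_distrib)
  also have "\<dots> = S * (D + \<eta> * card I)"
    by (simp only: sum.distrib sum_constant sum_distrib_left[symmetric] sum_distrib_right[symmetric]
          S_def[symmetric]) (simp add: algebra_simps)
  finally have ss: "ip M s s \<le> S * (D + \<eta> * card I)" .
  have "S \<ge> 0" unfolding S_def by (simp add: sum_nonneg)
  have "S\<^sup>2 \<le> (nrm M s)\<^sup>2 * (nrm M f)\<^sup>2"
    using ip_Cauchy_Schwarz[OF s f] power_mono[of "\<bar>ip M s f\<bar>" "nrm M s * nrm M f" 2]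
    by (simp add: Ss power_mult_distrib)
  also have "\<dots> \<le> S * (D + \<eta> * card I) * (nrm M f)\<^sup>2"
    using ss by (intro mult_right_mono) (auto simp: nrm_power2 ip_self_nonneg)
  finally have "S * S \<le> S * ((D + \<eta> * card I) * (nrm M f)\<^sup>2)"
    by (simp add: power2_eq_square mult.assoc)
  then have "S \<le> (D + \<eta> * card I) * (nrm M f)\<^sup>2 \<or> S = 0"
    using \<open>S \<ge> 0\<close> by (metis mult_le_cancel_left_pos order_less_le)
  moreover have "0 \<le> (D + \<eta> * card I) * (nrm M f)\<^sup>2"
    using \<open>0 \<le> \<eta>\<close> \<open>0 \<le> D\<close> by simp
  ultimately show ?thesis by (auto simp: S_def c_def)
qed

text \<open>Ramsey's theorem makes all mutual inner products nearly equal, so differences over disjoint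
  pairs are nearly orthogonal.\<close>

lemma almost_orthogonal_differences:
  fixes h :: "nat \<Rightarrow> 'a \<Rightarrow> real"
  assumes h: "\<And>i. h i \<in> L2_real M" and B: "\<And>i j. \<bar>ip M (h i) (h j)\<bar> \<le> B" and "\<eta> > 0"
  obtains e :: "nat \<Rightarrow> nat" where "inj e"
    "\<And>i j. i \<noteq> j \<Longrightarrow> \<bar>ip M (\<lambda>x. h (e (2 * i)) x - h (e (2 * i + 1)) x)
                          (\<lambda>x. h (e (2 * j)) x - h (e (2 * j + 1)) x)\<bar> \<le> \<eta>"
proof -
  \<comment> \<open>Inner products are sorted into bins of width \<open>\<eta> / 2\<close>. Adding
    \<open>B\<close> makes them nonnegative, so \<open>nat\<close> loses nothing, and leaves
    finitely many colours.\<close>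
  define c where "c i j = nat \<lfloor>2 * (ip M (h i) (h j) + B) / \<eta>\<rfloor>" for i j
  have c_comm: "c i j = c j i" for i j by (simp add: c_def ip_commute)
  define col where "col X = c (Min X) (Max X)" for X
  have col: "col {i, j} = c i j" for i j
    by (cases "i \<le> j") (auto simp: col_def min_def max_def c_comm)
  have "c i j < Suc (nat \<lfloor>4 * B / \<eta>\<rfloor>)" for i j
  proof -
    have "2 * (ip M (h i) (h j) + B) / \<eta> \<le> 4 * B / \<eta>"
      using B[of i j] \<open>\<eta> > 0\<close> by (intro divide_right_mono) auto
    then show ?thesis by (simp add: c_def less_Suc_eq_le nat_mono floor_mono)
  qed
  then obtain Y t where Y: "infinite Y" "\<And>i j. i \<in> Y \<Longrightarrow> j \<in> Y \<Longrightarrow> i \<noteq> j \<Longrightarrow> col {i, j} = t"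
    using Ramsey2[of "UNIV :: nat set" col "Suc (nat \<lfloor>4 * B / \<eta>\<rfloor>)"] by (auto simp: col)
  have close: "\<bar>ip M (h i) (h j) - ip M (h k) (h l)\<bar> \<le> \<eta> / 2"
    if "i \<in> Y" "j \<in> Y" "i \<noteq> j" "k \<in> Y" "l \<in> Y" "k \<noteq> l" for i j k l
  proof -
    have "c i j = c k l" using Y(2)[of i j] Y(2)[of k l] that by (simp add: col)
    moreover have "0 \<le> 2 * (ip M (h i) (h j) + B) / \<eta>" "0 \<le> 2 * (ip M (h k) (h l) + B) / \<eta>"
      using B[of i j] B[of k l] \<open>\<eta> > 0\<close> by auto
    ultimately have "\<lfloor>2 * (ip M (h i) (h j) + B) / \<eta>\<rfloor> = \<lfloor>2 * (ip M (h k) (h l) + B) / \<eta>\<rfloor>"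
      unfolding c_def by (subst (asm) eq_nat_nat_iff) (simp_all only: zero_le_floor)
    then have "\<bar>2 * (ip M (h i) (h j) + B) / \<eta> - 2 * (ip M (h k) (h l) + B) / \<eta>\<bar> \<le> 1"
      by linarith
    also have "2 * (ip M (h i) (h j) + B) / \<eta> - 2 * (ip M (h k) (h l) + B) / \<eta>
        = 2 * (ip M (h i) (h j) - ip M (h k) (h l)) / \<eta>"
      by (simp add: diff_divide_distrib[symmetric])
    finally show ?thesis
      using \<open>\<eta> > 0\<close> unfolding abs_divide abs_mult by (simp add: divide_le_eq)
  qed
  define e where "e = enumerate Y"
  have inj: "inj e" unfolding e_def
    using Y(1) by (intro strict_mono_imp_inj_on strict_mono_enumerate)
  have eY: "e i \<in> Y" for i unfolding e_def using Y(1) by (rule enumerate_in_set)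
  show thesis
  proof (rule that[OF inj])
    fix i j :: nat assume "i \<noteq> j"
    then have ne: "2 * i \<noteq> 2 * j" "2 * i \<noteq> 2 * j + 1" "2 * i + 1 \<noteq> 2 * j" "2 * i + 1 \<noteq> 2 * j + 1"
      by presburger+
    let ?a = "e (2 * i)" and ?b = "e (2 * i + 1)" and ?c = "e (2 * j)" and ?d = "e (2 * j + 1)"
    have neq: "?a \<noteq> ?c" "?a \<noteq> ?d" "?b \<noteq> ?c" "?b \<noteq> ?d"
      using ne inj unfolding inj_eq[OF inj] by auto
    \<comment> \<open>Expanding gives two differences of inner products of distinct vectors, each at
      most one bin wide. The norms of the vectors do not enter because the pairs are
      disjoint.\<close>
    have "ip M (\<lambda>x. h ?a x - h ?b x) (\<lambda>x. h ?c x - h ?d x)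
        = (ip M (h ?a) (h ?c) - ip M (h ?a) (h ?d)) - (ip M (h ?b) (h ?c) - ip M (h ?b) (h ?d))"
      using h by (simp add: ip_diff ip_diff_right L2_real_diff)
    moreover have "\<bar>ip M (h ?a) (h ?c) - ip M (h ?a) (h ?d)\<bar> \<le> \<eta> / 2"
      "\<bar>ip M (h ?b) (h ?c) - ip M (h ?b) (h ?d)\<bar> \<le> \<eta> / 2"
      using close eY neq by auto
    ultimately show "\<bar>ip M (\<lambda>x. h ?a x - h ?b x) (\<lambda>x. h ?c x - h ?d x)\<bar> \<le> \<eta>"
      by linarith
  qed
qed

text \<open>The parallelogram law forces elements of nearly minimal norm to be close to each other.\<close>

lemma midpoint_closed_Cauchy_selection:
  fixes G :: "nat \<Rightarrow> ('a \<Rightarrow> real) set"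
  assumes L2: "\<And>n. G n \<subseteq> L2_real M" and ne: "\<And>n. G n \<noteq> {}"
    and dec: "\<And>m n. m \<le> n \<Longrightarrow> G n \<subseteq> G m"
    and mid: "\<And>n f g. f \<in> G n \<Longrightarrow> g \<in> G n \<Longrightarrow> (\<lambda>x. (1/2) * (f x + g x)) \<in> G n"
    and bdd: "\<And>n f. f \<in> G n \<Longrightarrow> nrm M f \<le> B"
  obtains g where "\<And>n. g n \<in> G n"
    "\<And>e. e > 0 \<Longrightarrow> \<exists>N. \<forall>m\<ge>N. \<forall>n\<ge>N. nrm M (\<lambda>x. g m x - g n x) < e"
proof -
  \<comment> \<open>These infima increase as the sets shrink and are bounded by
    \<open>B\<^sup>2\<close>, so they form a Cauchy sequence even if no set attains its
    infimum.\<close>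
  define d where "d n = (INF f\<in>G n. ip M f f)" for n
  have bb: "bdd_below ((\<lambda>f. ip M f f) ` G n)" for n
    by (rule bdd_belowI[of _ 0]) (auto simp: ip_self_nonneg)
  have d_le: "d n \<le> ip M f f" if "f \<in> G n" for f n
    unfolding d_def using bb that by (rule cINF_lower)
  have "incseq d"
    unfolding incseq_def d_def using ne bb dec by (intro allI impI cINF_superset_mono) auto
  have "d n \<le> B\<^sup>2" for n
  proof -
    obtain f where f: "f \<in> G n" using ne by blast
    have "ip M f f \<le> B\<^sup>2" using bdd[OF f] by (simp add: nrm_power2[symmetric] power_mono)
    then show ?thesis using d_le[OF f] by simp
  qed
  then have "bdd_above (range d)" by (intro bdd_aboveI[of _ "B\<^sup>2"]) auto
  then have conv: "Cauchy d"
    using \<open>incseq d\<close> LIMSEQ_incseq_SUP LIMSEQ_imp_Cauchy by blast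
  have "\<exists>f\<in>G n. ip M f f < d n + 1 / real (Suc n)" for n
    using cINF_less_iff[OF ne bb, of n "d n + 1 / real (Suc n)"] by (simp add: d_def)
  then obtain g where g: "\<And>n. g n \<in> G n" "\<And>n. ip M (g n) (g n) < d n + 1 / real (Suc n)"
    by metis
  have key: "ip M (\<lambda>x. g m x - g n x) (\<lambda>x. g m x - g n x) \<le> 2 * (d n - d m) + 4 / real (Suc m)"
    if "m \<le> n" for m n
  proof -
    have in_m: "g m \<in> G m" "g n \<in> G m" using g(1) dec[OF that] by auto
    have L: "g m \<in> L2_real M" "g n \<in> L2_real M" using g(1) L2 by auto
    \<comment> \<open>The midpoint lies in the larger set \<open>G m\<close>, which bounds its
      squared norm from below by \<open>d m\<close>; the parallelogram identity turns this into an
      upper bound for the distance.\<close>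
    have "d m \<le> ip M (\<lambda>x. (1/2) * (g m x + g n x)) (\<lambda>x. (1/2) * (g m x + g n x))"
      by (intro d_le mid in_m)
    also have "\<dots> = (ip M (g m) (g m) + 2 * ip M (g m) (g n) + ip M (g n) (g n)) / 4"
      by (simp only: ip_scale ip_scale_right ip_self_add[OF L])
    finally have "4 * d m \<le> ip M (g m) (g m) + 2 * ip M (g m) (g n) + ip M (g n) (g n)" by simp
    moreover have "ip M (g n) (g n) < d n + 1 / real (Suc m)"
      using g(2)[of n] that frac_le[of 1 1 "real (Suc m)" "real (Suc n)"] by simp
    moreover have "4 / real (Suc m) = 4 * (1 / real (Suc m))" by simp
    ultimately show ?thesis using g(2)[of m] unfolding ip_self_diff[OF L] by argo
  qed
  show thesis
  proof (rule that[OF g(1)])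
    fix e :: real assume e: "e > 0"
    obtain N1 where N1: "\<And>m n. m \<ge> N1 \<Longrightarrow> n \<ge> N1 \<Longrightarrow> \<bar>d m - d n\<bar> < e\<^sup>2 / 4"
      using conv e unfolding Cauchy_def dist_real_def
      by (metis divide_pos_pos zero_less_numeral zero_less_power)
    \<comment> \<open>Half of \<open>e\<^sup>2\<close> covers the slack \<open>4 / Suc m\<close>,
      the other half covers twice the gap between the infima.\<close>
    obtain N2 where N2: "8 / e\<^sup>2 < real N2" using reals_Archimedean2 by blast
    have le: "nrm M (\<lambda>x. g m x - g n x) < e" if "max N1 N2 \<le> m" "m \<le> n" for m n
    proof -
      have "8 / e\<^sup>2 < real (Suc m)" using N2 that by simp
      then have "4 / real (Suc m) < e\<^sup>2 / 2" using e by (simp add: field_simps)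
      moreover have "\<bar>d m - d n\<bar> < e\<^sup>2 / 4" using N1[of m n] that by simp
      ultimately have "ip M (\<lambda>x. g m x - g n x) (\<lambda>x. g m x - g n x) < e\<^sup>2"
        using key[OF that(2)] by argo
      then show ?thesis unfolding nrm_def using e real_sqrt_less_mono by fastforce
    qed
    show "\<exists>N. \<forall>m\<ge>N. \<forall>n\<ge>N. nrm M (\<lambda>x. g m x - g n x) < e"
    proof (intro exI allI impI)
      fix m n assume "max N1 N2 \<le> m" "max N1 N2 \<le> n"
      then show "nrm M (\<lambda>x. g m x - g n x) < e"
        using le[of m n] le[of n m] nrm_diff_commute[of M "g m" "g n"] by (cases "m \<le> n") auto
    qed
  qed
qed

text \<open>The positive operator \<open>\<Sum> a\<^sub>p u\<^sub>p \<otimes> u\<^sub>p\<close>.\<close>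

definition rank_sum :: "'a measure \<Rightarrow> 'p set \<Rightarrow> ('p \<Rightarrow> real) \<Rightarrow> ('p \<Rightarrow> 'a \<Rightarrow> real) \<Rightarrow> ('a \<Rightarrow> real) \<Rightarrow> 'a \<Rightarrow> real"
  where "rank_sum M P a u h = (\<lambda>x. \<Sum>p\<in>P. (a p * ip M h (u p)) * u p x)"

lemma rank_sum_L2: "(\<And>p. p \<in> P \<Longrightarrow> u p \<in> L2_real M) \<Longrightarrow> rank_sum M P a u h \<in> L2_real M"
  unfolding rank_sum_def by (rule L2_real_sum)

lemma rank_sum_diff:
  assumes "\<And>p. p \<in> P \<Longrightarrow> u p \<in> L2_real M" "h \<in> L2_real M" "k \<in> L2_real M"
  shows "rank_sum M P a u (\<lambda>x. h x - k x) = (\<lambda>x. rank_sum M P a u h x - rank_sum M P a u k x)"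
  using assms by (simp add: rank_sum_def ip_diff algebra_simps sum_subtractf)

text \<open>Splitting \<open>a p\<close> into two square roots and applying Cauchy-Schwarz leaves
  the total mass and a weighted sum of squares. When this is summed over several \<open>h\<close>,
  the Bessel estimate applies for each \<open>p\<close> separately.\<close>

lemma nrm_rank_sum:
  assumes P: "\<And>p. p \<in> P \<Longrightarrow> u p \<in> L2_real M" "\<And>p. p \<in> P \<Longrightarrow> nrm M (u p) \<le> R"
    and a: "\<And>p. p \<in> P \<Longrightarrow> 0 \<le> a p" and C: "sum a P \<le> C"
  shows "(nrm M (rank_sum M P a u h))\<^sup>2 \<le> R\<^sup>2 * C * (\<Sum>p\<in>P. a p * (ip M h (u p))\<^sup>2)"
proof -
  have "nrm M (rank_sum M P a u h) \<le> (\<Sum>p\<in>P. \<bar>a p * ip M h (u p)\<bar> * nrm M (u p))"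
    unfolding rank_sum_def by (rule nrm_sum) (rule P)
  also have "\<dots> \<le> (\<Sum>p\<in>P. \<bar>a p * ip M h (u p)\<bar> * R)"
    using P(2) by (intro sum_mono mult_left_mono) auto
  also have "\<dots> = R * (\<Sum>p\<in>P. sqrt (a p) * (sqrt (a p) * \<bar>ip M h (u p)\<bar>))"
    using a by (subst sum_distrib_left) (auto intro!: sum.cong simp: abs_mult simp flip: mult.assoc)
  finally have "(nrm M (rank_sum M P a u h))\<^sup>2
      \<le> (R * (\<Sum>p\<in>P. sqrt (a p) * (sqrt (a p) * \<bar>ip M h (u p)\<bar>)))\<^sup>2"
    by (intro power_mono) auto
  also have "\<dots> \<le> R\<^sup>2 * ((\<Sum>p\<in>P. (sqrt (a p))\<^sup>2) * (\<Sum>p\<in>P. (sqrt (a p) * \<bar>ip M h (u p)\<bar>)\<^sup>2))"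
    unfolding power_mult_distrib[of R] by (intro mult_left_mono Cauchy_Schwarz_ineq_sum) auto
  also have "\<dots> = R\<^sup>2 * (sum a P * (\<Sum>p\<in>P. a p * (ip M h (u p))\<^sup>2))"
    using a by (simp add: power_mult_distrib)
  also have "\<dots> \<le> R\<^sup>2 * (C * (\<Sum>p\<in>P. a p * (ip M h (u p))\<^sup>2))"
    using C a by (intro mult_left_mono mult_right_mono sum_nonneg) auto
  finally show ?thesis by (simp add: mult.assoc)
qed

section \<open>Averaging operators along a direction\<close>

definition offset :: "real \<Rightarrow> int \<times> int \<Rightarrow> real" where
  "offset \<beta> p = of_int (snd p) - \<beta> * of_int (fst p)"

lemma offset_diff: "offset \<beta> (p - q) = offset \<beta> p - offset \<beta> q"
  by (simp add: offset_def algebra_simps)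

lemma mem_strip_iff: "p \<in> strip \<beta> b \<longleftrightarrow> \<bar>offset \<beta> p\<bar> \<le> b"
  by (cases p) (auto simp: strip_def offset_def abs_le_iff)

text \<open>The sum over \<open>F\<close> in the fourth clause bounds the \<open>\<ell>\<^sup>1\<close>-distance of \<open>a\<close> to its translate by \<open>q\<close>.
  The fifth clause bounds \<open>\<langle>A f, f\<rangle>\<close> from below when \<open>\<phi> p = \<langle>f, U\<^sup>p f\<rangle>\<close>.\<close>

definition weights :: "real \<Rightarrow> real \<Rightarrow> real \<Rightarrow> real \<Rightarrow> (int \<times> int \<Rightarrow> real) \<Rightarrow> nat \<Rightarrow> (int \<times> int \<Rightarrow> real) set"
  where "weights \<beta> L C c \<phi> n = {a. (\<forall>p. 0 \<le> a p) \<and> finite {p. a p \<noteq> 0} \<and>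
     (\<forall>F. finite F \<longrightarrow> sum a F \<le> C) \<and>
     (\<forall>q F. finite F \<longrightarrow> \<bar>fst q\<bar> \<le> int n \<longrightarrow>
        (\<Sum>p\<in>F. \<bar>a (p - q) - a p\<bar>) \<le> L * \<bar>offset \<beta> q\<bar> + 1 / real (Suc n)) \<and>
     c \<le> (\<Sum>p | a p \<noteq> 0. a p * (\<phi> p)\<^sup>2)}"

lemma weightsD:
  assumes "a \<in> weights \<beta> L C c \<phi> n"
  shows "0 \<le> a p" "finite {p. a p \<noteq> 0}" "finite F \<Longrightarrow> sum a F \<le> C"
    "finite F \<Longrightarrow> \<bar>fst q\<bar> \<le> int n \<Longrightarrow>
      (\<Sum>p\<in>F. \<bar>a (p - q) - a p\<bar>) \<le> L * \<bar>offset \<beta> q\<bar> + 1 / real (Suc n)"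
    "c \<le> (\<Sum>p | a p \<noteq> 0. a p * (\<phi> p)\<^sup>2)"
proof -
  note w = assms[unfolded weights_def mem_Collect_eq]
  show "0 \<le> a p" "finite {p. a p \<noteq> 0}" "finite F \<Longrightarrow> sum a F \<le> C"
    "c \<le> (\<Sum>p | a p \<noteq> 0. a p * (\<phi> p)\<^sup>2)"
    using w by blast+
  show "(\<Sum>p\<in>F. \<bar>a (p - q) - a p\<bar>) \<le> L * \<bar>offset \<beta> q\<bar> + 1 / real (Suc n)"
    if "finite F" "\<bar>fst q\<bar> \<le> int n"
    using w that by blast
qed

text \<open>Every clause is convex in the weights. The last one sums over the support, which varies,
  so all three sums are extended to the union of the supports.\<close>

lemma weights_midpoint:
  assumes "a \<in> weights \<beta> L C c \<phi> n" "b \<in> weights \<beta> L C c \<phi> n"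
  shows "(\<lambda>p. (1/2) * (a p + b p)) \<in> weights \<beta> L C c \<phi> n"
proof -
  let ?m = "\<lambda>p. (1/2) * (a p + b p)"
  let ?F = "{p. a p \<noteq> 0} \<union> {p. b p \<noteq> 0}"
  have nn: "0 \<le> a p" "0 \<le> b p" for p by (rule weightsD(1)[OF assms(1)], rule weightsD(1)[OF assms(2)])
  have fin: "finite ?F" using weightsD(2)[OF assms(1)] weightsD(2)[OF assms(2)] by (rule finite_UnI)
  have supp: "{p. ?m p \<noteq> 0} \<subseteq> ?F" by auto
  have finm: "finite {p. ?m p \<noteq> 0}" using fin supp by (rule finite_subset[rotated])
  have "sum ?m F \<le> C" if "finite F" for F
  proof -
    have "sum a F \<le> C" "sum b F \<le> C" by (rule weightsD(3)[OF assms(1) that], rule weightsD(3)[OF assms(2) that])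
    then show ?thesis unfolding sum_distrib_left[symmetric] sum.distrib by simp
  qed
  moreover have "(\<Sum>p\<in>F. \<bar>?m (p - q) - ?m p\<bar>) \<le> L * \<bar>offset \<beta> q\<bar> + 1 / real (Suc n)"
    if "finite F" "\<bar>fst q\<bar> \<le> int n" for F q
  proof -
    have "(\<Sum>p\<in>F. \<bar>?m (p - q) - ?m p\<bar>) \<le> (\<Sum>p\<in>F. (1/2) * (\<bar>a (p - q) - a p\<bar> + \<bar>b (p - q) - b p\<bar>))"
    proof (intro sum_mono)
      fix p
      have "?m (p - q) - ?m p = (1/2) * ((a (p - q) - a p) + (b (p - q) - b p))" by argo
      then show "\<bar>?m (p - q) - ?m p\<bar> \<le> (1/2) * (\<bar>a (p - q) - a p\<bar> + \<bar>b (p - q) - b p\<bar>)"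
        using abs_triangle_ineq[of "a (p - q) - a p" "b (p - q) - b p"] by (simp only: abs_mult) simp
    qed
    also have "\<dots> = (1/2) * ((\<Sum>p\<in>F. \<bar>a (p - q) - a p\<bar>) + (\<Sum>p\<in>F. \<bar>b (p - q) - b p\<bar>))"
      by (simp only: sum_distrib_left[symmetric] sum.distrib)
    also have "\<dots> \<le> L * \<bar>offset \<beta> q\<bar> + 1 / real (Suc n)"
    proof -
      have "(\<Sum>p\<in>F. \<bar>a (p - q) - a p\<bar>) \<le> L * \<bar>offset \<beta> q\<bar> + 1 / real (Suc n)"
        "(\<Sum>p\<in>F. \<bar>b (p - q) - b p\<bar>) \<le> L * \<bar>offset \<beta> q\<bar> + 1 / real (Suc n)"
        by (rule weightsD(4)[OF assms(1) that], rule weightsD(4)[OF assms(2) that])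
      then show ?thesis by argo
    qed
    finally show ?thesis .
  qed
  moreover have "c \<le> (\<Sum>p | ?m p \<noteq> 0. ?m p * (\<phi> p)\<^sup>2)"
  proof -
    have "(\<Sum>p | ?m p \<noteq> 0. ?m p * (\<phi> p)\<^sup>2) = (\<Sum>p\<in>?F. ?m p * (\<phi> p)\<^sup>2)"
      by (rule sum.mono_neutral_left[OF fin supp]) auto
    also have "\<dots> = (1/2) * ((\<Sum>p\<in>?F. a p * (\<phi> p)\<^sup>2) + (\<Sum>p\<in>?F. b p * (\<phi> p)\<^sup>2))"
      unfolding sum.distrib[symmetric] sum_distrib_left
      by (rule sum.cong[OF refl]) (simp add: algebra_simps)
    also have "(\<Sum>p\<in>?F. a p * (\<phi> p)\<^sup>2) = (\<Sum>p | a p \<noteq> 0. a p * (\<phi> p)\<^sup>2)"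
      by (rule sum.mono_neutral_right[OF fin]) auto
    also have "(\<Sum>p\<in>?F. b p * (\<phi> p)\<^sup>2) = (\<Sum>p | b p \<noteq> 0. b p * (\<phi> p)\<^sup>2)"
      by (rule sum.mono_neutral_right[OF fin]) auto
    finally have e: "(\<Sum>p | ?m p \<noteq> 0. ?m p * (\<phi> p)\<^sup>2)
        = (1/2) * ((\<Sum>p | a p \<noteq> 0. a p * (\<phi> p)\<^sup>2) + (\<Sum>p | b p \<noteq> 0. b p * (\<phi> p)\<^sup>2))" .
    have "c \<le> (\<Sum>p | a p \<noteq> 0. a p * (\<phi> p)\<^sup>2)" "c \<le> (\<Sum>p | b p \<noteq> 0. b p * (\<phi> p)\<^sup>2)"
      by (rule weightsD(5)[OF assms(1)], rule weightsD(5)[OF assms(2)])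
    then show ?thesis unfolding e by argo
  qed
  ultimately show ?thesis using finm nn unfolding weights_def mem_Collect_eq by (intro conjI allI impI) auto
qed

text \<open>A larger \<open>n\<close> tests more translations and tolerates less.\<close>

lemma weights_antimono: "m \<le> n \<Longrightarrow> weights \<beta> L C c \<phi> n \<subseteq> weights \<beta> L C c \<phi> m"
proof
  fix a assume mn: "m \<le> n" and a: "a \<in> weights \<beta> L C c \<phi> n"
  have "1 / real (Suc n) \<le> 1 / real (Suc m)" using mn by (intro frac_le) auto
  then have "(\<Sum>p\<in>F. \<bar>a (p - q) - a p\<bar>) \<le> L * \<bar>offset \<beta> q\<bar> + 1 / real (Suc m)"
    if "finite F" "\<bar>fst q\<bar> \<le> int m" for F q
  proof -
    have "\<bar>fst q\<bar> \<le> int n" using that(2) mn by simp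
    then have "(\<Sum>p\<in>F. \<bar>a (p - q) - a p\<bar>) \<le> L * \<bar>offset \<beta> q\<bar> + 1 / real (Suc n)"
      using weightsD(4)[OF a that(1)] by blast
    then show ?thesis using \<open>1 / real (Suc n) \<le> 1 / real (Suc m)\<close> by linarith
  qed
  then show "a \<in> weights \<beta> L C c \<phi> m"
    unfolding weights_def mem_Collect_eq by (intro conjI allI impI weightsD[OF a]) auto
qed

context Z2_system
begin

lemma T_T: "T p (T q x) = T (p + q) x"
  by (simp add: T_add)

lemma L2_real_T:
  assumes "f \<in> L2_real M"
  shows "(\<lambda>x. f (T p x)) \<in> L2_real M"
proof -
  have f [measurable]: "f \<in> borel_measurable M" and "integrable (distr M M (T p)) (\<lambda>x. (f x)\<^sup>2)"
    using assms by (auto simp: L2_real_def distr_T)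
  then have "integrable M (\<lambda>x. (f (T p x))\<^sup>2)" by (intro integrable_distr[OF T_measurable])
  then show ?thesis by (simp add: L2_real_def)
qed

lemma ip_T:
  assumes "f \<in> L2_real M" "g \<in> L2_real M"
  shows "ip M (\<lambda>x. f (T p x)) (\<lambda>x. g (T p x)) = ip M f g"
proof -
  have [measurable]: "f \<in> borel_measurable M" "g \<in> borel_measurable M"
    using assms by (auto simp: L2_real_def)
  have "(\<integral>x. f x * g x \<partial>distr M M (T p)) = (\<integral>x. f (T p x) * g (T p x) \<partial>M)"
    by (rule integral_distr) measurable
  then show ?thesis by (simp add: distr_T ip_def)
qed

lemma nrm_T: "f \<in> L2_real M \<Longrightarrow> nrm M (\<lambda>x. f (T p x)) = nrm M f"
  by (simp add: nrm_def ip_T)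

definition corr :: "('a \<Rightarrow> real) \<Rightarrow> int \<times> int \<Rightarrow> real" where
  "corr f p = ip M f (\<lambda>x. f (T p x))"

lemma ip_T_T:
  assumes "f \<in> L2_real M"
  shows "ip M (\<lambda>x. f (T q x)) (\<lambda>x. f (T p x)) = corr f (p - q)"
proof -
  have "ip M (\<lambda>x. f (T q x)) (\<lambda>x. f (T (p - q) (T q x))) = corr f (p - q)"
    unfolding corr_def using assms L2_real_T by (intro ip_T)
  then show ?thesis by (simp add: T_T)
qed

lemma abs_corr_le: "f \<in> L2_real M \<Longrightarrow> \<bar>corr f p\<bar> \<le> (nrm M f)\<^sup>2"
  using ip_Cauchy_Schwarz[OF _ L2_real_T, of f f p]
  by (simp add: corr_def nrm_T power2_eq_square)

abbreviation avg_op :: "('a \<Rightarrow> real) \<Rightarrow> (int \<times> int \<Rightarrow> real) \<Rightarrow> ('a \<Rightarrow> real) \<Rightarrow> 'a \<Rightarrow> real" where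
  "avg_op f a h \<equiv> rank_sum M {p. a p \<noteq> 0} a (\<lambda>p x. f (T p x)) h"

lemma avg_op_L2: "f \<in> L2_real M \<Longrightarrow> avg_op f a h \<in> L2_real M"
  by (intro rank_sum_L2 L2_real_T)

lemma avg_op_superset:
  assumes "finite F" "{p. a p \<noteq> 0} \<subseteq> F"
  shows "avg_op f a h = rank_sum M F a (\<lambda>p x. f (T p x)) h"
  unfolding rank_sum_def using assms by (intro ext sum.mono_neutral_left) auto

text \<open>Replacing \<open>p\<close> by \<open>p - q\<close> gives the coefficient
  \<open>a (p - q) * corr f (p - q)\<close> in the translate of \<open>A f\<close>, while
  \<open>A\<close> applied to the translate of \<open>f\<close> has
  \<open>a p * corr f (p - q)\<close>. The correlations agree, so only the variation of
  \<open>a\<close> remains. The cube consists of two factors from the correlation and one from the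
  translate of \<open>f\<close>.\<close>

lemma avg_op_almost_commutes:
  assumes f: "f \<in> L2_real M" and a: "a \<in> weights \<beta> L C c \<phi> n" and q: "\<bar>fst q\<bar> \<le> int n"
  shows "nrm M (\<lambda>x. avg_op f a f (T q x) - avg_op f a (\<lambda>y. f (T q y)) x)
    \<le> (L * \<bar>offset \<beta> q\<bar> + 1 / real (Suc n)) * (nrm M f)^3"
proof -
  define S where "S = {p. a p \<noteq> 0}"
  define F where "F = S \<union> (\<lambda>p. p + q) ` S"
  have S: "finite S" unfolding S_def by (rule weightsD(2)[OF a])
  then have F: "finite F" by (simp add: F_def)
  have "avg_op f a f (T q x) = (\<Sum>p\<in>F. (a (p - q) * corr f (p - q)) * f (T p x))" for x
  proof -
    have "avg_op f a f (T q x) = (\<Sum>p\<in>S. (a p * corr f p) * f (T (p + q) x))"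
      by (simp add: rank_sum_def S_def T_T corr_def)
    also have "\<dots> = (\<Sum>p\<in>(\<lambda>p. p + q) ` S. (a (p - q) * corr f (p - q)) * f (T p x))"
      by (subst sum.reindex) (auto simp: inj_on_def)
    also have "\<dots> = (\<Sum>p\<in>F. (a (p - q) * corr f (p - q)) * f (T p x))"
    proof (rule sum.mono_neutral_left)
      have "p \<in> (\<lambda>p. p + q) ` S" if "a (p - q) \<noteq> 0" for p
        using that by (intro image_eqI[of _ _ "p - q"]) (auto simp: S_def)
      then show "\<forall>p\<in>F - (\<lambda>p. p + q) ` S. (a (p - q) * corr f (p - q)) * f (T p x) = 0" by auto
    qed (use F in \<open>auto simp: F_def\<close>)
    finally show ?thesis .
  qed
  moreover have "avg_op f a (\<lambda>y. f (T q y)) x = (\<Sum>p\<in>F. (a p * corr f (p - q)) * f (T p x))" for x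
    using F by (subst avg_op_superset[of F]) (auto simp: rank_sum_def ip_T_T[OF f] F_def S_def)
  ultimately have "nrm M (\<lambda>x. avg_op f a f (T q x) - avg_op f a (\<lambda>y. f (T q y)) x)
      = nrm M (\<lambda>x. \<Sum>p\<in>F. ((a (p - q) - a p) * corr f (p - q)) * f (T p x))"
    by (simp add: sum_subtractf[symmetric] algebra_simps)
  also have "\<dots> \<le> (\<Sum>p\<in>F. \<bar>(a (p - q) - a p) * corr f (p - q)\<bar> * nrm M (\<lambda>x. f (T p x)))"
    by (intro nrm_sum L2_real_T f)
  also have "\<dots> \<le> (\<Sum>p\<in>F. \<bar>a (p - q) - a p\<bar> * (nrm M f)^3)"
  proof (intro sum_mono)
    fix p
    have "\<bar>(a (p - q) - a p) * corr f (p - q)\<bar> * nrm M (\<lambda>x. f (T p x))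
        = \<bar>a (p - q) - a p\<bar> * (\<bar>corr f (p - q)\<bar> * nrm M f)"
      by (simp add: abs_mult nrm_T[OF f])
    also have "\<dots> \<le> \<bar>a (p - q) - a p\<bar> * ((nrm M f)\<^sup>2 * nrm M f)"
      using abs_corr_le[OF f] by (intro mult_left_mono mult_right_mono) auto
    finally show "\<bar>(a (p - q) - a p) * corr f (p - q)\<bar> * nrm M (\<lambda>x. f (T p x))
        \<le> \<bar>a (p - q) - a p\<bar> * (nrm M f)^3"
      by (simp add: power2_eq_square power3_eq_cube mult.assoc)
  qed
  also have "\<dots> = (\<Sum>p\<in>F. \<bar>a (p - q) - a p\<bar>) * (nrm M f)^3"
    by (simp add: sum_distrib_right)
  also have "\<dots> \<le> (L * \<bar>offset \<beta> q\<bar> + 1 / real (Suc n)) * (nrm M f)^3"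
    by (intro mult_right_mono weightsD(4)[OF a F q]) auto
  finally show ?thesis .
qed

lemma nrm_avg_op:
  assumes f: "f \<in> L2_real M" and a: "a \<in> weights \<beta> L C c \<phi> n"
  shows "(nrm M (avg_op f a h))\<^sup>2
    \<le> (nrm M f)\<^sup>2 * C * (\<Sum>p | a p \<noteq> 0. a p * (ip M h (\<lambda>x. f (T p x)))\<^sup>2)"
  using weightsD(1,3)[OF a] weightsD(2)[OF a] f by (intro nrm_rank_sum) (simp_all add: L2_real_T nrm_T)

text \<open>\<open>A f\<close> is linear in the weights, so the images of the weight sets inherit
  the midpoint property and decrease with \<open>n\<close>; the mass clause bounds their norms. The
  selection of nearly minimal norms then applies.\<close>

lemma weights_limit:
  assumes f: "f \<in> L2_real M" and ne: "\<And>n. weights \<beta> L C c (corr f) n \<noteq> {}"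
  obtains a g where "\<And>n. a n \<in> weights \<beta> L C c (corr f) n" "g \<in> L2_real M"
    "(\<lambda>n. nrm M (\<lambda>x. avg_op f (a n) f x - g x)) \<longlonglongrightarrow> 0"
proof -
  define W where "W n = weights \<beta> L C c (corr f) n" for n
  define G where "G n = (\<lambda>a. avg_op f a f) ` W n" for n
  obtain a0 where "a0 \<in> weights \<beta> L C c (corr f) 0" using ne by blast
  from weightsD(3)[OF this, of "{}"] have C: "0 \<le> C" by simp
  have mid: "(\<lambda>x. (1/2) * (u x + v x)) \<in> G n" if "u \<in> G n" "v \<in> G n" for u v n
  proof -
    obtain a b where ab: "a \<in> W n" "b \<in> W n" "u = avg_op f a f" "v = avg_op f b f"
      using \<open>u \<in> G n\<close> \<open>v \<in> G n\<close> by (auto simp: G_def)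
    let ?F = "{p. a p \<noteq> 0} \<union> {p. b p \<noteq> 0}" and ?m = "\<lambda>p. (1/2) * (a p + b p)"
    have F: "finite ?F" using ab(1,2) weightsD(2) unfolding W_def by blast
    have "avg_op f a f = rank_sum M ?F a (\<lambda>p x. f (T p x)) f"
      by (rule avg_op_superset[OF F]) blast
    moreover have "avg_op f b f = rank_sum M ?F b (\<lambda>p x. f (T p x)) f"
      by (rule avg_op_superset[OF F]) blast
    moreover have "avg_op f ?m f = rank_sum M ?F ?m (\<lambda>p x. f (T p x)) f"
      by (rule avg_op_superset[OF F]) auto
    moreover have "(1/2) * (rank_sum M ?F a (\<lambda>p x. f (T p x)) f x + rank_sum M ?F b (\<lambda>p x. f (T p x)) f x)
        = rank_sum M ?F ?m (\<lambda>p x. f (T p x)) f x" for x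
      unfolding rank_sum_def sum.distrib[symmetric] sum_distrib_left
      by (rule sum.cong[OF refl]) (simp add: algebra_simps)
    ultimately have "(\<lambda>x. (1/2) * (u x + v x)) = avg_op f ?m f"
      unfolding ab(3,4) by presburger
    moreover have "?m \<in> W n" using ab unfolding W_def by (intro weights_midpoint)
    ultimately show ?thesis unfolding G_def by (rule image_eqI)
  qed
  have bdd: "nrm M u \<le> nrm M f * C * (nrm M f)\<^sup>2" if "u \<in> G n" for u n
  proof -
    obtain a where a: "a \<in> W n" "u = avg_op f a f" using \<open>u \<in> G n\<close> by (auto simp: G_def)
    have "(nrm M u)\<^sup>2 \<le> (nrm M f)\<^sup>2 * C * (\<Sum>p | a p \<noteq> 0. a p * (corr f p)\<^sup>2)"
      using nrm_avg_op[OF f a(1)[unfolded W_def], of f] by (simp add: a corr_def)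
    also have "\<dots> \<le> (nrm M f)\<^sup>2 * C * (C * ((nrm M f)\<^sup>2)\<^sup>2)"
    proof (intro mult_left_mono)
      have "(\<Sum>p | a p \<noteq> 0. a p * (corr f p)\<^sup>2) \<le> (\<Sum>p | a p \<noteq> 0. a p * ((nrm M f)\<^sup>2)\<^sup>2)"
      proof (intro sum_mono mult_left_mono)
        fix p show "(corr f p)\<^sup>2 \<le> ((nrm M f)\<^sup>2)\<^sup>2"
          using power_mono[OF abs_corr_le[OF f, of p] abs_ge_zero, of 2] by simp
        show "0 \<le> a p" using a(1) unfolding W_def by (rule weightsD(1))
      qed
      also have "\<dots> = (\<Sum>p | a p \<noteq> 0. a p) * ((nrm M f)\<^sup>2)\<^sup>2" by (simp only: sum_distrib_right)
      also have "\<dots> \<le> C * ((nrm M f)\<^sup>2)\<^sup>2"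
        using weightsD(2,3)[OF a(1)[unfolded W_def]] by (intro mult_right_mono) simp_all
      finally show "(\<Sum>p | a p \<noteq> 0. a p * (corr f p)\<^sup>2) \<le> C * ((nrm M f)\<^sup>2)\<^sup>2" .
    qed (use C in simp)
    also have "\<dots> = (nrm M f * C * (nrm M f)\<^sup>2)\<^sup>2" by (simp only: power2_eq_square mult_ac)
    finally have "(nrm M u)\<^sup>2 \<le> (nrm M f * C * (nrm M f)\<^sup>2)\<^sup>2" .
    then show ?thesis by (rule power2_le_imp_le) (use C in simp)
  qed
  obtain u where u: "\<And>n. u n \<in> G n"
    "\<And>e. e > 0 \<Longrightarrow> \<exists>N. \<forall>m\<ge>N. \<forall>n\<ge>N. nrm M (\<lambda>x. u m x - u n x) < e"
  proof (rule midpoint_closed_Cauchy_selection[of G M "nrm M f * C * (nrm M f)\<^sup>2"])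
    show "G n \<subseteq> L2_real M" for n using avg_op_L2[OF f] by (auto simp: G_def)
    show "G n \<noteq> {}" for n using ne by (auto simp: G_def W_def)
    show "G n \<subseteq> G m" if "m \<le> n" for m n
      unfolding G_def W_def using weights_antimono[OF that] by (rule image_mono)
    show "(\<lambda>x. (1/2) * (v x + w x)) \<in> G n" if "v \<in> G n" "w \<in> G n" for v w n
      using that by (rule mid)
    show "nrm M v \<le> nrm M f * C * (nrm M f)\<^sup>2" if "v \<in> G n" for v n
      using that by (rule bdd)
  qed (rule that)
  have "\<exists>a. a \<in> W n \<and> u n = avg_op f a f" for n using u(1)[of n] by (auto simp: G_def)
  then obtain a where a: "\<And>n. a n \<in> W n" "\<And>n. u n = avg_op f (a n) f" by metis
  obtain g where "g \<in> L2_real M" "(\<lambda>n. nrm M (\<lambda>x. u n x - g x)) \<longlonglongrightarrow> 0"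
  proof (rule L2_real_Cauchy_limit[of u])
    show "u n \<in> L2_real M" for n unfolding a(2) by (rule avg_op_L2[OF f])
    show "\<exists>N. \<forall>m\<ge>N. \<forall>n\<ge>N. nrm M (\<lambda>x. u m x - u n x) < e" if "e > 0" for e
      using that by (rule u(2))
  qed (rule that)
  then show thesis using a(1) unfolding a(2) W_def by (intro that)
qed

end

section \<open>A function with totally bounded orbit\<close>

text \<open>Greedy choice: each new point avoids the relation to all earlier ones. This turns the
  failure of every finite net into an infinite separated sequence.\<close>

lemma separated_sequence:
  assumes "\<And>K. finite K \<Longrightarrow> K \<subseteq> S \<Longrightarrow> \<exists>p\<in>S. \<forall>r\<in>K. \<not> R p r"
  obtains s :: "nat \<Rightarrow> 'b" where "\<And>i. s i \<in> S" "\<And>i j. j < i \<Longrightarrow> \<not> R (s i) (s j)"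
proof -
  have "\<exists>s :: nat \<Rightarrow> 'b. \<forall>i. s i \<in> S \<and> (\<forall>j<i. \<not> R (s i) (s j))"
  proof (rule dependent_wellorder_choice[where P = "\<lambda>s i r. r \<in> S \<and> (\<forall>j<i. \<not> R r (s j))"])
    fix i and s :: "nat \<Rightarrow> 'b"
    assume "\<And>j. j < i \<Longrightarrow> s j \<in> S \<and> (\<forall>k<j. \<not> R (s j) (s k))"
    then have "s ` {..<i} \<subseteq> S" by auto
    with assms[of "s ` {..<i}"] show "\<exists>r. r \<in> S \<and> (\<forall>j<i. \<not> R r (s j))" by auto
  qed simp
  then show thesis using that by blast
qed

context Z2_system
begin

text \<open>The error splits into the translate of \<open>g - A f\<close>, whose norm does not
  depend on \<open>q\<close>, and the commutator of \<open>A\<close> with the translation. The set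
  \<open>S\<close> is finite because weights of level \<open>n\<close> only control first
  coordinates up to \<open>n\<close>.\<close>

lemma weights_limit_near:
  assumes f: "f \<in> L2_real M" and L: "0 \<le> L"
    and a: "\<And>n. a n \<in> weights \<beta> L C c (corr f) n"
    and g: "g \<in> L2_real M" "(\<lambda>n. nrm M (\<lambda>x. avg_op f (a n) f x - g x)) \<longlonglongrightarrow> 0"
    and S: "finite S" and e: "e > 0"
  obtains n where
    "\<And>q. q \<in> S \<Longrightarrow> nrm M (\<lambda>x. g (T q x) - avg_op f (a n) (\<lambda>y. f (T q y)) x)
       \<le> L * \<bar>offset \<beta> q\<bar> * (nrm M f)^3 + e"
proof -
  have "(\<lambda>n. 1 / real (Suc n) * (nrm M f)^3) \<longlonglongrightarrow> 0 * (nrm M f)^3"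
    by (rule tendsto_mult[OF LIMSEQ_Suc[OF lim_1_over_n] tendsto_const])
  from tendsto_add[OF this g(2)]
  have lim: "(\<lambda>n. 1 / real (Suc n) * (nrm M f)^3 + nrm M (\<lambda>x. avg_op f (a n) f x - g x)) \<longlonglongrightarrow> 0"
    by simp
  have "\<forall>\<^sub>F n in sequentially. 1 / real (Suc n) * (nrm M f)^3 + nrm M (\<lambda>x. avg_op f (a n) f x - g x) < e"
    using order_tendstoD(2)[OF lim e] .
  moreover have "\<forall>\<^sub>F n in sequentially. \<forall>q\<in>S. \<bar>fst q\<bar> \<le> int n"
  proof -
    have "\<bar>fst q\<bar> \<le> int n" if "q \<in> S" "n \<ge> Max ((\<lambda>q. nat \<bar>fst q\<bar>) ` S)" for n q
    proof -
      have "nat \<bar>fst q\<bar> \<le> Max ((\<lambda>q. nat \<bar>fst q\<bar>) ` S)" using that(1) S by (intro Max_ge finite_imageI imageI)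
      then show ?thesis using that(2) by linarith
    qed
    then show ?thesis unfolding eventually_sequentially by (intro exI allI impI ballI)
  qed
  ultimately have "\<forall>\<^sub>F n in sequentially. (1 / real (Suc n) * (nrm M f)^3
      + nrm M (\<lambda>x. avg_op f (a n) f x - g x) < e) \<and> (\<forall>q\<in>S. \<bar>fst q\<bar> \<le> int n)"
    by (rule eventually_conj)
  then obtain n where n: "1 / real (Suc n) * (nrm M f)^3 + nrm M (\<lambda>x. avg_op f (a n) f x - g x) < e"
    "\<forall>q\<in>S. \<bar>fst q\<bar> \<le> int n"
    by (auto dest: eventually_happens)
  show thesis
  proof (rule that[of n])
    fix q assume q: "q \<in> S"
    have "nrm M (\<lambda>x. g (T q x) - avg_op f (a n) (\<lambda>y. f (T q y)) x)
        \<le> nrm M (\<lambda>x. g (T q x) - avg_op f (a n) f (T q x))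
          + nrm M (\<lambda>x. avg_op f (a n) f (T q x) - avg_op f (a n) (\<lambda>y. f (T q y)) x)"
      by (intro nrm_diff_triangle L2_real_T avg_op_L2 f g(1))
    also have "nrm M (\<lambda>x. g (T q x) - avg_op f (a n) f (T q x)) = nrm M (\<lambda>x. g x - avg_op f (a n) f x)"
      by (rule nrm_T[OF L2_real_diff[OF g(1) avg_op_L2[OF f]]])
    also have "nrm M (\<lambda>x. g x - avg_op f (a n) f x) = nrm M (\<lambda>x. avg_op f (a n) f x - g x)"
      by (rule nrm_diff_commute)
    also have "nrm M (\<lambda>x. avg_op f (a n) f x - g x)
          + nrm M (\<lambda>x. avg_op f (a n) f (T q x) - avg_op f (a n) (\<lambda>y. f (T q y)) x)
        \<le> nrm M (\<lambda>x. avg_op f (a n) f x - g x)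
          + (L * \<bar>offset \<beta> q\<bar> + 1 / real (Suc n)) * (nrm M f)^3"
      using avg_op_almost_commutes[OF f a n(2)[rule_format, OF q]] by (rule add_left_mono)
    also have "\<dots> \<le> L * \<bar>offset \<beta> q\<bar> * (nrm M f)^3 + e"
      using n(1) unfolding distrib_right by linarith
    finally show "nrm M (\<lambda>x. g (T q x) - avg_op f (a n) (\<lambda>y. f (T q y)) x)
       \<le> L * \<bar>offset \<beta> q\<bar> * (nrm M f)^3 + e" .
  qed
qed

text \<open>If all pairs were separated, \<open>A\<close> would map each of \<open>m\<close> almost
  orthogonal differences to a vector of norm at least \<open>e / 2\<close>, while the squares of
  these norms sum to at most \<open>K\<close>. Since \<open>K\<close> involves neither
  \<open>m\<close> nor the operator, \<open>m\<close> is fixed before the points are selected, and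
  the operator is chosen last, for the finitely many translations involved.\<close>

lemma weights_limit_not_separated:
  assumes f: "f \<in> L2_real M" and L: "0 \<le> L"
    and a: "\<And>n. a n \<in> weights \<beta> L C c (corr f) n"
    and g: "g \<in> L2_real M" "(\<lambda>n. nrm M (\<lambda>x. avg_op f (a n) f x - g x)) \<longlonglongrightarrow> 0"
    and e: "e > 0" and \<delta>: "8 * (L * \<delta> * (nrm M f)^3) \<le> e" and s: "\<And>i. s i \<in> strip \<beta> \<delta>"
  obtains i j :: nat where "j \<noteq> i" "nrm M (\<lambda>x. g (T (s i) x) - g (T (s j) x)) < e"
proof (rule ccontr)
  assume "\<not> thesis"
  then have sep: "e \<le> nrm M (\<lambda>x. g (T (s i) x) - g (T (s j) x))" if "j \<noteq> i" for i j
    using that \<open>\<And>i j. j \<noteq> i \<Longrightarrow> nrm M (\<lambda>x. g (T (s i) x) - g (T (s j) x)) < e \<Longrightarrow> thesis\<close>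
    by (meson not_le)
  define R where "R = nrm M f"
  define h where "h i = (\<lambda>x. f (T (s i) x))" for i
  have h: "h i \<in> L2_real M" "nrm M (h i) = R" for i
    using f by (simp_all add: h_def R_def L2_real_T nrm_T)
  have C: "0 \<le> C" using weightsD(3)[OF a, of "{}" 0] by simp
  \<comment> \<open>The factors come from the estimates at the end: \<open>R\<^sup>2 * C\<close>
    from the norm of \<open>A\<close>, \<open>C\<close> from the mass,
    \<open>4 * R\<^sup>2 + 1\<close> from Bessel and \<open>R\<^sup>2\<close> from the translates of
    \<open>f\<close>.\<close>
  define K where "K = R\<^sup>2 * C * (C * ((4 * R\<^sup>2 + 1) * R\<^sup>2))"
  obtain m :: nat where m: "K / (e\<^sup>2 / 4) < real m" using reals_Archimedean2 by blast
  have K: "0 \<le> K" using C by (simp add: K_def)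
  have "0 < e\<^sup>2 / 4" using e by simp
  then have m0: "0 < m" "K < real m * (e\<^sup>2 / 4)"
    using m K by (auto simp: divide_less_eq intro: gr0I)
  have hh: "\<bar>ip M (h i) (h j)\<bar> \<le> R * R" for i j
    using ip_Cauchy_Schwarz[OF h(1) h(1), of i j] by (simp add: h(2))
  \<comment> \<open>Tolerance \<open>1 / m\<close> for \<open>m\<close> vectors contributes exactly
    1 to the Bessel constant.\<close>
  obtain u :: "nat \<Rightarrow> nat" where u: "inj u"
    "\<And>i j. i \<noteq> j \<Longrightarrow> \<bar>ip M (\<lambda>x. h (u (2 * i)) x - h (u (2 * i + 1)) x)
                          (\<lambda>x. h (u (2 * j)) x - h (u (2 * j + 1)) x)\<bar> \<le> 1 / real m"
  proof (rule almost_orthogonal_differences[of h M "R * R" "1 / real m"])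
    show "0 < 1 / real m" using m0(1) by simp
  qed (rule h(1), rule hh, rule that)
  define d where "d i = (\<lambda>x. h (u (2 * i)) x - h (u (2 * i + 1)) x)" for i
  have d: "d i \<in> L2_real M" for i unfolding d_def by (intro L2_real_diff h)
  have dD: "ip M (d i) (d i) \<le> 4 * R\<^sup>2" for i
  proof -
    have "nrm M (d i) \<le> nrm M (h (u (2 * i))) + nrm M (\<lambda>x. -1 * h (u (2 * i + 1)) x)"
      using nrm_add[OF h(1) L2_real_scale[OF h(1)], of "u (2 * i)" "-1" "u (2 * i + 1)"] by (simp add: d_def)
    then have "nrm M (d i) \<le> 2 * R" unfolding nrm_scale h(2) by simp
    then have "(nrm M (d i))\<^sup>2 \<le> (2 * R)\<^sup>2" by (intro power_mono) auto
    then show ?thesis by (simp add: nrm_power2 power_mult_distrib)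
  qed
  define S where "S = s ` u ` {..<2 * m}"
  have "finite S" by (simp add: S_def)
  from weights_limit_near[OF f L a g this, of "e / 8"] e obtain n where n:
    "\<And>q. q \<in> S \<Longrightarrow> nrm M (\<lambda>x. g (T q x) - avg_op f (a n) (\<lambda>y. f (T q y)) x)
       \<le> L * \<bar>offset \<beta> q\<bar> * (nrm M f)^3 + e / 8" by auto
  \<comment> \<open>The part proportional to the offset is at most \<open>e / 8\<close> by the
    hypothesis on \<open>\<delta>\<close>, the rest by the choice of \<open>n\<close>.\<close>
  have near: "nrm M (\<lambda>x. g (T (s (u i)) x) - avg_op f (a n) (h (u i)) x) \<le> e / 4" if "i < 2 * m" for i
  proof -
    have "L * \<bar>offset \<beta> (s (u i))\<bar> * (nrm M f)^3 \<le> L * \<delta> * (nrm M f)^3"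
      using s[of "u i"] L by (intro mult_right_mono mult_left_mono) (auto simp: mem_strip_iff)
    then show ?thesis using n[of "s (u i)"] that \<delta> unfolding h_def by (auto simp: S_def)
  qed
  \<comment> \<open>Replacing the two orbit points of \<open>g\<close> by operator values costs
    \<open>e / 4\<close> each and leaves half of the separation.\<close>
  have big: "e / 2 \<le> nrm M (avg_op f (a n) (d i))" if "i < m" for i
  proof -
    let ?p = "u (2 * i)" and ?q = "u (2 * i + 1)"
    have AL: "avg_op f (a n) v \<in> L2_real M" for v by (rule avg_op_L2[OF f])
    have gL: "(\<lambda>x. g (T v x)) \<in> L2_real M" for v by (rule L2_real_T[OF g(1)])
    have "?q \<noteq> ?p" using u(1) by (simp add: inj_eq)
    then have "e \<le> nrm M (\<lambda>x. g (T (s ?p) x) - g (T (s ?q) x))" by (rule sep)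
    also have "\<dots> \<le> nrm M (\<lambda>x. g (T (s ?p) x) - avg_op f (a n) (h ?p) x)
        + nrm M (\<lambda>x. avg_op f (a n) (h ?p) x - g (T (s ?q) x))"
      by (rule nrm_diff_triangle[OF gL AL gL])
    also have "nrm M (\<lambda>x. avg_op f (a n) (h ?p) x - g (T (s ?q) x))
        \<le> nrm M (\<lambda>x. avg_op f (a n) (h ?p) x - avg_op f (a n) (h ?q) x)
        + nrm M (\<lambda>x. avg_op f (a n) (h ?q) x - g (T (s ?q) x))"
      by (rule nrm_diff_triangle[OF AL AL gL])
    also have "(\<lambda>x. avg_op f (a n) (h ?p) x - avg_op f (a n) (h ?q) x) = avg_op f (a n) (d i)"
      unfolding d_def by (rule rank_sum_diff[symmetric]) (intro L2_real_T f h)+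
    also have "nrm M (\<lambda>x. avg_op f (a n) (h ?q) x - g (T (s ?q) x))
        = nrm M (\<lambda>x. g (T (s ?q) x) - avg_op f (a n) (h ?q) x)"
      by (rule nrm_diff_commute)
    finally show ?thesis using near[of "2 * i"] near[of "2 * i + 1"] that by simp
  qed
  let ?P = "{p. a n p \<noteq> 0}" and ?u = "\<lambda>p x. f (T p x)"
  have "real m * (e\<^sup>2 / 4) = (\<Sum>i<m. (e / 2)\<^sup>2)" by (simp add: power_divide)
  also have "\<dots> \<le> (\<Sum>i<m. (nrm M (avg_op f (a n) (d i)))\<^sup>2)"
    using big e by (intro sum_mono power_mono) auto
  also have "\<dots> \<le> (\<Sum>i<m. R\<^sup>2 * C * (\<Sum>p\<in>?P. a n p * (ip M (d i) (?u p))\<^sup>2))"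
    unfolding R_def by (intro sum_mono nrm_avg_op[OF f a])
  also have "\<dots> = R\<^sup>2 * C * (\<Sum>i<m. \<Sum>p\<in>?P. a n p * (ip M (d i) (?u p))\<^sup>2)"
    by (simp only: sum_distrib_left)
  \<comment> \<open>After the exchange, Bessel is applied for each \<open>p\<close> to the single
    vector \<open>f (T p x)\<close>.\<close>
  also have "(\<Sum>i<m. \<Sum>p\<in>?P. a n p * (ip M (d i) (?u p))\<^sup>2) = (\<Sum>p\<in>?P. \<Sum>i<m. a n p * (ip M (d i) (?u p))\<^sup>2)"
    by (rule sum.swap)
  also have "\<dots> = (\<Sum>p\<in>?P. a n p * (\<Sum>i<m. (ip M (d i) (?u p))\<^sup>2))"
    by (simp only: sum_distrib_left)
  also have "R\<^sup>2 * C * \<dots> \<le> R\<^sup>2 * C * (\<Sum>p\<in>?P. a n p * ((4 * R\<^sup>2 + 1) * R\<^sup>2))"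
  proof (intro mult_left_mono sum_mono)
    fix p
    show "0 \<le> a n p" by (rule weightsD(1)[OF a])
    have "(\<Sum>i<m. (ip M (d i) (?u p))\<^sup>2) \<le> (4 * R\<^sup>2 + 1 / real m * card {..<m}) * (nrm M (?u p))\<^sup>2"
    proof (rule almost_orthogonal_Bessel)
      show "\<bar>ip M (d i) (d j)\<bar> \<le> 1 / real m" if "i \<noteq> j" for i j
        unfolding d_def using that by (rule u(2))
    qed (use d dD f L2_real_T in auto)
    then show "(\<Sum>i<m. (ip M (d i) (?u p))\<^sup>2) \<le> (4 * R\<^sup>2 + 1) * R\<^sup>2"
      using m0(1) by (simp add: nrm_T[OF f] R_def)
  qed (use C in simp)
  also have "\<dots> = R\<^sup>2 * C * (sum (a n) ?P * ((4 * R\<^sup>2 + 1) * R\<^sup>2))"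
    by (simp only: sum_distrib_right)
  also have "\<dots> \<le> K"
    unfolding K_def using C
    by (intro mult_left_mono mult_right_mono weightsD(3)[OF a weightsD(2)[OF a]]) auto
  finally show False using m0(2) by simp
qed

definition strip_precompact :: "real \<Rightarrow> real \<Rightarrow> ('a \<Rightarrow> real) \<Rightarrow> bool" where
  "strip_precompact \<beta> b g \<longleftrightarrow> (\<forall>e>0. \<exists>K. finite K \<and> K \<subseteq> strip \<beta> b \<and>
     (\<forall>p\<in>strip \<beta> b. \<exists>r\<in>K. nrm M (\<lambda>x. g (T p x) - g (T r x)) < e))"

text \<open>Without a finite net there is an infinite separated sequence. Infinitely many of its
  terms lie in one of the finitely many thin translates that cover the strip; moving them back is an
  isometry and keeps them separated, against the thin case.\<close>

lemma weights_limit_precompact: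
  assumes f: "f \<in> L2_real M" and L: "0 \<le> L"
    and a: "\<And>n. a n \<in> weights \<beta> L C c (corr f) n"
    and g: "g \<in> L2_real M" "(\<lambda>n. nrm M (\<lambda>x. avg_op f (a n) f x - g x)) \<longlonglongrightarrow> 0"
  shows "strip_precompact \<beta> b g"
  unfolding strip_precompact_def
proof (intro allI impI, rule ccontr)
  fix e :: real
  assume e: "e > 0"
    and nex: "\<nexists>K. finite K \<and> K \<subseteq> strip \<beta> b \<and>
      (\<forall>p\<in>strip \<beta> b. \<exists>r\<in>K. nrm M (\<lambda>x. g (T p x) - g (T r x)) < e)"
  have ex: "\<exists>p\<in>strip \<beta> b. \<forall>r\<in>K. \<not> nrm M (\<lambda>x. g (T p x) - g (T r x)) < e"
    if "finite K" "K \<subseteq> strip \<beta> b" for K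
  proof (rule ccontr)
    assume "\<not> ?thesis"
    then have "\<forall>p\<in>strip \<beta> b. \<exists>r\<in>K. nrm M (\<lambda>x. g (T p x) - g (T r x)) < e" by blast
    with that have "finite K \<and> K \<subseteq> strip \<beta> b \<and>
      (\<forall>p\<in>strip \<beta> b. \<exists>r\<in>K. nrm M (\<lambda>x. g (T p x) - g (T r x)) < e)" by (intro conjI)
    with nex show False by (rule notE[OF _ exI])
  qed
  obtain s :: "nat \<Rightarrow> int \<times> int" where s: "\<And>i. s i \<in> strip \<beta> b"
    "\<And>i j. j < i \<Longrightarrow> \<not> nrm M (\<lambda>x. g (T (s i) x) - g (T (s j) x)) < e"
    by (rule separated_sequence[of "strip \<beta> b" "\<lambda>p r. nrm M (\<lambda>x. g (T p x) - g (T r x)) < e"])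
       (rule ex, assumption+, rule that)
  have sep: "\<not> nrm M (\<lambda>x. g (T (s i) x) - g (T (s j) x)) < e" if "j \<noteq> i" for i j
    using s(2)[of i j] s(2)[of j i] that nrm_diff_commute[of M "\<lambda>x. g (T (s i) x)" "\<lambda>x. g (T (s j) x)"]
    by (cases "i < j") auto
  define D where "D = L * (nrm M f)^3"
  have D: "0 \<le> D" using L by (simp add: D_def)
  \<comment> \<open>\<open>D + 1\<close> instead of \<open>D\<close> also covers
    \<open>D = 0\<close>.\<close>
  define \<delta> where "\<delta> = e / (8 * (D + 1))"
  have \<delta>0: "\<delta> > 0" using e D by (simp add: \<delta>_def)
  have "8 * (D * \<delta>) \<le> 8 * ((D + 1) * \<delta>)" using \<delta>0 by simp
  also have "\<dots> = e" using D by (simp add: \<delta>_def field_simps)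
  finally have \<delta>: "\<delta> > 0" "8 * (L * \<delta> * (nrm M f)^3) \<le> e"
    using \<delta>0 by (simp_all add: D_def mult_ac)
  obtain F where F: "finite F" "\<And>p. p \<in> strip \<beta> b \<Longrightarrow> \<exists>r\<in>F. p - r \<in> strip \<beta> \<delta>"
    by (rule strip_finite_cover[OF \<delta>(1), of \<beta> b]) (rule that)
  have "\<forall>i. \<exists>r. r \<in> F \<and> s i - r \<in> strip \<beta> \<delta>" using F(2) s(1) by blast
  then obtain r where r: "\<And>i. r i \<in> F" "\<And>i. s i - r i \<in> strip \<beta> \<delta>" by metis
  have "finite (range r)" using F(1) r(1) by (auto intro: finite_subset)
  then obtain i0 where "infinite {i. r i = r i0}"
    using pigeonhole_infinite[of "UNIV :: nat set" r] by auto
  then obtain v :: "nat \<Rightarrow> nat" where v: "inj v" "range v \<subseteq> {i. r i = r i0}"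
    using infinite_countable_subset by blast
  have st: "s (v i) - r i0 \<in> strip \<beta> \<delta>" for i
  proof -
    have "r (v i) = r i0" using v(2) by blast
    then show ?thesis using r(2)[of "v i"] by simp
  qed
  obtain i j where ij: "j \<noteq> i"
    "nrm M (\<lambda>x. g (T (s (v i) - r i0) x) - g (T (s (v j) - r i0) x)) < e"
    by (rule weights_limit_not_separated[OF f L a g e \<delta>(2), of "\<lambda>i. s (v i) - r i0", OF st]) (rule that)
  have "nrm M (\<lambda>x. g (T (s (v i) - r i0) x) - g (T (s (v j) - r i0) x))
      = nrm M (\<lambda>x. g (T (s (v i) - r i0) (T (r i0) x)) - g (T (s (v j) - r i0) (T (r i0) x)))"
    using nrm_T[of "\<lambda>x. g (T (s (v i) - r i0) x) - g (T (s (v j) - r i0) x)" "r i0"]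
    by (simp add: L2_real_diff L2_real_T g(1))
  also have "\<dots> = nrm M (\<lambda>x. g (T (s (v i)) x) - g (T (s (v j)) x))" by (simp add: T_T)
  finally have "nrm M (\<lambda>x. g (T (s (v i)) x) - g (T (s (v j)) x)) < e" using ij(2) by simp
  moreover have "v j \<noteq> v i" using ij(1) v(1) by (simp add: inj_eq)
  ultimately show False using sep by blast
qed

text \<open>Inner products pass to the limit. Pairing with \<open>f\<close> turns the fifth clause
  of the weights into \<open>c \<le> ip M g f\<close>, so \<open>g\<close> is not zero; pairing with
  1 gives mean zero, as every translate of \<open>f\<close> has mean zero.\<close>

lemma weights_nonempty_imp_precompact:
  assumes f: "f \<in> L2_real M" and L: "0 \<le> L" and c: "0 < c"
    and ne: "\<And>n. weights \<beta> L C c (corr f) n \<noteq> {}" and mean: "(\<integral>x. f x \<partial>M) = 0"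
  obtains g where "g \<in> L2_real M" "strip_precompact \<beta> b g" "(\<integral>x. g x \<partial>M) = 0" "0 < nrm M g"
proof -
  obtain a g where a: "\<And>n. a n \<in> weights \<beta> L C c (corr f) n" and g: "g \<in> L2_real M"
    and lim: "(\<lambda>n. nrm M (\<lambda>x. avg_op f (a n) f x - g x)) \<longlonglongrightarrow> 0"
    by (rule weights_limit[OF f ne]) (rule that)
  have ip_lim: "(\<lambda>n. ip M (avg_op f (a n) f) k) \<longlonglongrightarrow> ip M g k" if k: "k \<in> L2_real M" for k
  proof (rule LIM_zero_cancel, rule Lim_null_comparison)
    show "\<forall>\<^sub>F n in sequentially. norm (ip M (avg_op f (a n) f) k - ip M g k)
        \<le> nrm M (\<lambda>x. avg_op f (a n) f x - g x) * nrm M k"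
      using ip_Cauchy_Schwarz[OF L2_real_diff[OF avg_op_L2[OF f] g] k]
      by (simp add: ip_diff[OF avg_op_L2[OF f] g k])
    show "(\<lambda>n. nrm M (\<lambda>x. avg_op f (a n) f x - g x) * nrm M k) \<longlonglongrightarrow> 0"
      by (rule tendsto_mult_left_zero[OF lim])
  qed
  have ip_avg: "ip M (avg_op f (a n) f) k = (\<Sum>p | a n p \<noteq> 0. (a n p * corr f p) * ip M (\<lambda>x. f (T p x)) k)"
    if "k \<in> L2_real M" for n k
    unfolding rank_sum_def corr_def using f L2_real_T that by (intro ip_sum) auto
  have "ip M (\<lambda>x. f (T p x)) f = corr f p" for p unfolding corr_def by (rule ip_commute)
  then have "c \<le> ip M (avg_op f (a n) f) f" for n
    using weightsD(5)[OF a, of n] by (simp add: ip_avg[OF f] power2_eq_square mult.assoc)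
  with ip_lim[OF f] have "c \<le> ip M g f" by (intro LIMSEQ_le_const) auto
  then have "0 < nrm M g * nrm M f" using ip_Cauchy_Schwarz[OF g f] c by linarith
  then have pos: "0 < nrm M g" using nrm_nonneg[of M g] by (metis mult_zero_left less_irrefl order_le_less)
  have one: "(\<lambda>x. 1) \<in> L2_real M" by (rule L2_real_const)
  have "ip M (\<lambda>x. f (T p x)) (\<lambda>x. 1) = 0" for p
    using ip_T[OF f one, of p] mean by (simp add: ip_def)
  then have "ip M (avg_op f (a n) f) (\<lambda>x. 1) = 0" for n by (simp add: ip_avg[OF one])
  with ip_lim[OF one] have "ip M g (\<lambda>x. 1) = 0" by (simp add: LIMSEQ_const_iff)
  then have "(\<integral>x. g x \<partial>M) = 0" by (simp add: ip_def)
  with g pos weights_limit_precompact[OF f L a g lim] show thesis by (intro that)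
qed

section \<open>Level sets in the Kronecker algebra\<close>

lemma indicator_L2_real:
  assumes "B \<in> sets M"
  shows "(indicator B :: 'a \<Rightarrow> real) \<in> L2_real M"
proof -
  have "(\<lambda>x. Re (indicator B x)) = (indicator B :: 'a \<Rightarrow> real)" by (auto simp: indicator_def)
  then show ?thesis using L2_fun_Re_Im(1)[OF indicator_L2_fun[OF assms]] by simp
qed

text \<open>If \<open>T p x\<close> and \<open>T r x\<close> lie on different sides of the level,
  then the values of \<open>g\<close> differ by at least \<open>\<eta>\<close> or
  \<open>g (T p x)\<close> is within \<open>\<eta>\<close> of \<open>t\<close>. A Chebyshev bound
  controls the first event, invariance of the measure and the null level set the second.\<close>

lemma strip_precompact_level_set:
  assumes g: "g \<in> L2_real M" and pc: "strip_precompact \<beta> b g"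
    and t: "measure M {x. g x = t} = 0"
  shows "strip_precompact \<beta> b (indicator {x. t < g x})"
  unfolding strip_precompact_def
proof (intro allI impI)
  fix e :: real assume e: "e > 0"
  have gm [measurable]: "g \<in> borel_measurable M" by (rule L2_real_measurable[OF g])
  \<comment> \<open>These closed bands shrink to the null set where \<open>g\<close> equals
    \<open>t\<close>, so some band has small measure; its half-width becomes
    \<open>\<eta>\<close>.\<close>
  define A where "A n = {x \<in> space M. \<bar>g x - t\<bar> \<le> 1 / real (Suc n)}" for n
  have A_sets [measurable]: "A n \<in> sets M" for n unfolding A_def by measurable
  have "decseq A"
  proof (rule decseq_SucI)
    fix n
    have "1 / real (Suc (Suc n)) \<le> 1 / real (Suc n)" by (intro frac_le) auto
    then show "A (Suc n) \<subseteq> A n" unfolding A_def by fastforce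
  qed
  moreover have "(\<Inter>n. A n) = {x. g x = t}"
  proof (intro set_eqI iffI)
    fix x assume "x \<in> (\<Inter>n. A n)"
    then have "\<bar>g x - t\<bar> \<le> 1 / real (Suc n)" for n by (auto simp: A_def)
    then have "\<bar>g x - t\<bar> \<le> 0" by (intro LIMSEQ_le_const[OF LIMSEQ_Suc[OF lim_1_over_n]]) auto
    then show "x \<in> {x. g x = t}" by simp
  qed (auto simp: A_def)
  ultimately have "(\<lambda>n. measure M (A n)) \<longlonglongrightarrow> 0"
    using finite_Lim_measure_decseq[of A] t A_sets by (simp add: image_subset_iff)
  then have "\<forall>\<^sub>F n in sequentially. measure M (A n) < e\<^sup>2 / 2"
    using e by (intro order_tendstoD) auto
  then obtain n where n: "measure M (A n) < e\<^sup>2 / 2" by (auto dest: eventually_happens)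
  define \<eta> where "\<eta> = 1 / real (Suc n)"
  have \<eta>: "\<eta> > 0" by (simp add: \<eta>_def)
  define B where "B = {x. t < g x}"
  have B: "B \<in> sets M"
  proof -
    have "{x \<in> space M. t < g x} \<in> sets M" by measurable
    then show ?thesis by (simp add: B_def)
  qed
  have iB: "(indicator B :: 'a \<Rightarrow> real) \<in> L2_real M" by (rule indicator_L2_real[OF B])
  have close: "nrm M (\<lambda>x. indicator B (T p x) - indicator B (T r x)) < e"
    if pr: "nrm M (\<lambda>x. g (T p x) - g (T r x)) < \<eta> * e / 2" for p r
  proof -
    define D where "D = (\<lambda>x. g (T p x) - g (T r x))"
    have D: "D \<in> L2_real M" unfolding D_def by (intro L2_real_diff L2_real_T g)
    have iA: "(indicator (A n) :: 'a \<Rightarrow> real) \<in> L2_real M" by (rule indicator_L2_real[OF A_sets])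
    have int2: "integrable M (\<lambda>x. (indicator (A n) (T p x) :: real))"
      using integrable_mult_L2[OF L2_real_T[OF iA, of p] L2_real_const[of 1]] by simp
    have "ip M (\<lambda>x. indicator B (T p x) - indicator B (T r x)) (\<lambda>x. indicator B (T p x) - indicator B (T r x))
        \<le> (\<integral>x. (D x)\<^sup>2 / \<eta>\<^sup>2 + indicator (A n) (T p x) \<partial>M)"
      unfolding ip_def
    proof (rule integral_mono)
      show "integrable M (\<lambda>x. (indicator B (T p x) - indicator B (T r x)) * (indicator B (T p x) - indicator B (T r x) :: real))"
        using L2_real_diff[OF L2_real_T[OF iB] L2_real_T[OF iB], of p r]
        by (intro integrable_mult_L2)
      show "integrable M (\<lambda>x. (D x)\<^sup>2 / \<eta>\<^sup>2 + indicator (A n) (T p x))"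
        using D int2 by (simp add: L2_real_def)
      fix x
      show "(indicator B (T p x) - indicator B (T r x)) * (indicator B (T p x) - indicator B (T r x))
          \<le> (D x)\<^sup>2 / \<eta>\<^sup>2 + indicator (A n) (T p x)"
      proof (cases "\<eta> \<le> \<bar>D x\<bar>")
        case True
        then have "\<eta>\<^sup>2 \<le> (D x)\<^sup>2" using \<eta> abs_le_square_iff[of \<eta> "D x"] by linarith
        then have "1 \<le> (D x)\<^sup>2 / \<eta>\<^sup>2" using \<eta> by simp
        moreover have "(0::real) \<le> indicator (A n) (T p x)" by simp
        moreover have "(indicator B (T p x) - indicator B (T r x)) * (indicator B (T p x) - indicator B (T r x)) \<le> (1::real)"
          by (auto simp: indicator_def)
        ultimately show ?thesis by linarith
      next
        case False
        show ?thesis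
        proof (cases "T p x \<in> B \<longleftrightarrow> T r x \<in> B")
          case True
          then show ?thesis by (simp add: indicator_def)
        next
          case False
          then have "\<bar>g (T p x) - t\<bar> \<le> \<eta>" using \<open>\<not> \<eta> \<le> \<bar>D x\<bar>\<close> by (auto simp: B_def D_def)
          then have "T p x \<in> A n" by (simp add: A_def \<eta>_def)
          then have "(indicator (A n) (T p x) :: real) = 1" by simp
          moreover have "0 \<le> (D x)\<^sup>2 / \<eta>\<^sup>2" by simp
          moreover have "(indicator B (T p x) - indicator B (T r x)) * (indicator B (T p x) - indicator B (T r x)) \<le> (1::real)"
            by (auto simp: indicator_def)
          ultimately show ?thesis by linarith
        qed
      qed
    qed
    also have "\<dots> = ip M D D / \<eta>\<^sup>2 + (\<integral>x. indicator (A n) (T p x) \<partial>M)"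
      using D int2 by (simp add: L2_real_def ip_def power2_eq_square)
    also have "(\<integral>x. indicator (A n) (T p x) \<partial>M) = measure M (A n)"
      using ip_T[OF iA L2_real_const[of 1], of p] by (simp add: ip_def)
    \<comment> \<open>The budget is \<open>e\<^sup>2 / 4\<close> for large differences and less than
      \<open>e\<^sup>2 / 2\<close> for the band.\<close>
    also have "ip M D D / \<eta>\<^sup>2 + measure M (A n) < e\<^sup>2"
    proof -
      have "ip M D D \<le> (\<eta> * e / 2)\<^sup>2"
        using power_mono[OF less_imp_le[OF pr] nrm_nonneg, of 2] by (simp only: nrm_power2 D_def)
      then have "ip M D D / \<eta>\<^sup>2 \<le> (\<eta> * e / 2)\<^sup>2 / \<eta>\<^sup>2" by (rule divide_right_mono) simp
      also have "\<dots> = e\<^sup>2 / 4" using \<eta> by (simp add: power_divide power_mult_distrib)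
      finally have "ip M D D / \<eta>\<^sup>2 \<le> e\<^sup>2 / 4" .
      moreover have "0 < e\<^sup>2" using e by simp
      ultimately show ?thesis using n by linarith
    qed
    finally have "nrm M (\<lambda>x. indicator B (T p x) - indicator B (T r x)) < sqrt (e\<^sup>2)"
      unfolding nrm_def by (rule real_sqrt_less_mono)
    then show ?thesis using e by simp
  qed
  have "0 < \<eta> * e / 2" using \<eta> e by simp
  from pc[unfolded strip_precompact_def, rule_format, OF this]
  obtain K where K: "finite K" "K \<subseteq> strip \<beta> b"
    and near: "\<forall>p\<in>strip \<beta> b. \<exists>r\<in>K. nrm M (\<lambda>x. g (T p x) - g (T r x)) < \<eta> * e / 2"
    by (elim exE conjE)
  have "\<exists>r\<in>K. nrm M (\<lambda>x. indicator B (T p x) - indicator B (T r x)) < e" if "p \<in> strip \<beta> b" for p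
    using near[rule_format, OF that] close by (elim bexE) (rule bexI)
  then show "\<exists>K. finite K \<and> K \<subseteq> strip \<beta> b \<and> (\<forall>p\<in>strip \<beta> b. \<exists>r\<in>K.
    nrm M (\<lambda>x. indicator {x. t < g x} (T p x) - indicator {x. t < g x} (T r x)) < e)"
    using K unfolding B_def[symmetric] by (intro exI[of _ K] conjI ballI)
qed

text \<open>A function of mean zero that is not almost everywhere zero exceeds some
  \<open>1 / Suc n\<close> with positive probability. Any \<open>t\<close> between 0 and that bound
  is exceeded neither almost never nor almost surely, the latter because a nonnegative function of
  mean zero vanishes. Only countably many levels have positive measure, so a null one can be
  chosen.\<close>

lemma nontrivial_level_set:
  assumes g: "g \<in> L2_real M" and mean: "(\<integral>x. g x \<partial>M) = 0" and pos: "0 < nrm M g"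
  obtains t where "measure M {x. g x = t} = 0" "measure M {x. t < g x} \<noteq> 0" "measure M {x. t < g x} \<noteq> 1"
proof -
  have gm [measurable]: "g \<in> borel_measurable M" by (rule L2_real_measurable[OF g])
  have gi: "integrable M g" using integrable_mult_L2[OF g L2_real_const[of 1]] by simp
  have S: "{x. t < g x} \<in> sets M" for t
  proof -
    have "{x \<in> space M. t < g x} \<in> sets M" by measurable
    then show ?thesis by simp
  qed
  have not0: "\<not> (AE x in M. g x = 0)"
  proof
    assume "AE x in M. g x = 0"
    then have "ip M g g = (\<integral>x. 0 \<partial>M)" unfolding ip_def by (intro integral_cong_AE) auto
    then show False using pos by (simp add: nrm_def)
  qed
  have "\<exists>n. measure M {x. 1 / real (Suc n) < g x} \<noteq> 0"
  proof (rule ccontr)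
    assume "\<nexists>n. measure M {x. 1 / real (Suc n) < g x} \<noteq> 0"
    then have "AE x in M. \<not> 1 / real (Suc n) < g x" for n
      using S by (subst AE_iff_measurable[where N = "{x. 1 / real (Suc n) < g x}"]) (auto simp: emeasure_eq_measure)
    then have "AE x in M. \<forall>n. \<not> 1 / real (Suc n) < g x" by (simp add: AE_all_countable)
    then have le: "AE x in M. g x \<le> 0"
    proof eventually_elim
      case (elim x)
      then show ?case by (intro LIMSEQ_le_const[OF LIMSEQ_Suc[OF lim_1_over_n]]) (auto simp: not_less)
    qed
    have "(\<integral>x. - g x \<partial>M) = 0" using mean by simp
    then have "AE x in M. - g x = 0"
      using le gi by (subst (asm) integral_nonneg_eq_0_iff_AE) auto
    then show False using not0 by simp
  qed
  then obtain n where n: "measure M {x. 1 / real (Suc n) < g x} \<noteq> 0" by blast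
  interpret D: prob_space "distr M borel g" by (rule prob_space_distr) measurable
  have "uncountable {0<..<1 / real (Suc n)}" by (rule uncountable_open_interval[THEN iffD2]) simp
  then have "\<not> {0<..<1 / real (Suc n)} \<subseteq> {t. measure (distr M borel g) {t} \<noteq> 0}"
    using D.countable_support countable_subset by blast
  then obtain t where t: "0 < t" "t < 1 / real (Suc n)" "measure (distr M borel g) {t} = 0" by auto
  show thesis
  proof (rule that[of t])
    have "g -` {t} \<inter> space M = {x. g x = t}" by auto
    then show "measure M {x. g x = t} = 0" using t(3) by (simp add: measure_distr)
    have "measure M {x. 1 / real (Suc n) < g x} \<le> measure M {x. t < g x}"
      using t(2) S by (intro finite_measure_mono) auto
    then show "measure M {x. t < g x} \<noteq> 0" using n measure_nonneg[of M "{x. 1 / real (Suc n) < g x}"] by linarith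
    show "measure M {x. t < g x} \<noteq> 1"
    proof
      assume "measure M {x. t < g x} = 1"
      then have gt: "AE x in M. t < g x" using prob_eq_1[OF S, of t] by simp
      then have "AE x in M. 0 \<le> g x" using t(1) by auto
      then have "AE x in M. g x = 0"
        using mean gi by (subst (asm) integral_nonneg_eq_0_iff_AE) auto
      with not0 show False by simp
    qed
  qed
qed

text \<open>In a complete space, compact closure means total boundedness; the centres in
  \<open>strip_precompact\<close> lie in the orbit itself, as \<open>mtotally_bounded\<close>
  demands.\<close>

lemma orbit_compact_indicator_iff:
  assumes B: "B \<in> sets M"
  shows "orbit_compact M T (strip \<beta> b) (indicator B) \<longleftrightarrow> strip_precompact \<beta> b (indicator B)"
proof -
  interpret L2: Metric_space "L2_space M" "L2_dist M" by (rule Metric_space_L2)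
  let ?o = "\<lambda>p. L2_class M (koopman T p (indicator B))"
  have inL: "koopman T p (indicator B) \<in> L2_fun M" for p by (intro koopman_L2_fun indicator_L2_fun B)
  have sub: "?o ` strip \<beta> b \<subseteq> L2_space M" using inL by auto
  have dist: "L2_dist M (?o r) (?o p) = nrm M (\<lambda>x. indicator B (T p x) - indicator B (T r x))" for p r
  proof -
    have "(\<lambda>x. koopman T p (indicator B) x - koopman T r (indicator B) x)
        = (\<lambda>x. complex_of_real (indicator B (T p x) - indicator B (T r x)))"
      by (auto simp: koopman_def indicator_def)
    then show ?thesis
      by (subst L2.commute) (simp only: L2_dist_class[OF inL inL] L2_norm_of_real)
  qed
  have "orbit_compact M T (strip \<beta> b) (indicator B) \<longleftrightarrow> L2.mtotally_bounded (?o ` strip \<beta> b)"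
    unfolding orbit_compact_def L2_topology_def
    using L2.mtotally_bounded_eq_compact_closure_of[OF mcomplete_L2] sub by simp
  also have "\<dots> \<longleftrightarrow> (\<forall>e>0. \<exists>K. finite K \<and> K \<subseteq> strip \<beta> b \<and> ?o ` strip \<beta> b \<subseteq> (\<Union>x\<in>?o ` K. L2.mball x e))"
    unfolding L2.mtotally_bounded_def ex_finite_subset_image by simp
  also have "\<dots> \<longleftrightarrow> strip_precompact \<beta> b (indicator B)"
  proof -
    have "?o ` strip \<beta> b \<subseteq> (\<Union>x\<in>?o ` K. L2.mball x e) \<longleftrightarrow>
      (\<forall>p\<in>strip \<beta> b. \<exists>r\<in>K. nrm M (\<lambda>x. indicator B (T p x) - indicator B (T r x)) < e)" for K e
      using inL by (simp add: image_subset_iff L2.mball_def dist)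
    then show ?thesis unfolding strip_precompact_def by simp
  qed
  finally show ?thesis .
qed

lemma precompact_imp_not_weakly_mixing:
  assumes b: "b > 0" and g: "g \<in> L2_real M" and pc: "strip_precompact \<beta> b g"
    and mean: "(\<integral>x. g x \<partial>M) = 0" and pos: "0 < nrm M g"
  shows "\<not> directionally_weakly_mixing M T \<beta>"
proof -
  obtain t where t: "measure M {x. g x = t} = 0" "measure M {x. t < g x} \<noteq> 0" "measure M {x. t < g x} \<noteq> 1"
    using nontrivial_level_set[OF g mean pos] by blast
  have "g \<in> borel_measurable M" by (rule L2_real_measurable[OF g])
  then have "{x \<in> space M. t < g x} \<in> sets M" by measurable
  then have B: "{x. t < g x} \<in> sets M" by simp
  have "{x. t < g x} \<in> directional_kronecker M T \<beta>"
    unfolding directional_kronecker_iff[OF b] orbit_compact_indicator_iff[OF B]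
    using B strip_precompact_level_set[OF g pc t(1)] by simp
  with t(2,3) show ?thesis unfolding directionally_weakly_mixing_def by blast
qed

end

section \<open>Counting points in a strip\<close>

lemma strip_column: "{n. (m, n) \<in> strip \<beta> c} = {\<lceil>\<beta> * of_int m - c\<rceil>..\<lfloor>\<beta> * of_int m + c\<rfloor>}"
  by (auto simp: strip_def ceiling_le_iff le_floor_iff)

lemma strip_box:
  assumes "0 \<le> c"
  shows "finite (strip \<beta> c \<inter> ({i..<j} \<times> UNIV))"
    and "real (card (strip \<beta> c \<inter> ({i..<j} \<times> UNIV))) \<le> (2 * c + 1) * real (nat (j - i))"
proof -
  have eq: "strip \<beta> c \<inter> ({i..<j} \<times> UNIV) = Sigma {i..<j} (\<lambda>m. {n. (m, n) \<in> strip \<beta> c})"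
    by auto
  show "finite (strip \<beta> c \<inter> ({i..<j} \<times> UNIV))"
    unfolding eq strip_column by (intro finite_SigmaI) auto
  have col: "real (card {n. (m, n) \<in> strip \<beta> c}) \<le> 2 * c + 1" for m
  proof -
    have "real_of_int (\<lfloor>\<beta> * of_int m + c\<rfloor> - \<lceil>\<beta> * of_int m - c\<rceil> + 1) \<le> 2 * c + 1"
      by linarith
    then show ?thesis
      unfolding strip_column using assms
      by (cases "0 \<le> \<lfloor>\<beta> * of_int m + c\<rfloor> - \<lceil>\<beta> * of_int m - c\<rceil> + 1") auto
  qed
  have "real (card (strip \<beta> c \<inter> ({i..<j} \<times> UNIV))) = (\<Sum>m\<in>{i..<j}. real (card {n. (m, n) \<in> strip \<beta> c}))"
    unfolding eq by (subst card_SigmaI) (auto simp: strip_column)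
  also have "\<dots> \<le> (\<Sum>m\<in>{i..<j}. 2 * c + 1)" by (intro sum_mono col)
  also have "\<dots> = (2 * c + 1) * real (nat (j - i))" by simp
  finally show "real (card (strip \<beta> c \<inter> ({i..<j} \<times> UNIV))) \<le> (2 * c + 1) * real (nat (j - i))" .
qed

lemma strip_upto_eq: "strip_upto \<beta> b k = strip \<beta> b \<inter> ({0..<int k} \<times> UNIV)"
  by (auto simp: strip_upto_def)

lemma strip_upto_bounds:
  assumes "0 \<le> b"
  shows "finite (strip_upto \<beta> b k)" "real (card (strip_upto \<beta> b k)) \<le> (2 * b + 1) * real k"
  using strip_box[OF assms, of \<beta> 0 "int k"] unfolding strip_upto_eq by auto

text \<open>The points on or just below the line, one in each column, are sums of an element of
  \<open>F\<close> and one of \<open>Q\<close>. For columns at distance at least \<open>R\<close>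
  from both ends of the box the summand from \<open>Q\<close> lies in the box, so pairs in
  \<open>F \<times> S k\<close> account for \<open>k - 2 * R\<close> columns.\<close>

lemma syndetic_linear_growth:
  assumes F: "finite F" "\<And>p. p \<in> strip \<beta> 1 \<Longrightarrow> \<exists>r\<in>F. p - r \<in> Q" and Q: "Q \<subseteq> strip \<beta> b" "0 \<le> b"
  obtains \<kappa> k0 where "\<kappa> > 0"
    "\<And>k. k \<ge> k0 \<Longrightarrow> \<kappa> * real k \<le> real (card (Q \<inter> ({0..int k - 1} \<times> UNIV)))"
proof -
  define R where "R = Max (insert 0 ((\<lambda>r. nat \<bar>fst r\<bar>) ` F))"
  have R: "\<bar>fst r\<bar> \<le> int R" if "r \<in> F" for r
  proof -
    have "nat \<bar>fst r\<bar> \<le> R" unfolding R_def using F(1) that by (intro Max_ge) auto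
    then show ?thesis by linarith
  qed
  define S where "S k = Q \<inter> ({0..int k - 1} \<times> UNIV)" for k
  have finS: "finite (S k)" for k
    by (rule finite_subset[OF _ strip_upto_bounds(1)[OF Q(2), of \<beta> k]]) (use Q(1) in \<open>auto simp: S_def strip_upto_def\<close>)
  have count: "k - 2 * R \<le> card F * card (S k)" for k
  proof -
    define h where "h m = (m, \<lfloor>\<beta> * of_int m\<rfloor>)" for m :: int
    have "h ` {int R..<int k - int R} \<subseteq> (\<lambda>(r, s). r + s) ` (F \<times> S k)"
    proof
      fix p assume "p \<in> h ` {int R..<int k - int R}"
      then obtain m where m: "p = h m" "int R \<le> m" "m < int k - int R" by auto
      have "p \<in> strip \<beta> 1" unfolding m(1) h_def strip_def by auto linarith+
      then obtain r where r: "r \<in> F" "p - r \<in> Q" using F(2) by blast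
      have "fst (p - r) = m - fst r" by (simp add: m(1) h_def)
      then have "p - r \<in> S k" using r(2) R[OF r(1)] m(2,3) by (cases "p - r") (auto simp: S_def)
      then have "(r, p - r) \<in> F \<times> S k" using r(1) by blast
      then show "p \<in> (\<lambda>(r, s). r + s) ` (F \<times> S k)" by (rule image_eqI[rotated]) simp
    qed
    then have "card (h ` {int R..<int k - int R}) \<le> card (F \<times> S k)"
      by (meson F(1) card_image_le card_mono finS finite_SigmaI finite_imageI le_trans)
    moreover have "card (h ` {int R..<int k - int R}) = nat (int k - int R - int R)"
      by (subst card_image) (auto simp: inj_on_def h_def)
    ultimately show ?thesis by (simp add: card_cartesian_product)
  qed
  \<comment> \<open>For \<open>4 * R \<le> k\<close> at least half of the columns remain; the added
    1 makes positivity immediate.\<close>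
  define \<kappa> where "\<kappa> = 1 / (2 * (real (card F) + 1))"
  show thesis
  proof (rule that[of \<kappa> "4 * R"])
    show "\<kappa> > 0" by (simp add: \<kappa>_def)
    fix k assume k: "4 * R \<le> k"
    have "real (k - 2 * R) \<le> real (card F) * real (card (S k))"
      using count[of k] by (metis of_nat_le_iff of_nat_mult)
    then have "real k / 2 \<le> real (card F) * real (card (S k))" using k by simp
    also have "\<dots> \<le> (real (card F) + 1) * real (card (S k))" by (intro mult_right_mono) auto
    finally show "\<kappa> * real k \<le> real (card (Q \<inter> ({0..int k - 1} \<times> UNIV)))"
      unfolding S_def[symmetric] by (simp add: \<kappa>_def field_simps)
  qed
qed

text \<open>A narrow strip may miss whole columns, so it cannot be counted from below column by
  column; covering a wider strip by its translates gives the bound instead.\<close>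

lemma strip_upto_linear_growth:
  assumes "b > 0"
  obtains \<kappa> k0 where "\<kappa> > 0" "\<And>k. k \<ge> k0 \<Longrightarrow> \<kappa> * real k \<le> real (card (strip_upto \<beta> b k))"
proof -
  obtain F where F: "finite F" "\<And>p. p \<in> strip \<beta> 1 \<Longrightarrow> \<exists>r\<in>F. p - r \<in> strip \<beta> b"
    by (rule strip_finite_cover[OF assms, of \<beta> 1]) (rule that)
  show thesis
    by (rule syndetic_linear_growth[OF F subset_refl less_imp_le[OF assms]], assumption)
       (rule that, simp_all add: strip_upto_def)
qed

text \<open>Points are coded lexicographically by natural numbers, with \<open>W\<close> exceeding
  the height of a column. Listing the codes in increasing order lists the points by columns.\<close>

lemma enumerates_exists:
  assumes Q: "Q \<subseteq> strip_pos \<beta> b" "infinite Q" and b: "0 \<le> b"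
  obtains q where "enumerates q Q"
proof -
  define W where "W = nat \<lceil>2 * b + 2\<rceil>"
  have W: "2 * b + 2 \<le> real W" unfolding W_def using b by linarith
  then have "0 < real W" using b by linarith
  then have W0: "0 < W" by simp
  define c where "c p = nat (snd p - \<lceil>\<beta> * of_int (fst p) - b\<rceil>)" for p
  define e where "e p = nat (fst p) * W + c p" for p
  have QD: "0 \<le> fst p" "\<lceil>\<beta> * of_int (fst p) - b\<rceil> \<le> snd p" "c p < W" if "p \<in> Q" for p
  proof -
    have p: "0 \<le> fst p" "\<beta> * of_int (fst p) - b \<le> of_int (snd p)" "of_int (snd p) \<le> \<beta> * of_int (fst p) + b"
      using that Q(1) by (auto simp: strip_pos_def strip_def)
    then show "0 \<le> fst p" "\<lceil>\<beta> * of_int (fst p) - b\<rceil> \<le> snd p" by (auto simp: ceiling_le_iff)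
    have "real_of_int (snd p - \<lceil>\<beta> * of_int (fst p) - b\<rceil>) < real W" using p W by linarith
    then show "c p < W" using W0 unfolding c_def by linarith
  qed
  have e_div: "e p div W = nat (fst p)" "e p mod W = c p" if "p \<in> Q" for p
    using QD(3)[OF that] by (simp_all add: e_def)
  have inj: "inj_on e Q"
  proof (rule inj_onI)
    fix p r assume pr: "p \<in> Q" "r \<in> Q" "e p = e r"
    then have "nat (fst p) = nat (fst r)" "c p = c r" using e_div by metis+
    then have f: "fst p = fst r" using QD(1)[OF pr(1)] QD(1)[OF pr(2)] by linarith
    then have "snd p = snd r" using \<open>c p = c r\<close> QD(2)[OF pr(1)] QD(2)[OF pr(2)] by (simp add: c_def)
    with f show "p = r" by (rule prod_eqI)
  qed
  then have inf: "infinite (e ` Q)" using Q(2) finite_image_iff by blast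
  define q where "q = inv_into Q e \<circ> enumerate (e ` Q)"
  have "bij_betw q UNIV Q"
    unfolding q_def using bij_enumerate[OF inf] inj_on_imp_bij_betw[OF inj]
    by (intro bij_betw_trans) (auto intro: bij_betw_inv_into)
  moreover have "mono (\<lambda>i. fst (q i))"
  proof (rule monoI)
    fix i j :: nat assume "i \<le> j"
    have qQ: "q i \<in> Q" for i unfolding q_def using enumerate_in_set[OF inf] by (auto intro: inv_into_into)
    have eq: "e (q i) = enumerate (e ` Q) i" for i
      unfolding q_def using enumerate_in_set[OF inf] by (simp add: f_inv_into_f)
    have "enumerate (e ` Q) i \<le> enumerate (e ` Q) j" using \<open>i \<le> j\<close> inf by simp
    then have "e (q i) div W \<le> e (q j) div W" unfolding eq by (rule div_le_mono)
    then have "nat (fst (q i)) \<le> nat (fst (q j))" using e_div(1)[OF qQ] by simp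
    then show "fst (q i) \<le> fst (q j)" using QD(1)[OF qQ] by (simp add: nat_le_iff)
  qed
  ultimately show thesis by (intro that) (simp add: enumerates_def)
qed

section \<open>Correlations of weakly mixing systems\<close>

text \<open>A Lipschitz cutoff bounds the change of the weights under translation at every point, so
  no count of the points near the edge of the strip is required.\<close>

definition tent :: "real \<Rightarrow> real" where
  "tent t = max 0 (1 - \<bar>t\<bar>)"

lemma tent_bounds: "0 \<le> tent t" "tent t \<le> 1" "\<bar>tent s - tent t\<bar> \<le> \<bar>s - t\<bar>"
  by (auto simp: tent_def)

lemma tent_ge_half: "2 * \<bar>t\<bar> \<le> 1 \<Longrightarrow> 1/2 \<le> tent t"
  by (simp add: tent_def)

lemma tent_eq_0_iff: "tent t = 0 \<longleftrightarrow> 1 \<le> \<bar>t\<bar>"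
  by (auto simp: tent_def max_def)

lemma tent_mult_Lipschitz:
  "\<bar>tent s * tent t - tent s' * tent t'\<bar> \<le> \<bar>s - s'\<bar> + \<bar>t - t'\<bar>"
proof -
  have "tent s * tent t - tent s' * tent t' = (tent s - tent s') * tent t + tent s' * (tent t - tent t')"
    by (simp add: algebra_simps)
  also have "\<bar>\<dots>\<bar> \<le> \<bar>tent s - tent s'\<bar> * tent t + tent s' * \<bar>tent t - tent t'\<bar>"
    using abs_triangle_ineq[of "(tent s - tent s') * tent t" "tent s' * (tent t - tent t')"]
    by (simp add: abs_mult tent_bounds(1))
  also have "\<dots> \<le> \<bar>s - s'\<bar> * 1 + 1 * \<bar>t - t'\<bar>"
    using tent_bounds by (intro add_mono mult_mono) auto
  finally show ?thesis by simp
qed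

text \<open>Both signs of the first coordinate occur because differences of points of
  \<open>strip_pos\<close> enter.\<close>

definition strip_ball :: "real \<Rightarrow> real \<Rightarrow> nat \<Rightarrow> (int \<times> int) set" where
  "strip_ball \<beta> c k = {p \<in> strip \<beta> c. \<bar>fst p\<bar> \<le> int k}"

lemma strip_ball_bounds:
  assumes "0 \<le> c"
  shows "finite (strip_ball \<beta> c k)" "real (card (strip_ball \<beta> c k)) \<le> (2 * c + 1) * (2 * real k + 1)"
proof -
  have eq: "strip_ball \<beta> c k = strip \<beta> c \<inter> ({- int k..<int k + 1} \<times> UNIV)"
    by (auto simp: strip_ball_def)
  have "nat (int k + 1 - - int k) = 2 * k + 1" by simp
  then show "finite (strip_ball \<beta> c k)" "real (card (strip_ball \<beta> c k)) \<le> (2 * c + 1) * (2 * real k + 1)"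
    using strip_box[OF assms, of \<beta> "- int k" "int k + 1"] unfolding eq by (auto simp: add.commute)
qed

text \<open>The weight is a product of two tents, across and along the strip, divided by
  \<open>k\<close>. Its support has at most \<open>5 * (4 * c + 1) * k\<close> points with values at
  most \<open>1 / k\<close>, which bounds the mass. The difference to a translate lives on at most
  twice as many points, hence the factor 10. Cauchy-Schwarz turns the hypothesis on absolute values
  into a lower bound for squares.\<close>

lemma tent_weight:
  fixes \<phi> :: "int \<times> int \<Rightarrow> real"
  assumes c: "0 < c" and e: "0 < e" and k: "1 \<le> k" "20 * (4 * c + 1) * real n * real (Suc n) \<le> real k"
    and big: "e * real k \<le> (\<Sum>p\<in>strip_ball \<beta> c k. \<bar>\<phi> p\<bar>)"
  shows "weights \<beta> (10 * (4 * c + 1) / c) (5 * (4 * c + 1)) (e\<^sup>2 / (12 * (2 * c + 1))) \<phi> n \<noteq> {}"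
proof -
  \<comment> \<open>Doubling both widths keeps each tent at least 1/2 on
    \<open>strip_ball \<beta> c k\<close>.\<close>
  define a where "a p = tent (offset \<beta> p / (2 * c)) * tent (real_of_int (fst p) / (2 * real k)) / real k" for p
  define D where "D = strip_ball \<beta> (2 * c) (2 * k)"
  have kpos: "0 < real k" using k(1) by simp
  have a0: "0 \<le> a p" for p using tent_bounds(1) by (simp add: a_def)
  have a1: "a p \<le> 1 / real k" for p
    unfolding a_def using tent_bounds by (intro divide_right_mono mult_le_one) auto
  have D: "finite D" unfolding D_def using c by (intro strip_ball_bounds) simp
  have "real (card D) \<le> (2 * (2 * c) + 1) * (2 * real (2 * k) + 1)"
    unfolding D_def using c by (intro strip_ball_bounds) simp
  also have "\<dots> \<le> (4 * c + 1) * (5 * real k)" using c k(1) by (intro mult_mono) auto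
  finally have cardD: "real (card D) \<le> 5 * (4 * c + 1) * real k" by (simp add: mult_ac)
  have supp: "a p = 0" if "p \<notin> D" for p
  proof -
    have "2 * c < \<bar>offset \<beta> p\<bar> \<or> 2 * int k < \<bar>fst p\<bar>"
      using that by (auto simp: D_def strip_ball_def mem_strip_iff)
    then have "1 \<le> \<bar>offset \<beta> p / (2 * c)\<bar> \<or> 1 \<le> \<bar>real_of_int (fst p) / (2 * real k)\<bar>"
    proof
      assume "2 * c < \<bar>offset \<beta> p\<bar>"
      then show ?thesis using c by (simp add: abs_divide)
    next
      assume "2 * int k < \<bar>fst p\<bar>"
      then have "2 * real k < \<bar>real_of_int (fst p)\<bar>" by linarith
      then show ?thesis using kpos by (simp add: abs_divide)
    qed
    then have "tent (offset \<beta> p / (2 * c)) = 0 \<or> tent (real_of_int (fst p) / (2 * real k)) = 0"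
      by (simp only: tent_eq_0_iff)
    then show ?thesis by (auto simp: a_def)
  qed
  have sub: "{p. a p \<noteq> 0} \<subseteq> D" using supp by blast
  have fin: "finite {p. a p \<noteq> 0}" by (rule finite_subset[OF sub D])
  have bound: "(\<Sum>p\<in>F. g p) \<le> B * real (card E)"
    if "finite F" "finite E" "\<And>p. p \<notin> E \<Longrightarrow> g p = 0" "\<And>p. g p \<le> B" "0 \<le> B"
    for F E :: "(int \<times> int) set" and g B
  proof -
    have "(\<Sum>p\<in>F. g p) = (\<Sum>p\<in>F \<inter> E. g p)"
      using that by (intro sum.mono_neutral_right) auto
    also have "\<dots> \<le> real (card (F \<inter> E)) * B" using that(4) by (rule sum_bounded_above)
    also have "\<dots> \<le> real (card E) * B"
      using that by (intro mult_right_mono) (auto intro: card_mono)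
    finally show ?thesis by (simp add: mult.commute)
  qed
  have mass: "sum a F \<le> 5 * (4 * c + 1)" if "finite F" for F
  proof -
    have "sum a F \<le> 1 / real k * real (card D)"
    proof (rule bound[OF that D])
      show "0 \<le> 1 / real k" by simp
    qed (rule supp, assumption, rule a1)
    also have "\<dots> \<le> 1 / real k * (5 * (4 * c + 1) * real k)"
      using cardD by (intro mult_left_mono) auto
    finally show ?thesis using kpos by simp
  qed
  have var: "(\<Sum>p\<in>F. \<bar>a (p - q) - a p\<bar>) \<le> 10 * (4 * c + 1) / c * \<bar>offset \<beta> q\<bar> + 1 / real (Suc n)"
    if F: "finite F" and q: "\<bar>fst q\<bar> \<le> int n" for F q
  proof -
    define B where "B = (\<bar>offset \<beta> q\<bar> / (2 * c) + real n / (2 * real k)) / real k"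
    have B0: "0 \<le> B" using c by (simp add: B_def)
    have "(\<Sum>p\<in>F. \<bar>a (p - q) - a p\<bar>) \<le> B * real (card (D \<union> (\<lambda>p. p + q) ` D))"
    proof (rule bound[OF F])
      show "finite (D \<union> (\<lambda>p. p + q) ` D)" using D by simp
      show "0 \<le> B" by (rule B0)
      fix p
      show "\<bar>a (p - q) - a p\<bar> = 0" if "p \<notin> D \<union> (\<lambda>p. p + q) ` D"
      proof -
        have "p - q \<notin> D"
        proof
          assume "p - q \<in> D"
          then have "p \<in> (\<lambda>p. p + q) ` D" by (rule image_eqI[rotated]) simp
          with that show False by simp
        qed
        then show ?thesis using that supp by simp
      qed
      have "\<bar>a (p - q) - a p\<bar> = \<bar>tent (offset \<beta> (p - q) / (2 * c)) * tent (real_of_int (fst (p - q)) / (2 * real k))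
          - tent (offset \<beta> p / (2 * c)) * tent (real_of_int (fst p) / (2 * real k))\<bar> / real k"
        unfolding a_def using kpos by (simp add: diff_divide_distrib[symmetric] abs_divide)
      also have "\<dots> \<le> (\<bar>offset \<beta> (p - q) / (2 * c) - offset \<beta> p / (2 * c)\<bar>
          + \<bar>real_of_int (fst (p - q)) / (2 * real k) - real_of_int (fst p) / (2 * real k)\<bar>) / real k"
        by (intro divide_right_mono tent_mult_Lipschitz) simp
      also have "offset \<beta> (p - q) / (2 * c) - offset \<beta> p / (2 * c) = - (offset \<beta> q / (2 * c))"
        by (simp add: offset_diff diff_divide_distrib)
      also have "real_of_int (fst (p - q)) / (2 * real k) - real_of_int (fst p) / (2 * real k)
          = - (real_of_int (fst q) / (2 * real k))"
        by (simp add: diff_divide_distrib)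
      also have "(\<bar>- (offset \<beta> q / (2 * c))\<bar> + \<bar>- (real_of_int (fst q) / (2 * real k))\<bar>) / real k \<le> B"
      proof -
        have "\<bar>real_of_int (fst q)\<bar> \<le> real n" using q by linarith
        then have "\<bar>real_of_int (fst q)\<bar> / (2 * real k) \<le> real n / (2 * real k)"
          by (intro divide_right_mono) auto
        then show ?thesis
          unfolding B_def using c by (intro divide_right_mono) (auto simp: abs_divide)
      qed
      finally show "\<bar>a (p - q) - a p\<bar> \<le> B" .
    qed
    also have "\<dots> \<le> B * (2 * (5 * (4 * c + 1) * real k))"
    proof (intro mult_left_mono B0)
      have "card (D \<union> (\<lambda>p. p + q) ` D) \<le> card D + card D"
        using card_Un_le[of D "(\<lambda>p. p + q) ` D"] card_image_le[OF D, of "\<lambda>p. p + q"] by linarith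
      then have "real (card (D \<union> (\<lambda>p. p + q) ` D)) \<le> real (card D) + real (card D)" by linarith
      then show "real (card (D \<union> (\<lambda>p. p + q) ` D)) \<le> 2 * (5 * (4 * c + 1) * real k)"
        using cardD by linarith
    qed
    also have "\<dots> = 10 * (4 * c + 1) * (\<bar>offset \<beta> q\<bar> / (2 * c)) + 10 * (4 * c + 1) * (real n / (2 * real k))"
    proof -
      have "x / real k * (2 * (5 * y * real k)) = 10 * y * x" for x y :: real using kpos by simp
      then show ?thesis unfolding B_def distrib_left[symmetric] .
    qed
    also have "\<dots> \<le> 10 * (4 * c + 1) / c * \<bar>offset \<beta> q\<bar> + 1 / real (Suc n)"
    proof (rule add_mono)
      have "\<bar>offset \<beta> q\<bar> / (2 * c) \<le> \<bar>offset \<beta> q\<bar> / c" using c by (intro divide_left_mono) auto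
      then have "10 * (4 * c + 1) * (\<bar>offset \<beta> q\<bar> / (2 * c)) \<le> 10 * (4 * c + 1) * (\<bar>offset \<beta> q\<bar> / c)"
        using c by (intro mult_left_mono) auto
      then show "10 * (4 * c + 1) * (\<bar>offset \<beta> q\<bar> / (2 * c)) \<le> 10 * (4 * c + 1) / c * \<bar>offset \<beta> q\<bar>"
        by simp
      \<comment> \<open>The size of \<open>k\<close> makes the contribution of the tent along the
        strip at most \<open>1 / Suc n\<close>; the tent across it gives the Lipschitz term.\<close>
      have "10 * (4 * c + 1) * real n * real (Suc n) \<le> 2 * real k"
        using k(2) kpos by linarith
      then show "10 * (4 * c + 1) * (real n / (2 * real k)) \<le> 1 / real (Suc n)"
        using kpos by (simp add: divide_le_eq le_divide_eq mult_ac)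
    qed
    finally show ?thesis .
  qed
  \<comment> \<open>The 12 combines 3 from the size of the ball with 4 from the lower bound
    \<open>1 / (4 * k)\<close> of the weight.\<close>
  have energy: "e\<^sup>2 / (12 * (2 * c + 1)) \<le> (\<Sum>p | a p \<noteq> 0. a p * (\<phi> p)\<^sup>2)"
  proof -
    let ?B = "strip_ball \<beta> c k"
    have B: "finite ?B" "real (card ?B) \<le> (2 * c + 1) * (3 * real k)"
    proof -
      show "finite ?B" using c by (intro strip_ball_bounds) simp
      have "real (card ?B) \<le> (2 * c + 1) * (2 * real k + 1)" using c by (intro strip_ball_bounds) simp
      also have "\<dots> \<le> (2 * c + 1) * (3 * real k)" using c k(1) by (intro mult_left_mono) auto
      finally show "real (card ?B) \<le> (2 * c + 1) * (3 * real k)" .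
    qed
    have aB: "1 / (4 * real k) \<le> a p" if "p \<in> ?B" for p
    proof -
      have p: "\<bar>offset \<beta> p\<bar> \<le> c" "\<bar>fst p\<bar> \<le> int k" using that by (auto simp: strip_ball_def mem_strip_iff)
      have "1/2 \<le> tent (offset \<beta> p / (2 * c))"
        using p(1) c by (intro tent_ge_half) (simp add: abs_divide)
      moreover have "1/2 \<le> tent (real_of_int (fst p) / (2 * real k))"
      proof (rule tent_ge_half)
        have "\<bar>real_of_int (fst p)\<bar> \<le> real k" using p(2) by linarith
        then show "2 * \<bar>real_of_int (fst p) / (2 * real k)\<bar> \<le> 1" using kpos by (simp add: abs_divide)
      qed
      ultimately have "1/2 * (1/2) \<le> tent (offset \<beta> p / (2 * c)) * tent (real_of_int (fst p) / (2 * real k))"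
        by (intro mult_mono) auto
      then have "1/2 * (1/2) / real k \<le> a p" unfolding a_def by (intro divide_right_mono) auto
      then show ?thesis by simp
    qed
    have "(e * real k)\<^sup>2 \<le> (\<Sum>p\<in>?B. 1 * \<bar>\<phi> p\<bar>)\<^sup>2"
      using big e by (intro power_mono) auto
    also have "\<dots> \<le> (\<Sum>p\<in>?B. 1\<^sup>2) * (\<Sum>p\<in>?B. \<bar>\<phi> p\<bar>\<^sup>2)" by (rule Cauchy_Schwarz_ineq_sum)
    also have "\<dots> = real (card ?B) * (\<Sum>p\<in>?B. (\<phi> p)\<^sup>2)" by simp
    also have "\<dots> \<le> (2 * c + 1) * (3 * real k) * (\<Sum>p\<in>?B. (\<phi> p)\<^sup>2)"
      using B(2) by (intro mult_right_mono sum_nonneg) auto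
    finally have "e\<^sup>2 * real k * real k \<le> (2 * c + 1) * 3 * (\<Sum>p\<in>?B. (\<phi> p)\<^sup>2) * real k"
      by (simp add: power2_eq_square mult_ac)
    then have 1: "e\<^sup>2 * real k \<le> (2 * c + 1) * 3 * (\<Sum>p\<in>?B. (\<phi> p)\<^sup>2)" using kpos by simp
    have "1 / (4 * real k) * (\<Sum>p\<in>?B. (\<phi> p)\<^sup>2) = (\<Sum>p\<in>?B. 1 / (4 * real k) * (\<phi> p)\<^sup>2)"
      by (rule sum_distrib_left)
    also have "\<dots> \<le> (\<Sum>p\<in>?B. a p * (\<phi> p)\<^sup>2)"
      using aB by (intro sum_mono mult_right_mono) auto
    also have "\<dots> \<le> (\<Sum>p | a p \<noteq> 0. a p * (\<phi> p)\<^sup>2)"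
    proof (rule sum_mono2[OF fin])
      show "?B \<subseteq> {p. a p \<noteq> 0}"
      proof
        fix p assume "p \<in> ?B"
        from aB[OF this] kpos have "0 < a p" by (meson divide_pos_pos less_le_trans mult_pos_pos zero_less_numeral zero_less_one)
        then show "p \<in> {p. a p \<noteq> 0}" by simp
      qed
    qed (use a0 in simp)
    finally have 2: "1 / (4 * real k) * (\<Sum>p\<in>?B. (\<phi> p)\<^sup>2) \<le> (\<Sum>p | a p \<noteq> 0. a p * (\<phi> p)\<^sup>2)" .
    have "e\<^sup>2 / (12 * (2 * c + 1)) = e\<^sup>2 * real k / (12 * (2 * c + 1) * real k)" using kpos by simp
    also have "\<dots> \<le> (2 * c + 1) * 3 * (\<Sum>p\<in>?B. (\<phi> p)\<^sup>2) / (12 * (2 * c + 1) * real k)"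
      using 1 c kpos by (intro divide_right_mono) auto
    also have "\<dots> = 1 / (4 * real k) * (\<Sum>p\<in>?B. (\<phi> p)\<^sup>2)"
      using c kpos by (simp add: divide_simps)
    finally show ?thesis using 2 by linarith
  qed
  have "a \<in> weights \<beta> (10 * (4 * c + 1) / c) (5 * (4 * c + 1)) (e\<^sup>2 / (12 * (2 * c + 1))) \<phi> n"
    unfolding weights_def mem_Collect_eq using a0 fin mass var energy by (intro conjI allI impI)
  then show ?thesis by blast
qed

text \<open>If the averages do not tend to zero, they are at least some \<open>e\<close> for
  arbitrarily large \<open>k\<close>. For each \<open>n\<close>, such a \<open>k\<close> that is
  large compared with \<open>n\<^sup>2\<close> gives an admissible weight, with constants
  independent of \<open>k\<close> and \<open>n\<close>; so no weight set is empty and a precompact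
  function arises.\<close>

lemma (in Z2_system) weakly_mixing_corr_average:
  assumes wm: "directionally_weakly_mixing M T \<beta>" and c: "0 < c"
    and f: "f \<in> L2_real M" and mean: "(\<integral>x. f x \<partial>M) = 0"
  shows "(\<lambda>k. (\<Sum>p\<in>strip_ball \<beta> c k. \<bar>corr f p\<bar>) / real k) \<longlonglongrightarrow> 0"
proof (rule LIMSEQ_I, rule ccontr)
  fix e :: real assume e: "0 < e"
  assume no: "\<nexists>k0. \<forall>k\<ge>k0. norm ((\<Sum>p\<in>strip_ball \<beta> c k. \<bar>corr f p\<bar>) / real k - 0) < e"
  have ne: "weights \<beta> (10 * (4 * c + 1) / c) (5 * (4 * c + 1)) (e\<^sup>2 / (12 * (2 * c + 1))) (corr f) n \<noteq> {}" for n
  proof -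
    obtain k0 :: nat where k0: "20 * (4 * c + 1) * real n * real (Suc n) \<le> real k0"
      using real_arch_simple by blast
    from no obtain k where k: "k \<ge> Suc k0"
      "\<not> norm ((\<Sum>p\<in>strip_ball \<beta> c k. \<bar>corr f p\<bar>) / real k - 0) < e" by blast
    have "e \<le> (\<Sum>p\<in>strip_ball \<beta> c k. \<bar>corr f p\<bar>) / real k"
      using k(2) by (simp add: sum_nonneg)
    then have "e * real k \<le> (\<Sum>p\<in>strip_ball \<beta> c k. \<bar>corr f p\<bar>)"
      using k(1) by (simp add: le_divide_eq)
    then show ?thesis using k k0 by (intro tent_weight c e) auto
  qed
  have pos: "0 \<le> 10 * (4 * c + 1) / c" "0 < e\<^sup>2 / (12 * (2 * c + 1))" using c e by auto
  obtain g where "g \<in> L2_real M" "strip_precompact \<beta> c g" "(\<integral>x. g x \<partial>M) = 0" "0 < nrm M g"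
    by (rule weights_nonempty_imp_precompact[OF f pos ne mean]) (rule that)
  from precompact_imp_not_weakly_mixing[OF c this] wm show False by blast
qed

section \<open>Averages along sets of positive density\<close>

context Z2_system
begin

text \<open>Expanding the square gives correlations at \<open>q i - q j\<close>. For fixed
  \<open>i\<close> these differences are distinct and lie in the wider ball, so each row is at most
  the sum over it; averaging over the rows leaves one factor \<open>1 / N\<close>.\<close>

lemma nrm_average_le:
  assumes f: "f \<in> L2_real M" and q: "inj_on q {..<N}" and N: "0 < N"
    and Q: "\<And>i. i < N \<Longrightarrow> q i \<in> strip \<beta> b" "\<And>i. i < N \<Longrightarrow> 0 \<le> fst (q i) \<and> fst (q i) \<le> int k" and b: "0 \<le> b"
  shows "(nrm M (\<lambda>x. \<Sum>i<N. (1 / real N) * f (T (q i) x)))\<^sup>2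
    \<le> (\<Sum>p\<in>strip_ball \<beta> (2 * b) k. \<bar>corr f p\<bar>) / real N"
proof -
  let ?S = "\<Sum>p\<in>strip_ball \<beta> (2 * b) k. \<bar>corr f p\<bar>"
  let ?A = "\<lambda>x. \<Sum>i<N. (1 / real N) * f (T (q i) x)"
  have TL: "(\<lambda>x. f (T p x)) \<in> L2_real M" for p by (rule L2_real_T[OF f])
  have AL: "?A \<in> L2_real M" by (intro L2_real_sum TL)
  have "(nrm M ?A)\<^sup>2 = (\<Sum>i<N. 1 / real N * ip M (\<lambda>x. f (T (q i) x)) ?A)"
    unfolding nrm_power2 by (rule ip_sum[OF TL AL])
  also have "\<dots> = (\<Sum>i<N. 1 / real N * (\<Sum>j<N. 1 / real N * corr f (q i - q j)))"
  proof (rule sum.cong[OF refl])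
    fix i
    have "ip M (\<lambda>x. f (T (q i) x)) ?A = (\<Sum>j<N. 1 / real N * ip M (\<lambda>x. f (T (q j) x)) (\<lambda>x. f (T (q i) x)))"
      by (subst ip_commute) (rule ip_sum[OF TL TL])
    then show "1 / real N * ip M (\<lambda>x. f (T (q i) x)) ?A = 1 / real N * (\<Sum>j<N. 1 / real N * corr f (q i - q j))"
      by (simp only: ip_T_T[OF f])
  qed
  also have "\<dots> \<le> (\<Sum>i<N. 1 / real N * (1 / real N * ?S))"
  proof (intro sum_mono mult_left_mono)
    fix i assume "i \<in> {..<N}"
    then have i: "i < N" by simp
    have "(\<Sum>j<N. 1 / real N * corr f (q i - q j)) = 1 / real N * (\<Sum>j<N. corr f (q i - q j))"
      by (simp only: sum_distrib_left)
    also have "\<dots> \<le> 1 / real N * ?S"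
    proof (rule mult_left_mono)
      have inj: "inj_on (\<lambda>j. q i - q j) {..<N}" using q by (auto simp: inj_on_def)
      have "(\<Sum>j<N. corr f (q i - q j)) \<le> (\<Sum>j<N. \<bar>corr f (q i - q j)\<bar>)" by (intro sum_mono) simp
      also have "\<dots> = (\<Sum>p\<in>(\<lambda>j. q i - q j) ` {..<N}. \<bar>corr f p\<bar>)"
        by (simp only: sum.reindex[OF inj] comp_def)
      also have "\<dots> \<le> ?S"
      proof (rule sum_mono2)
        show "finite (strip_ball \<beta> (2 * b) k)" using b by (intro strip_ball_bounds) simp
        show "(\<lambda>j. q i - q j) ` {..<N} \<subseteq> strip_ball \<beta> (2 * b) k"
        proof
          fix p assume "p \<in> (\<lambda>j. q i - q j) ` {..<N}"
          then obtain j where j: "j < N" "p = q i - q j" by auto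
          have "\<bar>offset \<beta> (q i)\<bar> \<le> b" "\<bar>offset \<beta> (q j)\<bar> \<le> b"
            using Q(1)[OF i] Q(1)[OF j(1)] by (simp_all only: mem_strip_iff)
          then have "\<bar>offset \<beta> p\<bar> \<le> 2 * b" unfolding j(2) offset_diff by linarith
          moreover have "\<bar>fst p\<bar> \<le> int k"
            using Q(2)[OF i] Q(2)[OF j(1)] unfolding j(2) fst_diff by linarith
          ultimately show "p \<in> strip_ball \<beta> (2 * b) k" by (simp add: strip_ball_def mem_strip_iff)
        qed
      qed simp
      finally show "(\<Sum>j<N. corr f (q i - q j)) \<le> ?S" .
    qed simp
    finally show "(\<Sum>j<N. 1 / real N * corr f (q i - q j)) \<le> 1 / real N * ?S" .
  qed simp
  also have "\<dots> = ?S / real N" using N by simp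
  finally show ?thesis .
qed

end

text \<open>The order of enumeration enters here: all points of \<open>Q\<close> in columns before
  that of \<open>q N\<close> have index below \<open>N\<close>. Positive lower density makes their
  number at least proportional to the column, so first coordinates grow at most linearly with the
  index.\<close>

lemma enumerates_fst_linear:
  assumes b: "b > 0" and Q: "Q \<subseteq> strip_pos \<beta> b" and q: "enumerates q Q" and D: "lower_density \<beta> b Q > 0"
  obtains \<kappa> where "\<kappa> > 0" "\<forall>\<^sub>F N in sequentially. \<kappa> * real (nat (fst (q N))) \<le> real (Suc N)"
    "filterlim (\<lambda>N. nat (fst (q N))) at_top sequentially"
proof -
  have inj: "inj q" and ran: "range q = Q" and mono: "mono (\<lambda>i. fst (q i))"
    using q by (auto simp: enumerates_def bij_betw_def)
  have qQ: "q i \<in> Q" for i using ran by (metis rangeI)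
  have q0: "0 \<le> fst (q i)" for i using qQ[of i] Q by (auto simp: strip_pos_def)
  have fin: "finite (Q \<inter> ({0..int k - 1} \<times> UNIV))" "Q \<inter> ({0..int k - 1} \<times> UNIV) \<subseteq> strip_upto \<beta> b k" for k
  proof -
    show "Q \<inter> ({0..int k - 1} \<times> UNIV) \<subseteq> strip_upto \<beta> b k"
      using Q by (auto simp: strip_pos_def strip_upto_def)
    then show "finite (Q \<inter> ({0..int k - 1} \<times> UNIV))"
      using strip_upto_bounds(1)[of b \<beta> k] b finite_subset by auto
  qed
  \<comment> \<open>A box contains only finitely many points of \<open>Q\<close>, so the injective
    sequence eventually leaves it.\<close>
  have lim: "filterlim (\<lambda>N. nat (fst (q N))) at_top sequentially"
    unfolding filterlim_at_top
  proof
    fix Z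
    have "q ` {i. nat (fst (q i)) < Z} \<subseteq> Q \<inter> ({0..int Z - 1} \<times> UNIV)"
    proof
      fix p assume "p \<in> q ` {i. nat (fst (q i)) < Z}"
      then obtain i where i: "p = q i" "nat (fst (q i)) < Z" by auto
      then have "0 \<le> fst p" "fst p \<le> int Z - 1" "p \<in> Q" using q0[of i] qQ[of i] by auto
      then show "p \<in> Q \<inter> ({0..int Z - 1} \<times> UNIV)" by (cases p) auto
    qed
    then have "finite (q ` {i. nat (fst (q i)) < Z})" by (rule finite_subset[OF _ fin(1)])
    then have "finite {i. nat (fst (q i)) < Z}"
      by (rule finite_imageD) (rule inj_on_subset[OF inj subset_UNIV])
    then obtain n0 where n0: "\<forall>i\<in>{i. nat (fst (q i)) < Z}. i \<le> n0"
      unfolding finite_nat_set_iff_bounded_le by (elim exE)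
    have "Z \<le> nat (fst (q i))" if "Suc n0 \<le> i" for i
    proof (rule ccontr)
      assume "\<not> Z \<le> nat (fst (q i))"
      then have "i \<le> n0" using n0 by simp
      with that show False by simp
    qed
    then show "\<forall>\<^sub>F i in sequentially. Z \<le> nat (fst (q i))" unfolding eventually_sequentially by blast
  qed
  obtain \<kappa> k0 where \<kappa>: "\<kappa> > 0" "\<And>k. k \<ge> k0 \<Longrightarrow> \<kappa> * real k \<le> real (card (strip_upto \<beta> b k))"
    by (rule strip_upto_linear_growth[OF b, of \<beta>]) (rule that)
  obtain d :: real where d: "0 < d" "ereal d < lower_density \<beta> b Q"
    using ereal_dense2[OF D] by (auto simp: zero_ereal_def)
  have "\<forall>\<^sub>F k in sequentially. ereal d < ereal (real (card (Q \<inter> ({0..int k - 1} \<times> UNIV))) / real (card (strip_upto \<beta> b k)))"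
    using d(2) unfolding lower_density_def by (rule less_LiminfD)
  then have ev: "\<forall>\<^sub>F k in sequentially. d * \<kappa> * real k \<le> real (card (Q \<inter> ({0..int k - 1} \<times> UNIV)))"
    using eventually_ge_at_top[of "max 1 k0"]
  proof eventually_elim
    case (elim k)
    have "\<kappa> * real k \<le> real (card (strip_upto \<beta> b k))" using \<kappa>(2) elim(2) by simp
    moreover have "0 < \<kappa> * real k" using \<kappa>(1) elim(2) by simp
    ultimately have pos: "0 < real (card (strip_upto \<beta> b k))" by linarith
    have "d * (\<kappa> * real k) \<le> d * real (card (strip_upto \<beta> b k))"
      using \<kappa>(2) elim(2) d(1) by (intro mult_left_mono) auto
    also have "\<dots> \<le> real (card (Q \<inter> ({0..int k - 1} \<times> UNIV)))"
      using elim(1) pos by (simp add: less_divide_eq)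
    finally show ?case by (simp add: mult.assoc)
  qed
  show thesis
  proof (rule that[OF _ _ lim])
    show "0 < d * \<kappa>" using d(1) \<kappa>(1) by simp
    show "\<forall>\<^sub>F N in sequentially. d * \<kappa> * real (nat (fst (q N))) \<le> real (Suc N)"
      using eventually_compose_filterlim[OF ev lim]
    proof eventually_elim
      case (elim N)
      have "Q \<inter> ({0..int (nat (fst (q N))) - 1} \<times> UNIV) \<subseteq> q ` {..<N}"
      proof
        fix p assume p: "p \<in> Q \<inter> ({0..int (nat (fst (q N))) - 1} \<times> UNIV)"
        then obtain i where i: "p = q i" using ran by blast
        have "fst (q i) < fst (q N)" using p q0[of N] unfolding i by (cases "q i") auto
        then have "i < N" using monoD[OF mono, of N i] by (meson not_less)
        then show "p \<in> q ` {..<N}" unfolding i by blast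
      qed
      then have "card (Q \<inter> ({0..int (nat (fst (q N))) - 1} \<times> UNIV)) \<le> card (q ` {..<N})"
        by (intro card_mono) auto
      also have "\<dots> \<le> N" using card_image_le[of "{..<N}" q] by simp
      finally show ?case using elim by simp
    qed
  qed
qed

lemma L2_fun_iff_Re_Im:
  "f \<in> L2_fun M \<longleftrightarrow> (\<lambda>x. Re (f x)) \<in> L2_real M \<and> (\<lambda>x. Im (f x)) \<in> L2_real M"
proof
  assume "(\<lambda>x. Re (f x)) \<in> L2_real M \<and> (\<lambda>x. Im (f x)) \<in> L2_real M"
  then show "f \<in> L2_fun M"
    by (simp add: L2_real_def L2_fun_def cmod_power2 borel_measurable_complex_iff)
qed (simp add: L2_fun_Re_Im)

context Z2_system
begin

text \<open>The radius is the column \<open>j N\<close> of the last point used. In the bound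
  \<open>S (j N) / Suc N\<close> the denominator is eventually at least
  \<open>\<kappa> * j N\<close>, so the averages of correlations along \<open>j N\<close> force
  convergence.\<close>

lemma weakly_mixing_average_real:
  assumes wm: "directionally_weakly_mixing M T \<beta>" and b: "b > 0"
    and Q: "Q \<subseteq> strip_pos \<beta> b" and q: "enumerates q Q" and D: "lower_density \<beta> b Q > 0"
    and f: "f \<in> L2_real M" and mean: "(\<integral>x. f x \<partial>M) = 0"
  shows "(\<lambda>N. nrm M (\<lambda>x. \<Sum>i<Suc N. (1 / real (Suc N)) * f (T (q i) x))) \<longlonglongrightarrow> 0"
proof -
  let ?a = "\<lambda>N. nrm M (\<lambda>x. \<Sum>i<Suc N. (1 / real (Suc N)) * f (T (q i) x))"
  define S where "S k = (\<Sum>p\<in>strip_ball \<beta> (2 * b) k. \<bar>corr f p\<bar>)" for k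
  define j where "j N = nat (fst (q N))" for N
  have inj: "inj q" and ran: "range q = Q" and mono: "mono (\<lambda>i. fst (q i))"
    using q by (auto simp: enumerates_def bij_betw_def)
  have qQ: "q i \<in> strip \<beta> b" "0 \<le> fst (q i)" for i
  proof -
    have "q i \<in> strip_pos \<beta> b" using ran Q by (metis rangeI subsetD)
    then show "q i \<in> strip \<beta> b" "0 \<le> fst (q i)" by (auto simp: strip_pos_def)
  qed
  obtain \<kappa> where \<kappa>: "\<kappa> > 0" "\<forall>\<^sub>F N in sequentially. \<kappa> * real (nat (fst (q N))) \<le> real (Suc N)"
    and lim: "filterlim (\<lambda>N. nat (fst (q N))) at_top sequentially"
    by (rule enumerates_fst_linear[OF b Q q D]) (rule that)
  have "(\<lambda>k. S k / real k) \<longlonglongrightarrow> 0"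
    unfolding S_def using b by (intro weakly_mixing_corr_average wm f mean) simp
  then have "(\<lambda>N. S (j N) / real (j N)) \<longlonglongrightarrow> 0"
    unfolding j_def by (rule filterlim_compose[OF _ lim])
  then have "(\<lambda>N. S (j N) / real (j N) / \<kappa>) \<longlonglongrightarrow> 0 / \<kappa>"
    by (rule tendsto_divide) (use \<kappa> in auto)
  then have lim0: "(\<lambda>N. S (j N) / real (j N) / \<kappa>) \<longlonglongrightarrow> 0" by simp
  have ge1: "\<forall>\<^sub>F N in sequentially. 1 \<le> j N"
    using lim unfolding filterlim_at_top j_def by blast
  have "\<forall>\<^sub>F N in sequentially. (?a N)\<^sup>2 \<le> S (j N) / real (j N) / \<kappa>"
    using \<kappa>(2) ge1
  proof eventually_elim
    case (elim N)
    have "(?a N)\<^sup>2 \<le> S (j N) / real (Suc N)"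
      unfolding S_def
    proof (rule nrm_average_le[OF f _ _ _ _ less_imp_le[OF b]])
      show "inj_on q {..<Suc N}" using inj inj_on_subset by blast
      show "0 \<le> fst (q i) \<and> fst (q i) \<le> int (j N)" if "i < Suc N" for i
        using qQ(2) monoD[OF mono, of i N] that by (simp add: j_def)
    qed (simp_all add: qQ)
    also have "\<dots> \<le> S (j N) / (\<kappa> * real (j N))"
      using elim \<kappa>(1) by (intro divide_left_mono) (auto simp: S_def j_def sum_nonneg)
    finally show ?case by (simp add: mult.commute)
  qed
  then have "(\<lambda>N. (?a N)\<^sup>2) \<longlonglongrightarrow> 0"
    by (intro tendsto_sandwich[OF _ _ tendsto_const lim0]) auto
  then have "(\<lambda>N. sqrt ((?a N)\<^sup>2)) \<longlonglongrightarrow> sqrt 0" by (rule tendsto_real_sqrt)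
  then show ?thesis by simp
qed

text \<open>Averaging fixes constants, so real and imaginary parts can be centred separately before
  averaging.\<close>

lemma weakly_mixing_average:
  assumes wm: "directionally_weakly_mixing M T \<beta>" and b: "b > 0"
    and Q: "Q \<subseteq> strip_pos \<beta> b" and q: "enumerates q Q" and D: "lower_density \<beta> b Q > 0"
    and f: "f \<in> L2_fun M"
  shows "(\<lambda>N. L2_norm M (\<lambda>x. (1 / of_nat N) * (\<Sum>i<N. koopman T (q i) f x) - (\<integral>y. f y \<partial>M))) \<longlonglongrightarrow> 0"
\<comment> \<open>Shifting the index discards the average over no points.\<close>
proof (rule LIMSEQ_imp_Suc)
  let ?h = "\<lambda>N x. (1 / of_nat (Suc N)) * (\<Sum>i<Suc N. koopman T (q i) f x) - (\<integral>y. f y \<partial>M)"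
  define u where "u x = Re (f x) - (\<integral>y. Re (f y) \<partial>M)" for x
  define v where "v x = Im (f x) - (\<integral>y. Im (f y) \<partial>M)" for x
  have fm: "f \<in> borel_measurable M" using f by (simp add: L2_fun_def)
  have fi: "integrable M f"
    using integral_norm_le_L2_norm(1)[OF f] integrable_norm_iff[OF fm] by simp
  have uv: "u \<in> L2_real M" "v \<in> L2_real M"
    unfolding u_def[abs_def] v_def[abs_def] by (intro L2_real_diff L2_fun_Re_Im f L2_real_const)+
  have mean: "(\<integral>x. u x \<partial>M) = 0" "(\<integral>x. v x \<partial>M) = 0"
    using fi prob_space by (simp_all add: u_def v_def)
  have avg: "(1 / real (Suc N)) * (\<Sum>i<Suc N. g i) - m = (\<Sum>i<Suc N. (1 / real (Suc N)) * (g i - m))"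
    for g :: "nat \<Rightarrow> real" and m N
    unfolding sum_distrib_left[symmetric] sum_subtractf sum_constant card_lessThan
    by (simp add: right_diff_distrib del: of_nat_Suc)
  have Re: "(\<lambda>x. Re (?h N x)) = (\<lambda>x. \<Sum>i<Suc N. (1 / real (Suc N)) * u (T (q i) x))" for N
  proof
    fix x
    have "Re (?h N x) = (1 / real (Suc N)) * (\<Sum>i<Suc N. Re (f (T (q i) x))) - (\<integral>y. Re (f y) \<partial>M)"
      using fi by (simp add: koopman_def integral_Re del: of_nat_Suc sum.lessThan_Suc)
    then show "Re (?h N x) = (\<Sum>i<Suc N. (1 / real (Suc N)) * u (T (q i) x))"
      unfolding u_def avg .
  qed
  have Im: "(\<lambda>x. Im (?h N x)) = (\<lambda>x. \<Sum>i<Suc N. (1 / real (Suc N)) * v (T (q i) x))" for N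
  proof
    fix x
    have "Im (?h N x) = (1 / real (Suc N)) * (\<Sum>i<Suc N. Im (f (T (q i) x))) - (\<integral>y. Im (f y) \<partial>M)"
      using fi by (simp add: koopman_def integral_Im del: of_nat_Suc sum.lessThan_Suc)
    then show "Im (?h N x) = (\<Sum>i<Suc N. (1 / real (Suc N)) * v (T (q i) x))"
      unfolding v_def avg .
  qed
  have hL: "?h N \<in> L2_fun M" for N
    unfolding L2_fun_iff_Re_Im Re Im by (intro conjI L2_real_sum L2_real_T uv)
  have le: "L2_norm M (?h N) \<le> nrm M (\<lambda>x. \<Sum>i<Suc N. (1 / real (Suc N)) * u (T (q i) x))
      + nrm M (\<lambda>x. \<Sum>i<Suc N. (1 / real (Suc N)) * v (T (q i) x))" for N
    using L2_norm_le_Re_Im[OF hL, of N] unfolding Re Im .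
  have lim: "(\<lambda>N. nrm M (\<lambda>x. \<Sum>i<Suc N. (1 / real (Suc N)) * u (T (q i) x))
      + nrm M (\<lambda>x. \<Sum>i<Suc N. (1 / real (Suc N)) * v (T (q i) x))) \<longlonglongrightarrow> 0"
    by (intro tendsto_add_zero weakly_mixing_average_real[OF wm b Q q D] uv mean)
  show "(\<lambda>N. L2_norm M (?h N)) \<longlonglongrightarrow> 0"
  proof (rule tendsto_sandwich[OF _ _ tendsto_const lim])
    show "\<forall>\<^sub>F N in sequentially. 0 \<le> L2_norm M (?h N)" by (simp add: L2_norm_def)
  qed (use le in simp)
qed

section \<open>Converse: almost periods of a Kronecker set\<close>

text \<open>Total boundedness of the orbit of \<open>1\<^sub>B\<close> makes its set of almost periods syndetic in the strip.\<close>

lemma almost_periods_linear_growth: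
  assumes b: "b > 0" and B: "B \<in> directional_kronecker M T \<beta>" and e: "e > 0"
  obtains \<kappa> k0 where "\<kappa> > 0"
    "\<And>k. k \<ge> k0 \<Longrightarrow> \<kappa> * real k \<le> real (card ({p \<in> strip_pos \<beta> b. nrm M (\<lambda>x. indicator B (T p x) - indicator B x) < e}
       \<inter> ({0..int k - 1} \<times> UNIV)))"
proof -
  have BM: "B \<in> sets M" using B by (simp add: directional_kronecker_def)
  let ?d = "\<lambda>p. nrm M (\<lambda>x. indicator B (T p x) - indicator B x)"
  define P where "P = {p \<in> strip \<beta> b. ?d p < e}"
  \<comment> \<open>Almost periods arise as differences of two points of the strip of half the
    width, so they stay in the given one.\<close>
  have "0 < b / 2" using b by simp
  have "strip_precompact \<beta> (b / 2) (indicator B)"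
    using B unfolding directional_kronecker_iff[OF \<open>0 < b / 2\<close>] orbit_compact_indicator_iff[OF BM] by blast
  from this[unfolded strip_precompact_def, rule_format, OF e]
  obtain K where K: "finite K" "K \<subseteq> strip \<beta> (b / 2)"
    and near: "\<forall>p\<in>strip \<beta> (b / 2). \<exists>r\<in>K. nrm M (\<lambda>x. indicator B (T p x) - indicator B (T r x)) < e"
    by (elim exE conjE)
  obtain F where F: "finite F" "\<And>p. p \<in> strip \<beta> 1 \<Longrightarrow> \<exists>r\<in>F. p - r \<in> strip \<beta> (b / 2)"
    by (rule strip_finite_cover[OF \<open>0 < b / 2\<close>, of \<beta> 1]) (rule that)
  define G where "G = (\<lambda>(r, s). r + s) ` (F \<times> K)"
  have finG: "finite G" unfolding G_def using F(1) K(1) by simp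
  have cover: "\<exists>r\<in>G. p - r \<in> P" if p: "p \<in> strip \<beta> 1" for p
  proof -
    from F(2)[OF p] obtain r where r: "r \<in> F" "p - r \<in> strip \<beta> (b / 2)" by (elim bexE)
    from near[rule_format, OF r(2)] obtain s where s: "s \<in> K"
      "nrm M (\<lambda>x. indicator B (T (p - r) x) - indicator B (T s x)) < e" by (elim bexE)
    \<comment> \<open>Translation by \<open>s\<close> is an isometry, so closeness of the translates
      by \<open>p - r\<close> and by \<open>s\<close> makes \<open>p - r - s\<close> an almost
      period.\<close>
    have "nrm M (\<lambda>x. indicator B (T (p - r - s) (T s x)) - indicator B (T s x)) = ?d (p - r - s)"
      by (rule nrm_T[of "\<lambda>x. indicator B (T (p - r - s) x) - indicator B x"])
         (intro L2_real_diff L2_real_T indicator_L2_real BM)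
    then have "?d (p - r - s) < e" using s(2) by (simp add: T_T)
    moreover have "p - r - s \<in> strip \<beta> b"
    proof -
      have "\<bar>offset \<beta> (p - r)\<bar> \<le> b / 2" "\<bar>offset \<beta> s\<bar> \<le> b / 2"
        using r(2) s(1) K(2) by (auto simp: mem_strip_iff)
      then have "\<bar>offset \<beta> (p - r - s)\<bar> \<le> b" unfolding offset_diff[of \<beta> "p - r"] by linarith
      then show ?thesis unfolding mem_strip_iff .
    qed
    moreover have "r + s \<in> G" unfolding G_def using r(1) s(1) by force
    ultimately show ?thesis unfolding P_def by (intro bexI[of _ "r + s"]) (simp_all add: diff_diff_eq)
  qed
  have PS: "P \<subseteq> strip \<beta> b" by (auto simp: P_def)
  obtain \<kappa> k0 where \<kappa>: "\<kappa> > 0" "\<And>k. k \<ge> k0 \<Longrightarrow> \<kappa> * real k \<le> real (card (P \<inter> ({0..int k - 1} \<times> UNIV)))"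
    by (rule syndetic_linear_growth[OF finG cover PS less_imp_le[OF b]], assumption) (rule that)
  have "P \<inter> ({0..int k - 1} \<times> UNIV) = {p \<in> strip_pos \<beta> b. ?d p < e} \<inter> ({0..int k - 1} \<times> UNIV)" for k
    by (auto simp: P_def strip_pos_def)
  with \<kappa> show thesis by (intro that) auto
qed

text \<open>\<open>Q\<close> consists of the almost periods up to half the distance
  \<open>\<sigma>\<close> of the indicator from its mean. Every average along \<open>Q\<close> is
  within \<open>\<sigma> / 2\<close> of the indicator, hence at least \<open>\<sigma> / 2\<close>
  away from the constant, in any enumeration.\<close>

lemma kronecker_average_not_convergent:
  assumes b: "b > 0" and B: "B \<in> directional_kronecker M T \<beta>"
    and nontriv: "measure M B \<noteq> 0" "measure M B \<noteq> 1"
  obtains Q q where "Q \<subseteq> strip_pos \<beta> b" "infinite Q" "enumerates q Q" "lower_density \<beta> b Q > 0"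
    "\<not> (\<lambda>N. L2_norm M (\<lambda>x. (1 / of_nat N) * (\<Sum>i<N. koopman T (q i) (indicator B) x)
          - (\<integral>y. indicator B y \<partial>M))) \<longlonglongrightarrow> 0"
proof -
  have BM: "B \<in> sets M" using B by (simp add: directional_kronecker_def)
  define \<mu> where "\<mu> = measure M B"
  have iB: "(indicator B :: 'a \<Rightarrow> real) \<in> L2_real M" by (rule indicator_L2_real[OF BM])
  have cB: "(\<lambda>x. \<mu>) \<in> L2_real M" by (rule L2_real_const)
  define \<sigma> where "\<sigma> = nrm M (\<lambda>x. indicator B x - \<mu>)"
  have "(\<lambda>x. indicator B x * indicator B x) = (indicator B :: 'a \<Rightarrow> real)" by (auto simp: indicator_def)
  \<comment> \<open>This is the variance of an indicator; it vanishes only for measure 0 or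
    1.\<close>
  then have "\<sigma>\<^sup>2 = \<mu> - \<mu> * \<mu>"
    unfolding \<sigma>_def nrm_power2 ip_self_diff[OF iB cB] using prob_space by (simp add: ip_def \<mu>_def)
  then have "\<sigma> \<noteq> 0" using nontriv by (auto simp: \<mu>_def)
  then have \<sigma>: "\<sigma> > 0" using nrm_nonneg[of M "\<lambda>x. indicator B x - \<mu>"] by (simp add: \<sigma>_def less_le)
  define Q where "Q = {p \<in> strip_pos \<beta> b. nrm M (\<lambda>x. indicator B (T p x) - indicator B x) < \<sigma> / 2}"
  have half: "\<sigma> / 2 > 0" using \<sigma> by simp
  obtain \<kappa> k0 where \<kappa>: "\<kappa> > 0" "\<And>k. k \<ge> k0 \<Longrightarrow> \<kappa> * real k \<le> real (card (Q \<inter> ({0..int k - 1} \<times> UNIV)))"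
    by (rule almost_periods_linear_growth[OF b B half, folded Q_def]) (rule that)
  have sub: "Q \<subseteq> strip_pos \<beta> b" by (auto simp: Q_def)
  have inf: "infinite Q"
  proof
    assume fin: "finite Q"
    obtain k :: nat where k: "real (card Q) / \<kappa> < real k" using reals_Archimedean2 by blast
    have "real (card Q) < \<kappa> * real (max k k0)"
    proof -
      have "real (card Q) / \<kappa> < real (max k k0)" using k by simp
      then show ?thesis using \<kappa>(1) by (simp add: divide_less_eq mult.commute)
    qed
    also have "\<dots> \<le> real (card (Q \<inter> ({0..int (max k k0) - 1} \<times> UNIV)))" by (rule \<kappa>(2)) simp
    also have "\<dots> \<le> real (card Q)" using fin by (auto intro: card_mono)
    finally show False by simp
  qed
  obtain q where q: "enumerates q Q"
    by (rule enumerates_exists[OF sub inf less_imp_le[OF b]]) (rule that)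
  \<comment> \<open>Linear growth of \<open>Q\<close> is compared with the upper bound
    \<open>(2 * b + 1) * k\<close> for the whole strip.\<close>
  have dens: "lower_density \<beta> b Q > 0"
  proof -
    have "\<forall>\<^sub>F k in sequentially. ereal (\<kappa> / (2 * b + 1))
        \<le> ereal (real (card (Q \<inter> ({0..int k - 1} \<times> UNIV))) / real (card (strip_upto \<beta> b k)))"
      using eventually_ge_at_top[of "max 1 k0"]
    proof eventually_elim
      case (elim k)
      have k: "\<kappa> * real k \<le> real (card (Q \<inter> ({0..int k - 1} \<times> UNIV)))" using \<kappa>(2) elim by simp
      have "Q \<inter> ({0..int k - 1} \<times> UNIV) \<subseteq> strip_upto \<beta> b k"
        using sub by (auto simp: strip_pos_def strip_upto_def)
      then have "card (Q \<inter> ({0..int k - 1} \<times> UNIV)) \<le> card (strip_upto \<beta> b k)"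
        using b by (intro card_mono strip_upto_bounds) auto
      moreover have "0 < \<kappa> * real k" using \<kappa>(1) elim by simp
      ultimately have pos: "0 < real (card (strip_upto \<beta> b k))" using k by linarith
      have "\<kappa> / (2 * b + 1) * real (card (strip_upto \<beta> b k)) \<le> \<kappa> / (2 * b + 1) * ((2 * b + 1) * real k)"
        using b \<kappa>(1) by (intro mult_left_mono strip_upto_bounds) auto
      also have "\<dots> = \<kappa> * real k" using b by simp
      finally show ?case using k pos by (simp add: le_divide_eq)
    qed
    then have "ereal (\<kappa> / (2 * b + 1)) \<le> lower_density \<beta> b Q"
      unfolding lower_density_def by (rule Liminf_bounded)
    moreover have "0 < ereal (\<kappa> / (2 * b + 1))" using \<kappa>(1) b by simp
    ultimately show ?thesis by (rule order_less_le_trans[rotated])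
  qed
  let ?h = "\<lambda>N x. (1 / of_nat N) * (\<Sum>i<N. koopman T (q i) (indicator B) x) - (\<integral>y. indicator B y \<partial>M) :: complex"
  have big: "\<sigma> / 2 \<le> L2_norm M (?h (Suc N))" for N
  proof -
    let ?A = "\<lambda>x. \<Sum>i<Suc N. (1 / real (Suc N)) * indicator B (T (q i) x)"
    have AL: "?A \<in> L2_real M" by (intro L2_real_sum L2_real_T iB)
    have "?h (Suc N) = (\<lambda>x. complex_of_real (?A x - \<mu>))"
    proof
      fix x
      have ind: "(indicator B y :: complex) = complex_of_real (indicator B y)" for y by (simp add: indicator_def)
      have "(\<integral>y. (indicator B y :: complex) \<partial>M) = complex_of_real \<mu>"
        unfolding ind by (simp add: \<mu>_def)
      then show "?h (Suc N) x = complex_of_real (?A x - \<mu>)"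
        unfolding sum_distrib_left[symmetric] koopman_def comp_def ind
        by (simp del: of_nat_Suc sum.lessThan_Suc)
    qed
    then have h: "L2_norm M (?h (Suc N)) = nrm M (\<lambda>x. ?A x - \<mu>)" by (simp only: L2_norm_of_real)
    have "nrm M (\<lambda>x. ?A x - indicator B x)
        = nrm M (\<lambda>x. \<Sum>i<Suc N. (1 / real (Suc N)) * (indicator B (T (q i) x) - indicator B x))"
      unfolding sum_distrib_left[symmetric] sum_subtractf sum_constant card_lessThan
      by (simp add: right_diff_distrib del: of_nat_Suc sum.lessThan_Suc)
    also have "\<dots> \<le> (\<Sum>i<Suc N. \<bar>1 / real (Suc N)\<bar> * nrm M (\<lambda>x. indicator B (T (q i) x) - indicator B x))"
      by (intro nrm_sum L2_real_diff L2_real_T iB)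
    also have "\<dots> \<le> (\<Sum>i<Suc N. \<bar>1 / real (Suc N)\<bar> * (\<sigma> / 2))"
    proof (intro sum_mono mult_left_mono)
      fix i
      have "q i \<in> Q" using q by (auto simp: enumerates_def bij_betw_def)
      then show "nrm M (\<lambda>x. indicator B (T (q i) x) - indicator B x) \<le> \<sigma> / 2" by (simp add: Q_def)
    qed simp
    also have "\<dots> = \<sigma> / 2" by (simp del: of_nat_Suc sum.lessThan_Suc)
    finally have "nrm M (\<lambda>x. indicator B x - ?A x) \<le> \<sigma> / 2" by (subst nrm_diff_commute)
    moreover have "\<sigma> \<le> nrm M (\<lambda>x. indicator B x - ?A x) + nrm M (\<lambda>x. ?A x - \<mu>)"
      unfolding \<sigma>_def by (rule nrm_diff_triangle[OF iB AL cB])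
    ultimately show ?thesis unfolding h by linarith
  qed
  have "\<not> (\<lambda>N. L2_norm M (?h N)) \<longlonglongrightarrow> 0"
  proof
    assume "(\<lambda>N. L2_norm M (?h N)) \<longlonglongrightarrow> 0"
    then have "(\<lambda>N. L2_norm M (?h (Suc N))) \<longlonglongrightarrow> 0" by (rule LIMSEQ_Suc)
    then have "\<sigma> / 2 \<le> 0" by (rule LIMSEQ_le_const) (use big in blast)
    with \<sigma> show False by simp
  qed
  with sub inf q dens show thesis by (rule that)
qed

end

theorem theorem1p5:
  fixes M :: "'a :: metric_space measure"
    and T :: "int \<times> int \<Rightarrow> 'a \<Rightarrow> 'a"
    and \<beta> b :: real
  assumes "Z2_system M T"
    and "\<beta> \<notin> \<rat>"
    and "b > 0"
  shows "directionally_weakly_mixing M T \<beta> \<longleftrightarrow>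
    (\<forall>Q q. Q \<subseteq> strip_pos \<beta> b \<longrightarrow> infinite Q \<longrightarrow> enumerates q Q \<longrightarrow> lower_density \<beta> b Q > 0 \<longrightarrow>
      (\<forall>f \<in> L2_fun M.
        (\<lambda>N. L2_norm M (\<lambda>x. (1 / of_nat N) * (\<Sum>i<N. koopman T (q i) f x) - (\<integral>y. f y \<partial>M)))
          \<longlonglongrightarrow> 0))" (is "?wm \<longleftrightarrow> ?avg")
proof -
  interpret Z2_system M T by fact
  show ?thesis
  proof
    assume ?wm
    then show ?avg by (intro allI impI ballI weakly_mixing_average[OF _ \<open>b > 0\<close>])
  next
    assume avg: ?avg
    show ?wm
      unfolding directionally_weakly_mixing_def
    proof (rule ballI, rule ccontr)
      fix B assume B: "B \<in> directional_kronecker M T \<beta>"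
        and nontriv: "\<not> (measure M B = 0 \<or> measure M B = 1)"
      then have "measure M B \<noteq> 0" "measure M B \<noteq> 1" by simp_all
      then obtain Q q where Q: "Q \<subseteq> strip_pos \<beta> b" "infinite Q" "enumerates q Q" "lower_density \<beta> b Q > 0"
        and no: "\<not> (\<lambda>N. L2_norm M (\<lambda>x. (1 / of_nat N) * (\<Sum>i<N. koopman T (q i) (indicator B) x)
          - (\<integral>y. indicator B y \<partial>M))) \<longlonglongrightarrow> 0"
        by (rule kronecker_average_not_convergent[OF \<open>b > 0\<close> B]) (rule that)
      have "B \<in> sets M" using B by (simp add: directional_kronecker_def)
      then have ind: "indicator B \<in> L2_fun M" by (rule indicator_L2_fun)
      have "(\<lambda>N. L2_norm M (\<lambda>x. (1 / of_nat N) * (\<Sum>i<N. koopman T (q i) (indicator B) x)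
          - (\<integral>y. indicator B y \<partial>M))) \<longlonglongrightarrow> 0" by (rule avg[rule_format, OF Q ind])
      with no show False by contradiction
    qed
  qed
qed

end
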